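(* Let $\Phi$ be a symmetric norming function, let $1<q\leqslant2\leqslant p<+\infty$ satisfy $\frac1p+\frac1q=1$, and let $\mathscr{A}\in L^q_s(\Omega,\mu,\mathcal{B}(\mathcal{H}))$ and $\mathscr{B}\in L^p_G(\Omega,\mu,\mathcal{B}(\mathcal{H}))$ be such that $\mathscr{B}_t\in\mathcal{C}_{\Phi^{(p)}}^{(\circ)}(\mathcal{H})$ for every $t\in\Omega$ and $\int_\Omega|\mathscr{B}|^p\,d\mu\in\mathcal{C}_\Phi^{(\circ)}(\mathcal{H})$. Then $\mathscr{A}^*\mathscr{B}\in\mathbb{P}(\Omega,\mu,\mathcal{C}_{\Phi^{(p)}}^{(\circ)}(\mathcal{H}))$ and $$\|\mathscr{A}^*\mathscr{B}\|_{\mathbb{P}(\Omega,\mu,\mathcal{C}_{\Phi^{(p)}}^{(\circ)}(\mathcal{H}))}\leqslant\|\mathscr{A}\|_{L^q_s}\cdot\big\|\,|\mathscr{B}|^p\,\big\|^{\frac1p}_{\mathbb{P}(\Omega,\mu,\mathcal{C}_{\Phi}^{(\circ)}(\mathcal{H}))}.$$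
   Context: $\mathcal{H}$ is an infinite-dimensional separable complex Hilbert space, $\mathcal{B}(\mathcal{H})$ the bounded linear operators on it, $|A|=\sqrt{A^*A}$. $(\Omega,\mathfrak{M},\mu)$ is a measure space with complete measure $\mu$ (not assumed finite). Symmetric norming (s.n.) function: a norm $\Phi$ on finitely supported sequences with $\Phi(1,0,0,\dots)=1$, depending only on the absolute values of the entries and invariant under permutations of the entries. It is extended by $\Phi(a)=\lim_n\Phi(a_1,\dots,a_n,0,0,\dots)$, and $\mathfrak{c}_\Phi$ is the set of complex sequences $a$ converging to $0$ with $\Phi(a)<+\infty$. $\mathcal{C}_\Phi(\mathcal{H})$ is the ideal of compact operators $A$ whose singular value sequence $(s_n(A))_{n\ge1}$ lies in $\mathfrak{c}_\Phi$, with norm $\|A\|_\Phi=\Phi((s_n(A))_n)$. $\mathcal{C}_\Phi^{(\circ)}(\mathcal{H})$ is the $\|\cdot\|_\Phi$-closure of the finite-rank operators in $\mathcal{C}_\Phi(\mathcal{H})$. For $1\le p<\infty$ the $p$-modification of $\Phi$ is the s.n. function $\Phi^{(p)}((z_n)_n)=\Phi((|z_n|^p)_n)^{1/p}$. A scalar function on $\Omega$ is $\mu$-measurable if it is a $\mu$-a.e. limit of $\mu$-simple functions $\sum_{k=1}^m x_k\chi_{A_k}$ with $A_k\in\mathfrak{M}$ disjoint of finite measure. $\mathscr{A}\colon\Omega\to\mathcal{B}(\mathcal{H})$, $t\mapsto\mathscr{A}_t$, is weakly$^*$ $\mu$-measurable (weakly$^*$ integrable) if for every $f\in\mathcal{H}$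 the function $t\mapsto\langle\mathscr{A}_tf,f\rangle$ is $\mu$-measurable (resp. also integrable). In the integrable case the weak$^*$ integral $\int_E\mathscr{A}\,d\mu\in\mathcal{B}(\mathcal{H})$, $E\in\mathfrak{M}$, is the unique operator with $\langle(\int_E\mathscr{A}\,d\mu)f,g\rangle=\int_E\langle\mathscr{A}_tf,g\rangle\,d\mu(t)$ for all $f,g\in\mathcal{H}$. Operations are pointwise: $(\mathscr{A}^*\mathscr{B})_t=\mathscr{A}_t^*\mathscr{B}_t$, $(|\mathscr{B}|^p)_t=|\mathscr{B}_t|^p$. $L^q_s(\Omega,\mu,\mathcal{B}(\mathcal{H}))$ is the space of weakly$^*$ $\mu$-measurable $\mathscr{A}$ with $\int_\Omega\|\mathscr{A}_tf\|^q\,d\mu(t)<+\infty$ for all $f\in\mathcal{H}$, normed by $\|\mathscr{A}\|_{L^q_s}=\sup_{\|f\|=1}\left(\int_\Omega\|\mathscr{A}_tf\|^q\,d\mu(t)\right)^{1/q}$. $L^p_G(\Omega,\mu,\mathcal{B}(\mathcal{H}))$ is the class of weakly$^*$ $\mu$-measurable $\mathscr{B}$ such that $|\mathscr{B}|^p$ is weakly$^*$ integrable. For a Banach space $X$, $\varphi\colon\Omega\to X$ is Pettis integrable ($\varphi\in\mathbb{P}(\Omega,\mu,X)$) if $t\mapsto\langle\varphi(t),x^*\rangle$ is $\mu$-measurable and integrable for every $x^*\in X^*$ and for every $E\in\mathfrak{M}$ there is $\varphi_E\in X$ with $\langle\varphi_E,x^*\rangle=\int_E\langle\varphi(t),x^*\rangle\,d\mu(t)$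 for every $x^*\in X^*$. The Pettis norm is $\|\varphi\|_{\mathbb{P}(\Omega,\mu,X)}=\sup_{\|x^*\|_{X^*}=1}\int_\Omega|\langle\varphi(t),x^*\rangle|\,d\mu(t)$. *)

theory Defs
  imports "HOL-Analysis.Analysis" "HOL-Computational_Algebra.Polynomial"
begin

section \<open>Complex Hilbert spaces\<close>

class complex_vector = real_vector +
  fixes scaleC :: "complex \<Rightarrow> 'a \<Rightarrow> 'a"  (infixr \<open>*\<^sub>C\<close> 75)
  assumes scaleC_add_right: "c *\<^sub>C (x + y) = c *\<^sub>C x + c *\<^sub>C y"
    and scaleC_add_left: "(c + d) *\<^sub>C x = c *\<^sub>C x + d *\<^sub>C x"
    and scaleC_scaleC: "c *\<^sub>C (d *\<^sub>C x) = (c * d) *\<^sub>C x"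
    and scaleR_scaleC: "r *\<^sub>R x = complex_of_real r *\<^sub>C x"

lemma scaleC_one: "1 *\<^sub>C x = (x :: 'a::complex_vector)"
  using scaleR_scaleC[of 1 x] by simp

interpretation complex_vs: vector_space "scaleC :: complex \<Rightarrow> 'a \<Rightarrow> 'a::complex_vector"
  by unfold_locales (simp_all add: scaleC_add_right scaleC_add_left scaleC_scaleC scaleC_one)

definition cspan :: "'a::complex_vector set \<Rightarrow> 'a set"
  where "cspan = module.span scaleC"

definition cdim :: "'a::complex_vector set \<Rightarrow> nat"
  where "cdim = vector_space.dim scaleC"

text \<open>The inner product is linear in the first argument. Positive definiteness follows from
  \<open>norm_eq_sqrt_cinner\<close> and the norm axioms, since \<^term>\<open>sqrt\<close> is negative on negative reals.\<close>

class complex_inner = complex_vector + real_normed_vector +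
  fixes cinner :: "'a \<Rightarrow> 'a \<Rightarrow> complex"
  assumes cinner_add_left: "cinner (x + y) z = cinner x z + cinner y z"
    and cinner_scaleC_left: "cinner (c *\<^sub>C x) y = c * cinner x y"
    and cinner_commute: "cinner x y = cnj (cinner y x)"
    and norm_eq_sqrt_cinner: "norm x = sqrt (Re (cinner x x))"

class complex_hilbert = complex_inner + complete_space

lemma norm_scaleC: "norm (c *\<^sub>C x) = cmod c * norm (x :: 'a::complex_inner)"
proof -
  have *: "cinner y (c *\<^sub>C x) = cnj c * cinner y x" for y :: 'a
    by (metis cinner_commute cinner_scaleC_left complex_cnj_mult)
  have "cinner (c *\<^sub>C x) (c *\<^sub>C x) = complex_of_real ((cmod c)\<^sup>2) * cinner x x"
    by (simp add: cinner_scaleC_left * complex_norm_square mult_ac del: of_real_power)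
  then have "Re (cinner (c *\<^sub>C x) (c *\<^sub>C x)) = (cmod c)\<^sup>2 * Re (cinner x x)"
    by simp
  then show ?thesis
    by (simp add: norm_eq_sqrt_cinner real_sqrt_mult)
qed

lemma bounded_linear_scaleC_right: "bounded_linear (\<lambda>x :: 'a::complex_inner. c *\<^sub>C x)"
  by (rule bounded_linear_intro[where K = "cmod c"])
    (simp_all add: scaleC_add_right scaleR_scaleC scaleC_scaleC norm_scaleC mult.commute)

instantiation blinfun :: (real_normed_vector, complex_inner) complex_vector
begin

lift_definition scaleC_blinfun :: "complex \<Rightarrow> 'a \<Rightarrow>\<^sub>L 'b \<Rightarrow> 'a \<Rightarrow>\<^sub>L 'b"
  is "\<lambda>c f x. c *\<^sub>C f x"
  by (rule bounded_linear_compose[OF bounded_linear_scaleC_right])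

instance
  by standard
    (transfer, simp add: scaleC_add_right scaleC_add_left scaleC_scaleC scaleR_scaleC)+

end

definition infinite_dimensional :: "'a::complex_vector itself \<Rightarrow> bool"
  where "infinite_dimensional TYPE('a) \<longleftrightarrow> (\<nexists>S :: 'a set. finite S \<and> cspan S = UNIV)"

section \<open>Bounded operators\<close>

text \<open>The library type of bounded linear maps is real linear; \<open>B(H)\<close> is the set of its complex
  linear elements. The operator norm is the same.\<close>

definition bop :: "('h::complex_hilbert \<Rightarrow>\<^sub>L 'h) set"
  where "bop = {A :: 'h \<Rightarrow>\<^sub>L 'h. \<forall>c x. A (c *\<^sub>C x) = c *\<^sub>C A x}"

definition adj :: "'h::complex_hilbert \<Rightarrow>\<^sub>L 'h \<Rightarrow> 'h \<Rightarrow>\<^sub>L 'h"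
  where "adj A = (THE S :: 'h \<Rightarrow>\<^sub>L 'h. \<forall>x y. cinner (A x) y = cinner x (S y))"

definition poly_op :: "real poly \<Rightarrow> 'h::complex_hilbert \<Rightarrow>\<^sub>L 'h \<Rightarrow> 'h \<Rightarrow>\<^sub>L 'h"
  where "poly_op P T = (\<Sum>i\<le>degree P. coeff P i *\<^sub>R (((o\<^sub>L) T ^^ i) id_blinfun))"

text \<open>Continuous functional calculus \<open>f(T)\<close> for a positive operator \<open>T\<close>, whose spectrum lies in
  \<open>[0, \<parallel>T\<parallel>]\<close>, and \<open>f\<close> continuous on that interval: the norm limit of \<open>P\<^sub>n(T)\<close> for polynomials
  \<open>P\<^sub>n\<close> converging to \<open>f\<close> uniformly on the interval.\<close>

definition fun_calc :: "(real \<Rightarrow> real) \<Rightarrow> 'h::complex_hilbert \<Rightarrow>\<^sub>L 'h \<Rightarrow> 'h \<Rightarrow>\<^sub>L 'h"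
  where "fun_calc f T = (THE S. \<forall>P :: nat \<Rightarrow> real poly.
    uniform_limit {0..norm T} (\<lambda>n. poly (P n)) f sequentially
      \<longrightarrow> (\<lambda>n. poly_op (P n) T) \<longlonglongrightarrow> S)"

definition op_abs :: "'h::complex_hilbert \<Rightarrow>\<^sub>L 'h \<Rightarrow> 'h \<Rightarrow>\<^sub>L 'h"
  where "op_abs A = fun_calc sqrt (adj A o\<^sub>L A)"

definition abs_powr :: "'h::complex_hilbert \<Rightarrow>\<^sub>L 'h \<Rightarrow> real \<Rightarrow> 'h \<Rightarrow>\<^sub>L 'h"
  where "abs_powr A p = fun_calc (\<lambda>x. x powr p) (op_abs A)"

definition compact_op :: "'h::complex_hilbert \<Rightarrow>\<^sub>L 'h \<Rightarrow> bool"
  where "compact_op A \<longleftrightarrow> A \<in> bop \<and> compact (closure (A ` cball 0 1))"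

definition finite_rank :: "'h::complex_hilbert \<Rightarrow>\<^sub>L 'h \<Rightarrow> bool"
  where "finite_rank A \<longleftrightarrow> A \<in> bop \<and> (\<exists>S. finite S \<and> range A \<subseteq> cspan S)"

text \<open>Singular values of a compact operator: the positive eigenvalues of \<open>|A|\<close> in nonincreasing
  order, repeated according to multiplicity and followed by zeros if there are only finitely many.
  The numbering starts at \<open>0\<close>.\<close>

definition sing_val :: "'h::complex_hilbert \<Rightarrow>\<^sub>L 'h \<Rightarrow> nat \<Rightarrow> real"
  where "sing_val A = (THE s. antimono s \<and> (\<forall>n. 0 \<le> s n) \<and>
    (\<forall>l>0. finite {n. s n = l} \<and> card {n. s n = l} = cdim {x. op_abs A x = l *\<^sub>R x}))"

section \<open>Symmetric norming functions and the associated ideals\<close>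

definition fin_supp :: "(nat \<Rightarrow> complex) set"
  where "fin_supp = {a. finite {n. a n \<noteq> 0}}"

definition sn_function :: "((nat \<Rightarrow> complex) \<Rightarrow> real) \<Rightarrow> bool"
  where "sn_function \<Phi> \<longleftrightarrow>
    (\<forall>a\<in>fin_supp. 0 \<le> \<Phi> a \<and> (\<Phi> a = 0 \<longleftrightarrow> a = (\<lambda>_. 0))) \<and>
    (\<forall>a\<in>fin_supp. \<forall>c. \<Phi> (\<lambda>n. c * a n) = cmod c * \<Phi> a) \<and>
    (\<forall>a\<in>fin_supp. \<forall>b\<in>fin_supp. \<Phi> (\<lambda>n. a n + b n) \<le> \<Phi> a + \<Phi> b) \<and>
    \<Phi> (\<lambda>n. if n = 0 then 1 else 0) = 1 \<and>
    (\<forall>a\<in>fin_supp. \<Phi> (\<lambda>n. complex_of_real (cmod (a n))) = \<Phi> a) \<and>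
    (\<forall>a\<in>fin_supp. \<forall>\<sigma>. bij \<sigma> \<longrightarrow> \<Phi> (\<lambda>n. a (\<sigma> n)) = \<Phi> a)"

definition sn_ext :: "((nat \<Rightarrow> complex) \<Rightarrow> real) \<Rightarrow> (nat \<Rightarrow> complex) \<Rightarrow> ennreal"
  where "sn_ext \<Phi> a = lim (\<lambda>n. ennreal (\<Phi> (\<lambda>k. if k < n then a k else 0)))"

definition sn_space :: "((nat \<Rightarrow> complex) \<Rightarrow> real) \<Rightarrow> (nat \<Rightarrow> complex) set"
  where "sn_space \<Phi> = {a. a \<longlonglongrightarrow> 0 \<and> sn_ext \<Phi> a < \<infinity>}"

definition p_mod :: "((nat \<Rightarrow> complex) \<Rightarrow> real) \<Rightarrow> real \<Rightarrow> (nat \<Rightarrow> complex) \<Rightarrow> real"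
  where "p_mod \<Phi> p = (\<lambda>z. \<Phi> (\<lambda>n. complex_of_real (cmod (z n) powr p)) powr (1 / p))"

definition sn_ideal :: "((nat \<Rightarrow> complex) \<Rightarrow> real) \<Rightarrow> ('h::complex_hilbert \<Rightarrow>\<^sub>L 'h) set"
  where "sn_ideal \<Phi> =
    {A. compact_op A \<and> (\<lambda>n. complex_of_real (sing_val A n)) \<in> sn_space \<Phi>}"

definition sn_norm :: "((nat \<Rightarrow> complex) \<Rightarrow> real) \<Rightarrow> 'h::complex_hilbert \<Rightarrow>\<^sub>L 'h \<Rightarrow> real"
  where "sn_norm \<Phi> A = enn2real (sn_ext \<Phi> (\<lambda>n. complex_of_real (sing_val A n)))"

definition sn_ideal0 :: "((nat \<Rightarrow> complex) \<Rightarrow> real) \<Rightarrow> ('h::complex_hilbert \<Rightarrow>\<^sub>L 'h) set"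
  where "sn_ideal0 \<Phi> = {A \<in> sn_ideal \<Phi>.
    \<forall>e>0. \<exists>F\<in>sn_ideal \<Phi>. finite_rank F \<and> sn_norm \<Phi> (A - F) < e}"

section \<open>Measurability and integrals\<close>

definition mu_simple :: "'t measure \<Rightarrow> ('t \<Rightarrow> complex) \<Rightarrow> bool"
  where "mu_simple M s \<longleftrightarrow> (\<exists>(m::nat) x E.
    (\<forall>k<m. E k \<in> sets M \<and> emeasure M (E k) < \<infinity>) \<and> disjoint_family_on E {..<m} \<and>
    (\<forall>t\<in>space M. s t = (\<Sum>k<m. x k * indicator (E k) t)))"

definition mu_measurable :: "'t measure \<Rightarrow> ('t \<Rightarrow> complex) \<Rightarrow> bool"
  where "mu_measurable M f \<longleftrightarrow>
    (\<exists>s. (\<forall>n. mu_simple M (s n)) \<and> (AE t in M. (\<lambda>n. s n t) \<longlonglongrightarrow> f t))"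

definition wstar_measurable :: "'t measure \<Rightarrow> ('t \<Rightarrow> 'h::complex_hilbert \<Rightarrow>\<^sub>L 'h) \<Rightarrow> bool"
  where "wstar_measurable M A \<longleftrightarrow>
    (\<forall>t\<in>space M. A t \<in> bop) \<and> (\<forall>f. mu_measurable M (\<lambda>t. cinner (A t f) f))"

definition wstar_integrable :: "'t measure \<Rightarrow> ('t \<Rightarrow> 'h::complex_hilbert \<Rightarrow>\<^sub>L 'h) \<Rightarrow> bool"
  where "wstar_integrable M A \<longleftrightarrow>
    wstar_measurable M A \<and> (\<forall>f. integrable M (\<lambda>t. cinner (A t f) f))"

definition wstar_integral ::
    "'t measure \<Rightarrow> 't set \<Rightarrow> ('t \<Rightarrow> 'h::complex_hilbert \<Rightarrow>\<^sub>L 'h) \<Rightarrow> 'h \<Rightarrow>\<^sub>L 'h"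
  where "wstar_integral M E A =
    (THE T. T \<in> bop \<and> (\<forall>f g. cinner (T f) g = (LINT t:E|M. cinner (A t f) g)))"

text \<open>Powers with positive real exponent on \<open>[0, \<infinity>]\<close>.\<close>

definition enn_powr :: "ennreal \<Rightarrow> real \<Rightarrow> ennreal"
  where "enn_powr x r = (if x = \<infinity> then \<infinity> else ennreal (enn2real x powr r))"

definition Lqs :: "'t measure \<Rightarrow> real \<Rightarrow> ('t \<Rightarrow> 'h::complex_hilbert \<Rightarrow>\<^sub>L 'h) set"
  where "Lqs M q = {A. wstar_measurable M A \<and>
    (\<forall>f. (\<integral>\<^sup>+t. ennreal (norm (A t f) powr q) \<partial>M) < \<infinity>)}"

definition Lqs_norm :: "'t measure \<Rightarrow> real \<Rightarrow> ('t \<Rightarrow> 'h::complex_hilbert \<Rightarrow>\<^sub>L 'h) \<Rightarrow> ennreal"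
  where "Lqs_norm M q A =
    (SUP f\<in>{f. norm f = 1}. enn_powr (\<integral>\<^sup>+t. ennreal (norm (A t f) powr q) \<partial>M) (1 / q))"

definition LpG :: "'t measure \<Rightarrow> real \<Rightarrow> ('t \<Rightarrow> 'h::complex_hilbert \<Rightarrow>\<^sub>L 'h) set"
  where "LpG M p = {B. wstar_measurable M B \<and> wstar_integrable M (\<lambda>t. abs_powr (B t) p)}"

section \<open>Pettis integrability\<close>

text \<open>A Banach space is given by its carrier \<open>X\<close> inside a complex vector space and its norm \<open>N\<close>
  on \<open>X\<close>. Functionals are total functions of which only the values on \<open>X\<close> matter.\<close>

definition dual_space ::
    "'v::complex_vector set \<Rightarrow> ('v \<Rightarrow> real) \<Rightarrow> ('v \<Rightarrow> complex) set"
  where "dual_space X N = {h. (\<forall>u\<in>X. \<forall>v\<in>X. h (u + v) = h u + h v) \<and>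
    (\<forall>c. \<forall>u\<in>X. h (c *\<^sub>C u) = c * h u) \<and> (\<exists>C. \<forall>u\<in>X. cmod (h u) \<le> C * N u)}"

definition dual_norm :: "'v::complex_vector set \<Rightarrow> ('v \<Rightarrow> real) \<Rightarrow> ('v \<Rightarrow> complex) \<Rightarrow> real"
  where "dual_norm X N h = (SUP u\<in>{u\<in>X. N u \<le> 1}. cmod (h u))"

definition pettis_integrable ::
    "'t measure \<Rightarrow> 'v::complex_vector set \<Rightarrow> ('v \<Rightarrow> real) \<Rightarrow> ('t \<Rightarrow> 'v) \<Rightarrow> bool"
  where "pettis_integrable M X N \<phi> \<longleftrightarrow>
    (\<forall>t\<in>space M. \<phi> t \<in> X) \<and>
    (\<forall>h\<in>dual_space X N. mu_measurable M (\<lambda>t. h (\<phi> t)) \<and> integrable M (\<lambda>t. h (\<phi> t))) \<and>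
    (\<forall>E\<in>sets M. \<exists>v\<in>X. \<forall>h\<in>dual_space X N. h v = (LINT t:E|M. h (\<phi> t)))"

definition pettis_norm ::
    "'t measure \<Rightarrow> 'v::complex_vector set \<Rightarrow> ('v \<Rightarrow> real) \<Rightarrow> ('t \<Rightarrow> 'v) \<Rightarrow> ennreal"
  where "pettis_norm M X N \<phi> =
    (SUP h\<in>{h\<in>dual_space X N. dual_norm X N h = 1}. \<integral>\<^sup>+t. ennreal (cmod (h (\<phi> t))) \<partial>M)"

end

theory Submission
  imports Defs "HOL-Computational_Algebra.Fundamental_Theorem_Algebra"
begin

text \<open>The ideal norm of a compact operator \<open>A\<close> is the supremum of
  \<open>\<Phi> ((\<langle>A e\<^sub>i, f\<^sub>i\<rangle>)\<^sub>i)\<close> over finite families \<open>e\<close>, \<open>f\<close> that satisfy Bessel's inequality;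
  all ideal properties follow from this formula. For a bounded measurable phase \<open>\<theta>\<close> put
  \<open>Z = \<integral> \<theta> \<A>\<^sup>* \<B> d\<mu>\<close> and \<open>T = \<integral> |\<B>|\<^sup>p d\<mu>\<close>. Hoelder's inequality and
  \<open>\<parallel>\<B>\<^sub>t e\<parallel>\<^sup>p \<le> \<langle>|\<B>\<^sub>t|\<^sup>p e, e\<rangle>\<close> give
  \<open>|\<langle>Z e, f\<rangle>| \<le> \<parallel>\<A>\<parallel> \<langle>T e, e\<rangle>\<^bsup>1/p\<^esup>\<close> for \<open>e\<close>, \<open>f\<close> in the unit ball, so the
  \<open>p\<close>-modified norm of \<open>Z\<close> is at most \<open>\<parallel>\<A>\<parallel> \<parallel>T\<parallel>\<^bsup>1/p\<^esup>\<close>. A functional \<open>h\<close> on the ideal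
  is determined by truncations to finitely many matrix entries, on which it commutes with the weak
  integral; a suitable \<open>\<theta>\<close> then bounds \<open>\<integral> |h (\<A>\<^sup>* \<B>)| d\<mu>\<close>. Conversely, norming functionals
  built from a Schmidt decomposition of \<open>T\<close> bound \<open>\<parallel>T\<parallel>\<close> by the Pettis norm of \<open>|\<B>|\<^sup>p\<close>.\<close>

section \<open>Complex Hilbert spaces\<close>

text \<open>The obstacle is that a functional h on the ideal comes without a formula: nothing shows
  in advance that h(A_t^* B_t) is measurable or integrable in t, nor that the weak integral Z lies
  in the closure of the finite-rank operators. One device settles all of this: multiply on the right
  by finite-rank projections P_n that converge strongly to the identity, and put Q_n = 1 - P_n. The
  entry estimate localises, so that Z Q_n is governed by the compression Q_n T Q_n, whose norm tends
  to 0 because T is a norm limit of finite-rank operators. This makes the tails of Z and of the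
  integral of |h(A_t^* B_t Q_n)| small together, although the pointwise convergence of A_t^* B_t Q_n
  to 0 has no uniformity in t. The condition p >= 2 enters through Jensen's inequality, as convexity
  of u^(p/2) in u. Adjoint, functional calculus, singular values and weak integrals are definite
  descriptions, each of which must first be shown to be meaningful. For the functional calculus this
  rests on bounding the norm of P(T) by the supremum of |P|, which is done by locating complex roots
  of P^2 - N^2, where N is the norm of P(T).\<close>

lemma cinner_add_right: "cinner x (y + z) = cinner x y + cinner x (z::'a::complex_inner)"
  by (metis cinner_add_left cinner_commute complex_cnj_add)

lemma cinner_scaleC_right: "cinner x (c *\<^sub>C y) = cnj c * cinner x (y::'a::complex_inner)"
  by (metis cinner_commute cinner_scaleC_left complex_cnj_mult)

lemma cinner_scaleR_left: "cinner (r *\<^sub>R x) y = of_real r * cinner x (y::'a::complex_inner)"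
  by (simp add: scaleR_scaleC cinner_scaleC_left)

lemma cinner_scaleR_right: "cinner x (r *\<^sub>R y) = of_real r * cinner x (y::'a::complex_inner)"
  by (simp add: scaleR_scaleC cinner_scaleC_right)

lemma cinner_zero_left [simp]: "cinner 0 (y::'a::complex_inner) = 0"
  using cinner_scaleR_left[of 0] by simp

lemma cinner_zero_right [simp]: "cinner (y::'a::complex_inner) 0 = 0"
  using cinner_scaleR_right[of _ 0] by simp

lemma cinner_minus_left: "cinner (- x) y = - cinner x (y::'a::complex_inner)"
  using cinner_scaleR_left[of "-1" x y] by simp

lemma cinner_minus_right: "cinner x (- y) = - cinner x (y::'a::complex_inner)"
  using cinner_scaleR_right[of x "-1" y] by simp

lemma cinner_diff_left: "cinner (x - y) z = cinner x z - cinner y (z::'a::complex_inner)"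
  using cinner_add_left[of x "- y" z] by (simp add: cinner_minus_left)

lemma cinner_diff_right: "cinner x (y - z) = cinner x y - cinner x (z::'a::complex_inner)"
  using cinner_add_right[of x y "- z"] by (simp add: cinner_minus_right)

lemma cinner_sum_left: "cinner (\<Sum>i\<in>I. f i) y = (\<Sum>i\<in>I. cinner (f i) (y::'a::complex_inner))"
  by (induction I rule: infinite_finite_induct) (simp_all add: cinner_add_left)

lemma cinner_sum_right: "cinner y (\<Sum>i\<in>I. f i) = (\<Sum>i\<in>I. cinner (y::'a::complex_inner) (f i))"
  by (induction I rule: infinite_finite_induct) (simp_all add: cinner_add_right)

lemmas cinner_simps = cinner_add_left cinner_add_right cinner_diff_left cinner_diff_right
  cinner_scaleC_left cinner_scaleC_right cinner_scaleR_left cinner_scaleR_right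
  cinner_minus_left cinner_minus_right

lemma cinner_self: "cinner x x = of_real ((norm (x::'a::complex_inner))\<^sup>2)"
proof -
  have "0 \<le> sqrt (Re (cinner x x))"
    by (metis norm_eq_sqrt_cinner norm_ge_zero)
  then have "Re (cinner x x) = (norm x)\<^sup>2"
    by (simp add: norm_eq_sqrt_cinner)
  moreover have "Im (cinner x x) = 0"
    using arg_cong[OF cinner_commute[of x x], of Im] by simp
  ultimately show ?thesis
    by (simp add: complex_eq_iff del: of_real_power)
qed

lemma cinner_self_Re: "Re (cinner x x) = (norm (x::'a::complex_inner))\<^sup>2"
  by (simp add: cinner_self flip: of_real_power)

lemma scaleC_zero_left [simp]: "0 *\<^sub>C (x::'a::complex_vector) = 0"
  by (rule complex_vs.scale_zero_left)

lemma scaleC_zero_right [simp]: "c *\<^sub>C (0::'a::complex_vector) = 0"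
  by (rule complex_vs.scale_zero_right)

lemma scaleC_minus_left: "(- c) *\<^sub>C (x::'a::complex_vector) = - (c *\<^sub>C x)"
  by (rule complex_vs.scale_minus_left)

lemma norm_add_sq:
  "(norm (x + y))\<^sup>2 = (norm x)\<^sup>2 + 2 * Re (cinner x y) + (norm (y::'a::complex_inner))\<^sup>2"
proof -
  have "Re (cinner y x) = Re (cinner x y)"
    using arg_cong[OF cinner_commute[of y x], of Re] by simp
  then show ?thesis
    by (simp add: cinner_simps flip: cinner_self_Re)
qed

lemma norm_diff_sq:
  "(norm (x - y))\<^sup>2 = (norm x)\<^sup>2 - 2 * Re (cinner x y) + (norm (y::'a::complex_inner))\<^sup>2"
  using norm_add_sq[of x "- y"] by (simp add: cinner_minus_right)

lemma cmod_cinner_le: "cmod (cinner x y) \<le> norm x * norm (y::'a::complex_inner)"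
proof (cases "y = 0")
  case False
  define c where "c = cinner x y / of_real ((norm y)\<^sup>2)"
  have n: "norm y > 0"
    using False by simp
  have "Re (cinner x (c *\<^sub>C y)) = (cmod (cinner x y))\<^sup>2 / (norm y)\<^sup>2"
    by (simp add: c_def cinner_scaleC_right complex_norm_square[symmetric] mult.commute
        flip: of_real_power of_real_divide)
  moreover have "(norm (c *\<^sub>C y))\<^sup>2 = (cmod (cinner x y))\<^sup>2 / (norm y)\<^sup>2"
    using n by (simp add: c_def norm_scaleC norm_divide norm_mult power_mult_distrib power_divide
        power2_eq_square)
  ultimately have "0 \<le> (norm x)\<^sup>2 - (cmod (cinner x y))\<^sup>2 / (norm y)\<^sup>2"
    using norm_diff_sq[of x "c *\<^sub>C y"] by (smt (verit) zero_le_power2)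
  then have "(cmod (cinner x y))\<^sup>2 \<le> (norm x * norm y)\<^sup>2"
    using n by (simp add: field_simps power_mult_distrib)
  then show ?thesis
    by (rule power2_le_imp_le) simp
qed simp

lemma cinner_eqI: "(\<And>z. cinner x z = cinner y z) \<Longrightarrow> x = (y::'a::complex_inner)"
proof -
  assume "\<And>z. cinner x z = cinner y z"
  then have "cinner (x - y) (x - y) = 0"
    by (simp add: cinner_diff_left)
  then show ?thesis
    by (simp add: cinner_self)
qed

lemma norm_le_cinnerI:
  assumes "\<And>z. norm z \<le> 1 \<Longrightarrow> cmod (cinner x z) \<le> K" "0 \<le> K"
  shows "norm (x::'a::complex_inner) \<le> K"
proof (cases "x = 0")
  case False
  have "cinner x ((1 / norm x) *\<^sub>R x) = of_real (norm x)"
    using False by (simp add: cinner_scaleR_right cinner_self power2_eq_square)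
  then show ?thesis
    using assms(1)[of "(1 / norm x) *\<^sub>R x"] False by simp
qed (use assms in simp)

lemma bounded_linear_cinner_left: "bounded_linear (\<lambda>x. cinner x (y::'a::complex_inner))"
  by (rule bounded_linear_intro[where K = "norm y"])
    (simp_all add: cinner_simps cmod_cinner_le scaleR_conv_of_real)

lemma bounded_linear_cinner_right: "bounded_linear (\<lambda>y. cinner (x::'a::complex_inner) y)"
  by (rule bounded_linear_intro[where K = "norm x"])
    (simp_all add: cinner_simps cmod_cinner_le scaleR_conv_of_real mult.commute[of _ "norm x"])

lemmas tendsto_cinner_left = bounded_linear.tendsto[OF bounded_linear_cinner_left]
lemmas tendsto_cinner_right = bounded_linear.tendsto[OF bounded_linear_cinner_right]

lemma tendsto_cinner:
  assumes "(f \<longlongrightarrow> a) F" "(g \<longlongrightarrow> b) F"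
  shows "((\<lambda>x. cinner (f x) (g x :: 'a::complex_inner)) \<longlongrightarrow> cinner a b) F"
proof -
  have "bounded_bilinear (\<lambda>x y::'a. cinner x y)"
    by (rule bounded_bilinear.intro)
      (auto simp: cinner_simps scaleR_conv_of_real intro!: exI[of _ 1] cmod_cinner_le)
  then show ?thesis
    by (rule bounded_bilinear.tendsto[OF _ assms])
qed

text \<open>The representing vector minimises \<open>\<parallel>x\<parallel>\<^sup>2 - 2 Re (\<phi> x)\<close>.\<close>

lemma riesz_representation:
  fixes \<phi> :: "'h::complex_hilbert \<Rightarrow> complex"
  assumes add: "\<And>x y. \<phi> (x + y) = \<phi> x + \<phi> y"
    and sc: "\<And>c x. \<phi> (c *\<^sub>C x) = c * \<phi> x"
    and bd: "\<And>x. cmod (\<phi> x) \<le> C * norm x"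
  obtains w where "\<And>x. \<phi> x = cinner x w"
proof -
  define J where "J x = (norm x)\<^sup>2 - 2 * Re (\<phi> x)" for x
  have bl: "bounded_linear \<phi>"
    by (rule bounded_linear_intro[where K = C])
      (simp_all add: add sc bd scaleR_scaleC scaleR_conv_of_real mult.commute)
  \<comment> \<open>Completing the square: \<open>(norm x - C)^2\<close> is nonnegative.\<close>
  have lower: "J x \<ge> - C\<^sup>2" for x
  proof -
    have "Re (\<phi> x) \<le> C * norm x"
      using bd[of x] complex_Re_le_cmod order_trans by blast
    then show ?thesis
      using zero_le_power2[of "norm x - C"] by (simp add: J_def power2_eq_square algebra_simps)
  qed
  define m where "m = Inf (range J)"
  have bdd: "bdd_below (range J)"
    using lower by (auto intro!: bdd_belowI)
  have mJ: "m \<le> J x" for x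
    unfolding m_def by (rule cInf_lower[OF _ bdd]) simp
  have "\<exists>x. J x < m + 1 / (real (Suc n))" for n
  proof -
    have "\<exists>y\<in>range J. y < m + 1 / (real (Suc n))"
      by (subst cInf_less_iff[symmetric]) (auto simp: bdd m_def)
    then show ?thesis by auto
  qed
  then obtain X where X: "\<And>n. J (X n) < m + 1 / (real (Suc n))"
    by metis
  \<comment> \<open>Parallelogram law. The linear terms cancel at the midpoint, so a minimising
    sequence is Cauchy.\<close>
  have par: "(norm (x - y))\<^sup>2 = 2 * J x + 2 * J y - 4 * J ((1/2) *\<^sub>R (x + y))" for x y
  proof -
    have e: "\<phi> ((1/2) *\<^sub>R (x + y)) = of_real (1/2) * (\<phi> x + \<phi> y)"
      by (simp only: scaleR_scaleC sc add)
    have "Re (\<phi> ((1/2) *\<^sub>R (x + y))) = (Re (\<phi> x) + Re (\<phi> y)) / 2"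
      unfolding e by simp
    moreover have "(norm ((1/2) *\<^sub>R (x + y)))\<^sup>2 = (norm (x + y))\<^sup>2 / 4"
      by (simp only: norm_scaleR power_mult_distrib) (simp add: power2_eq_square)
    ultimately show ?thesis
      by (simp only: J_def norm_diff_sq norm_add_sq)
        (simp add: field_simps)
  qed
  have close: "(norm (X i - X j))\<^sup>2 \<le> 4 / real (Suc n)" if "n \<le> i" "n \<le> j" for i j n
  proof -
    have "1 / real (Suc i) \<le> 1 / real (Suc n)" "1 / real (Suc j) \<le> 1 / real (Suc n)"
      using that by (auto intro!: divide_left_mono)
    then show ?thesis
      using par[of "X i" "X j"] X[of i] X[of j] mJ[of "(1/2) *\<^sub>R (X i + X j)"]
      by linarith
  qed
  have "Cauchy X"
  proof (rule metric_CauchyI)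
    fix e :: real assume e: "0 < e"
    obtain n :: nat where n: "4 / e\<^sup>2 < real (Suc n)"
      using reals_Archimedean2 less_Suc_eq of_nat_less_iff by (metis less_trans lessI)
    have "dist (X i) (X j) < e" if "n \<le> i" "n \<le> j" for i j
    proof -
      have "4 / real (Suc n) < e\<^sup>2"
        using n e by (simp add: field_simps del: of_nat_Suc)
      then have "(norm (X i - X j))\<^sup>2 < e\<^sup>2"
        using close[OF that] by linarith
      then show ?thesis
        using e by (simp add: dist_norm power2_less_imp_less)
    qed
    then show "\<exists>M. \<forall>m\<ge>M. \<forall>n\<ge>M. dist (X m) (X n) < e" by blast
  qed
  then obtain w where w: "X \<longlonglongrightarrow> w"
    using Cauchy_convergent convergent_def by blast
  have "(\<lambda>n. J (X n)) \<longlonglongrightarrow> J w"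
    unfolding J_def by (intro tendsto_intros w bounded_linear.tendsto[OF bl])
  moreover have "(\<lambda>n. m + 1 / real (Suc n)) \<longlonglongrightarrow> m + 0"
    by (intro tendsto_intros LIMSEQ_Suc[OF lim_1_over_n])
  ultimately have "J w \<le> m + 0"
    by (rule LIMSEQ_le) (auto intro: less_imp_le X simp del: of_nat_Suc)
  then have Jw: "J w \<le> J x" for x
    using mJ[of x] by simp
  \<comment> \<open>First variation at the minimiser in direction \<open>z\<close>; the step
    \<open>t\<close> chosen below minimises the resulting quadratic polynomial.\<close>
  have re: "Re (cinner z w) = Re (\<phi> z)" for z
  proof (rule ccontr)
    assume ne: "Re (cinner z w) \<noteq> Re (\<phi> z)"
    define d where "d = Re (\<phi> z) - Re (cinner z w)"
    have comm: "Re (cinner w z) = Re (cinner z w)"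
      using arg_cong[OF cinner_commute[of w z], of Re] by simp
    have J: "J (w + t *\<^sub>R z) = J w - 2 * t * d + t\<^sup>2 * (norm z)\<^sup>2" for t
      by (simp add: J_def norm_add_sq add sc scaleR_scaleC[of t z] cinner_scaleC_right d_def comm
          norm_scaleC power_mult_distrib algebra_simps)
    have z: "norm z > 0"
      using ne sc[of 0 0] by (cases "z = 0") auto
    define t where "t = d / (norm z)\<^sup>2"
    have "J (w + t *\<^sub>R z) = J w - d\<^sup>2 / (norm z)\<^sup>2"
      using z unfolding J t_def by (simp add: field_simps power2_eq_square)
    moreover have "d\<^sup>2 / (norm z)\<^sup>2 > 0"
      using z ne by (simp add: d_def)
    ultimately show False
      using Jw[of "w + t *\<^sub>R z"] by simp
  qed
  \<comment> \<open>Testing with \<open>\<i> *\<^sub>C z\<close> recovers the imaginary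
    part.\<close>
  have "cinner z w = \<phi> z" for z
    using re[of z] re[of "\<i> *\<^sub>C z"] by (simp add: sc cinner_scaleC_left complex_eq_iff)
  then show ?thesis
    using that by metis
qed

section \<open>Bounded complex linear operators and adjoints\<close>

lemma norm_blinfun_le_unit:
  assumes "\<And>x. norm x = 1 \<Longrightarrow> norm (blinfun_apply A x) \<le> K" "0 \<le> K"
  shows "norm A \<le> K"
proof (rule norm_blinfun_bound[OF assms(2)])
  fix x
  show "norm (A x) \<le> K * norm x"
  proof (cases "x = 0")
    case False
    have "norm (A ((1 / norm x) *\<^sub>R x)) \<le> K"
      by (rule assms) (use False in simp)
    then show ?thesis
      using False by (simp add: blinfun.scaleR_right field_simps)
  qed simp
qed

lemma bop_scaleC: "A \<in> bop \<Longrightarrow> blinfun_apply A (c *\<^sub>C x) = c *\<^sub>C A x"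
  by (simp add: bop_def)

lemma bopI: "(\<And>c x. blinfun_apply A (c *\<^sub>C x) = c *\<^sub>C A x) \<Longrightarrow> A \<in> bop"
  by (simp add: bop_def)

lemma scaleC_blinfun_apply: "blinfun_apply (c *\<^sub>C A) x = c *\<^sub>C A x"
  by (transfer) simp

lemma bop_zero: "0 \<in> bop" and bop_id: "id_blinfun \<in> bop"
  by (auto intro!: bopI)

lemma bop_add: "A \<in> bop \<Longrightarrow> B \<in> bop \<Longrightarrow> A + B \<in> bop"
  by (rule bopI) (simp add: blinfun.add_left bop_scaleC scaleC_add_right)

lemma scaleC_diff_right: "c *\<^sub>C (x - y) = c *\<^sub>C x - c *\<^sub>C (y::'a::complex_vector)"
  by (rule complex_vs.scale_right_diff_distrib)

lemma bop_diff: "A \<in> bop \<Longrightarrow> B \<in> bop \<Longrightarrow> A - B \<in> bop"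
  by (rule bopI) (simp add: blinfun.diff_left bop_scaleC scaleC_diff_right)

lemma bop_scale: "A \<in> bop \<Longrightarrow> c *\<^sub>C A \<in> bop"
  by (rule bopI) (simp add: scaleC_blinfun_apply bop_scaleC scaleC_scaleC mult.commute)

lemma scaleR_scaleC_blinfun: "r *\<^sub>R (A :: 'a::real_normed_vector \<Rightarrow>\<^sub>L 'b::complex_inner) = of_real r *\<^sub>C A"
  by (rule scaleR_scaleC)

lemma bop_scaleR: "A \<in> bop \<Longrightarrow> r *\<^sub>R A \<in> bop"
  using bop_scale scaleR_scaleC_blinfun by metis

lemma bop_compose: "A \<in> bop \<Longrightarrow> B \<in> bop \<Longrightarrow> A o\<^sub>L B \<in> bop"
  by (rule bopI) (simp add: bop_scaleC)

lemma bop_sum: "(\<And>i. i \<in> I \<Longrightarrow> f i \<in> bop) \<Longrightarrow> (\<Sum>i\<in>I. f i) \<in> bop"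
  by (induction I rule: infinite_finite_induct) (auto simp: bop_zero bop_add)

text \<open>Riesz representation for each fixed first argument. The form is antilinear in the second
  one, so its conjugate is the functional to represent. Adjoints and weak integrals both arise from
  this lemma.\<close>

lemma sesquilinear_operator:
  fixes s :: "'h::complex_hilbert \<Rightarrow> 'h \<Rightarrow> complex"
  assumes "\<And>x y z. s (x + y) z = s x z + s y z" "\<And>c x z. s (c *\<^sub>C x) z = c * s x z"
    and "\<And>x y z. s z (x + y) = s z x + s z y" "\<And>c x z. s z (c *\<^sub>C x) = cnj c * s z x"
    and bd: "\<And>x y. cmod (s x y) \<le> K * norm x * norm y" and "0 \<le> K"
  obtains S where "S \<in> bop" "\<And>x y. s x y = cinner (S x) y" "norm S \<le> K"
proof -
  have "\<exists>w. \<forall>y. s x y = cinner w y" for x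
  proof -
    obtain w where "\<And>y. cnj (s x y) = cinner y w"
      by (rule riesz_representation[of "\<lambda>y. cnj (s x y)" "K * norm x"])
        (use assms in auto)
    then show ?thesis
      by (metis cinner_commute complex_cnj_cnj)
  qed
  then obtain S0 where S0: "\<And>x y. s x y = cinner (S0 x) y"
    by metis
  have scS: "S0 (c *\<^sub>C x) = c *\<^sub>C S0 x" for c x
    by (rule cinner_eqI) (simp add: S0[symmetric] assms cinner_scaleC_left)
  have bound: "norm (S0 x) \<le> norm x * K" for x
  proof (rule norm_le_cinnerI)
    fix z :: 'h assume "norm z \<le> 1"
    then have "K * norm x * norm z \<le> norm x * K"
      using \<open>0 \<le> K\<close> by (simp add: mult_left_le mult.commute[of K])
    then show "cmod (cinner (S0 x) z) \<le> norm x * K"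
      using bd[of x z] S0 by (metis order_trans)
  qed (use \<open>0 \<le> K\<close> in simp)
  have bl: "bounded_linear S0"
  proof (rule bounded_linear_intro)
    show "S0 (x + y) = S0 x + S0 y" for x y
      by (rule cinner_eqI) (simp add: S0[symmetric] assms cinner_add_left)
    show "S0 (r *\<^sub>R x) = r *\<^sub>R S0 x" for r x
      by (simp add: scS scaleR_scaleC)
    show "norm (S0 x) \<le> norm x * K" for x
      by (rule bound)
  qed
  show ?thesis
  proof (rule that[of "Blinfun S0"])
    show "norm (Blinfun S0) \<le> K"
      using bound \<open>0 \<le> K\<close>
      by (intro norm_blinfun_bound) (auto simp: bounded_linear_Blinfun_apply[OF bl] mult.commute)
  qed (auto intro!: bopI simp: bounded_linear_Blinfun_apply[OF bl] scS S0)
qed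

text \<open>Makes the definite description in \<open>adj\<close> meaningful on \<open>bop\<close>:
  the form \<open>cinner x (A y)\<close> yields existence, nondegeneracy of the inner product yields
  uniqueness.\<close>

lemma adj_exists:
  fixes A :: "'h::complex_hilbert \<Rightarrow>\<^sub>L 'h"
  assumes "A \<in> bop"
  shows "\<exists>!S :: 'h \<Rightarrow>\<^sub>L 'h. \<forall>x y. cinner (A x) y = cinner x (S y)"
proof -
  have bd: "cmod (cinner x (A y)) \<le> norm A * norm x * norm y" for x y
  proof -
    have "norm x * norm (A y) \<le> norm x * (norm A * norm y)"
      by (intro mult_left_mono norm_blinfun) auto
    then show ?thesis
      using cmod_cinner_le[of x "A y"] by (simp add: mult_ac)
  qed
  obtain S where S: "S \<in> bop" "\<And>x y. cinner x (A y) = cinner (S x) y" "norm S \<le> norm A"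
    by (rule sesquilinear_operator[of "\<lambda>x y. cinner x (A y)" "norm A"])
      (use bd in \<open>auto simp: cinner_simps blinfun.add_right bop_scaleC[OF assms]\<close>)
  have "\<forall>x y. cinner (A x) y = cinner x (S y)"
    using S(2) cinner_commute by metis
  moreover have "S' = S''" if "\<forall>x y. cinner (A x) y = cinner x (S' y)"
      "\<forall>x y. cinner (A x) y = cinner x (S'' y)" for S' S'' :: "'h \<Rightarrow>\<^sub>L 'h"
  proof (rule blinfun_eqI)
    fix y
    have "cinner (S' y) x = cinner (S'' y) x" for x
      using that cinner_commute by metis
    then show "S' y = S'' y"
      by (rule cinner_eqI)
  qed
  ultimately show ?thesis
    by blast
qed

lemma cinner_adj_right: "A \<in> bop \<Longrightarrow> cinner x (adj A y) = cinner (A x) y"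
proof -
  assume "A \<in> bop"
  from theI'[OF adj_exists[OF this]] have "\<forall>x y. cinner (A x) y = cinner x (adj A y)"
    unfolding adj_def .
  then show ?thesis
    by (simp only:)
qed

lemma cinner_adj_left: "A \<in> bop \<Longrightarrow> cinner (adj A x) y = cinner x (A y)"
  by (metis cinner_adj_right cinner_commute)

lemma adj_bop: "A \<in> bop \<Longrightarrow> adj A \<in> bop"
  by (intro bopI cinner_eqI) (simp add: cinner_adj_left cinner_scaleC_left)

lemma norm_adj_le: "A \<in> bop \<Longrightarrow> norm (adj A) \<le> norm A"
proof (rule norm_blinfun_bound)
  fix x assume A: "A \<in> bop"
  show "norm (adj A x) \<le> norm A * norm x"
  proof (rule norm_le_cinnerI)
    fix z :: 'a assume z: "norm z \<le> 1"
    have "cmod (cinner (adj A x) z) \<le> norm x * norm (A z)"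
      by (simp add: cinner_adj_left A cmod_cinner_le)
    also have "\<dots> \<le> norm x * (norm A * 1)"
      using z by (intro mult_left_mono norm_blinfun[THEN order_trans]) auto
    finally show "cmod (cinner (adj A x) z) \<le> norm A * norm x"
      by (simp add: mult.commute)
  qed simp
qed simp

lift_definition rank1 :: "'h::complex_inner \<Rightarrow> 'h \<Rightarrow> 'h \<Rightarrow>\<^sub>L 'h"
  is "\<lambda>u v x. cinner x v *\<^sub>C u"
proof -
  fix u v :: 'h
  show "bounded_linear (\<lambda>x. cinner x v *\<^sub>C u)"
  proof (rule bounded_linear_intro[where K = "norm v * norm u"])
    show "norm (cinner x v *\<^sub>C u) \<le> norm x * (norm v * norm u)" for x
      using mult_right_mono[OF cmod_cinner_le[of x v] norm_ge_zero[of u]]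
      by (simp add: norm_scaleC mult.assoc)
  qed (simp_all add: cinner_simps scaleC_add_left scaleC_scaleC scaleR_scaleC)
qed

lemma rank1_bop: "rank1 u v \<in> bop"
  by (rule bopI) (simp add: rank1.rep_eq cinner_scaleC_left scaleC_scaleC)

lemma finite_rank_bop: "finite_rank A \<Longrightarrow> A \<in> bop"
  by (simp add: finite_rank_def)

lemma finite_rank_sum_rank1:
  assumes "finite I"
  shows "finite_rank (\<Sum>i\<in>I. rank1 (u i) (v i))"
  unfolding finite_rank_def
proof (intro conjI exI)
  show "range (blinfun_apply (\<Sum>i\<in>I. rank1 (u i) (v i))) \<subseteq> cspan (u ` I)"
    by (auto simp: blinfun.sum_left rank1.rep_eq cspan_def
        intro!: complex_vs.span_sum complex_vs.span_scale intro: complex_vs.span_base)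
qed (auto intro!: bop_sum rank1_bop assms)

section \<open>Symmetric norming functions\<close>

lemma fin_supp_add: "a \<in> fin_supp \<Longrightarrow> b \<in> fin_supp \<Longrightarrow> (\<lambda>n. a n + b n) \<in> fin_supp"
  unfolding fin_supp_def mem_Collect_eq
  by (rule finite_subset[of _ "{n. a n \<noteq> 0} \<union> {n. b n \<noteq> 0}"]) auto

lemma fin_supp_dominated:
  "a \<in> fin_supp \<Longrightarrow> (\<And>n. a n = 0 \<Longrightarrow> b n = 0) \<Longrightarrow> b \<in> fin_supp"
  unfolding fin_supp_def mem_Collect_eq by (rule finite_subset[of _ "{n. a n \<noteq> 0}"]) auto

lemma fin_supp_restrict: "(\<lambda>i. if i < n then a i else 0) \<in> fin_supp"
  unfolding fin_supp_def mem_Collect_eq by (rule finite_subset[of _ "{..<n}"]) auto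

lemma fin_supp_scale: "a \<in> fin_supp \<Longrightarrow> (\<lambda>i. c * a i) \<in> fin_supp"
  by (erule fin_supp_dominated) simp

lemma fin_supp_bij:
  assumes "a \<in> fin_supp" "bij \<sigma>"
  shows "(\<lambda>n. a (\<sigma> n)) \<in> fin_supp"
proof -
  have "{n. a (\<sigma> n) \<noteq> 0} = \<sigma> -` {n. a n \<noteq> 0}" by auto
  then show ?thesis
    using finite_vimageI[OF _ bij_is_inj[OF assms(2)], of "{n. a n \<noteq> 0}"] assms(1)
    by (simp add: fin_supp_def)
qed

context
  fixes \<Phi> :: "(nat \<Rightarrow> complex) \<Rightarrow> real"
  assumes sn: "sn_function \<Phi>"
begin

lemma sn_nonneg: "a \<in> fin_supp \<Longrightarrow> 0 \<le> \<Phi> a"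
  and sn_eq_0: "a \<in> fin_supp \<Longrightarrow> \<Phi> a = 0 \<longleftrightarrow> a = (\<lambda>_. 0)"
  and sn_scale: "a \<in> fin_supp \<Longrightarrow> \<Phi> (\<lambda>n. c * a n) = cmod c * \<Phi> a"
  and sn_triangle: "a \<in> fin_supp \<Longrightarrow> b \<in> fin_supp \<Longrightarrow> \<Phi> (\<lambda>n. a n + b n) \<le> \<Phi> a + \<Phi> b"
  and sn_unit: "\<Phi> (\<lambda>n. if n = 0 then 1 else 0) = 1"
  and sn_abs: "a \<in> fin_supp \<Longrightarrow> \<Phi> (\<lambda>n. complex_of_real (cmod (a n))) = \<Phi> a"
  and sn_bij: "a \<in> fin_supp \<Longrightarrow> bij \<sigma> \<Longrightarrow> \<Phi> (\<lambda>n. a (\<sigma> n)) = \<Phi> a"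
  using sn unfolding sn_function_def by blast+

lemma sn_zero: "\<Phi> (\<lambda>_. 0) = 0"
  by (subst sn_eq_0) (auto simp: fin_supp_def)

lemma sn_cong_abs:
  assumes "a \<in> fin_supp" "\<And>n. cmod (a n) = cmod (b n)"
  shows "\<Phi> a = \<Phi> b"
proof -
  have "b \<in> fin_supp"
    using assms by (metis fin_supp_dominated norm_eq_zero)
  then show ?thesis
    using sn_abs[of a] sn_abs[of b] assms by simp
qed

text \<open>Up to a phase, an entry of smaller modulus is a convex combination of \<open>b j\<close>
  and \<open>- b j\<close>, and flipping the sign of one entry does not change the norm.\<close>

lemma sn_mono_single:
  assumes "a \<in> fin_supp" "b \<in> fin_supp" "\<And>i. i \<noteq> j \<Longrightarrow> a i = b i" "cmod (a j) \<le> cmod (b j)"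
  shows "\<Phi> a \<le> \<Phi> b"
proof -
  define r where "r = cmod (a j) / cmod (b j)"
  have r: "0 \<le> r" "r \<le> 1" "r * cmod (b j) = cmod (a j)"
    using assms(4) by (auto simp: r_def divide_le_eq)
  define b' where "b' i = (if i = j then - b i else b i)" for i
  have b': "b' \<in> fin_supp"
    using assms(2) by (rule fin_supp_dominated) (auto simp: b'_def)
  have *: "cmod (a i) = cmod (of_real ((1 + r) / 2) * b i + of_real ((1 - r) / 2) * b' i)" for i
  proof (cases "i = j")
    case True
    have "of_real ((1 + r) / 2) * b j + of_real ((1 - r) / 2) * b' j = of_real r * b j"
      by (simp add: b'_def field_simps)
    then show ?thesis
      using r True by (simp add: norm_mult)
  next
    case False
    have "of_real ((1 + r) / 2) * b i + of_real ((1 - r) / 2) * b i = b i"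
      by (simp add: field_simps)
    then show ?thesis
      using False assms(3) by (simp add: b'_def)
  qed
  have "\<Phi> a = \<Phi> (\<lambda>i. of_real ((1 + r) / 2) * b i + of_real ((1 - r) / 2) * b' i)"
    by (rule sn_cong_abs[OF assms(1) *])
  also have "\<dots> \<le> \<Phi> (\<lambda>i. of_real ((1 + r) / 2) * b i) + \<Phi> (\<lambda>i. of_real ((1 - r) / 2) * b' i)"
    by (intro sn_triangle fin_supp_scale assms b')
  also have "\<dots> = (1 + r) / 2 * \<Phi> b + (1 - r) / 2 * \<Phi> b'"
    using r sn_scale[OF assms(2), of "of_real ((1 + r) / 2)"] sn_scale[OF b', of "of_real ((1 - r) / 2)"]
    by (simp only: norm_of_real) simp
  also have "\<Phi> b' = \<Phi> b"
    by (rule sn_cong_abs[OF b']) (simp add: b'_def)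
  finally show ?thesis
    by (simp add: field_simps)
qed

text \<open>Entries are enlarged one at a time. The induction runs over a finite set outside which
  the sequences agree; the support of \<open>b\<close> is such a set because \<open>a\<close>
  vanishes wherever \<open>b\<close> does.\<close>

lemma sn_mono:
  assumes "b \<in> fin_supp" "\<And>i. cmod (a i) \<le> cmod (b i)"
  shows "\<Phi> a \<le> \<Phi> b"
proof -
  have *: "\<Phi> a \<le> \<Phi> b" if "finite J" "a \<in> fin_supp" "\<And>i. i \<notin> J \<Longrightarrow> a i = b i"
    "\<And>i. cmod (a i) \<le> cmod (b i)" for J a
    using that
  proof (induction J arbitrary: a rule: finite_induct)
    case empty
    then have "a = b" by auto
    then show ?case by simp
  next
    case (insert j J)
    define a' where "a' i = (if i = j then b i else a i)" for i
    have a': "a' \<in> fin_supp"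
      by (rule fin_supp_dominated[OF assms(1)]) (use insert.prems(3) in \<open>auto simp: a'_def, metis norm_le_zero_iff norm_zero\<close>)
    have "\<Phi> a \<le> \<Phi> a'"
      by (rule sn_mono_single[of _ _ j]) (use insert.prems a' in \<open>auto simp: a'_def\<close>)
    also have "\<Phi> a' \<le> \<Phi> b"
      using insert.prems by (intro insert.IH a') (auto simp: a'_def)
    finally show ?case .
  qed
  have z: "a i = 0" if "b i = 0" for i
    using assms(2)[of i] that by simp
  have "finite {i. b i \<noteq> 0}"
    using assms(1) by (simp add: fin_supp_def)
  then show ?thesis
    by (rule *) (use z assms fin_supp_dominated in auto)
qed

lemma sn_coord: "\<Phi> (\<lambda>i. if i = j then c else 0) = cmod c"
proof -
  define u where "u = (\<lambda>n::nat. if n = 0 then 1 else 0 :: complex)"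
  have u: "u \<in> fin_supp"
    by (auto simp: u_def fin_supp_def)
  \<comment> \<open>The transposition of 0 and \<open>j\<close>.\<close>
  define t where "t n = (if n = j then 0 else if n = 0 then j else n)" for n
  have "t (t n) = n" for n
    by (auto simp: t_def)
  then have "bij t"
    by (metis o_bij comp_def eq_id_iff)
  then have "\<Phi> (\<lambda>n. u (t n)) = 1"
    using sn_bij[OF u] sn_unit by (simp add: u_def)
  moreover have "(\<lambda>i. if i = j then c else 0) = (\<lambda>n. c * u (t n))"
    by (auto simp: u_def t_def fun_eq_iff)
  ultimately show ?thesis
    using sn_scale[OF fin_supp_bij[OF u \<open>bij t\<close>], of c] by simp
qed

text \<open>Unit vectors have norm one, so the triangle inequality gives the l1 bound. Crude as it
  is, it controls rank one operators and small remainders.\<close>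

lemma sn_le_sum: "\<Phi> (\<lambda>i. if i < n then a i else 0) \<le> (\<Sum>i<n. cmod (a i))"
proof (induction n)
  case (Suc n)
  have "(\<lambda>i. if i < Suc n then a i else 0) =
      (\<lambda>i. (if i < n then a i else 0) + (if i = n then a n else 0))"
    by auto
  then have "\<Phi> (\<lambda>i. if i < Suc n then a i else 0)
      \<le> \<Phi> (\<lambda>i. if i < n then a i else 0) + \<Phi> (\<lambda>i. if i = n then a n else 0)"
    using sn_triangle[OF fin_supp_restrict[of n a], of "\<lambda>i. if i = n then a n else 0"]
    by (simp add: fin_supp_def)
  then show ?case
    using Suc by (simp add: sn_coord)
qed (simp add: sn_zero)

text \<open>The Hahn--Banach theorem for \<open>\<Phi>\<close> restricted to the first \<open>n\<close> coordinates, extending the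
  functional \<open>a x \<mapsto> a \<Phi> x\<close> one coordinate at a time.\<close>

lemma sn_hahn_banach:
  fixes x :: "nat \<Rightarrow> real" and n :: nat
  defines "p \<equiv> \<lambda>z :: nat \<Rightarrow> real. \<Phi> (\<lambda>i. if i < n then of_real (z i) else 0)"
  shows "\<exists>d. \<forall>a z. a * p x + (\<Sum>i<k. d i * z i) \<le> p (\<lambda>i. a * x i + (if i < k then z i else 0))"
proof (induction k)
  have hom: "p (\<lambda>i. r * z i) = \<bar>r\<bar> * p z" for r z
    unfolding p_def using sn_scale[OF fin_supp_restrict[of n "\<lambda>i. of_real (z i)"], of "of_real r"]
    by (simp add: if_distrib cong: if_cong)
  have sub: "p (\<lambda>i. z i + w i) \<le> p z + p w" for z w
    unfolding p_def using sn_triangle[OF fin_supp_restrict[of n "\<lambda>i. of_real (z i)"]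
        fin_supp_restrict[of n "\<lambda>i. of_real (w i)"]]
    by (simp add: if_distrib cong: if_cong)
  {
    case 0
    have "a * p x \<le> p (\<lambda>i. a * x i)" for a
      unfolding hom using sn_nonneg[OF fin_supp_restrict[of n "\<lambda>i. of_real (x i)"]]
      by (intro mult_right_mono) (auto simp: p_def)
    then show ?case by simp
  next
    case (Suc k)
    then obtain d where d: "\<And>a z. a * p x + (\<Sum>i<k. d i * z i) \<le> p (\<lambda>i. a * x i + (if i < k then z i else 0))"
      by blast
    \<comment> \<open>Elements of the span of \<open>x\<close> and the first \<open>k\<close> unit
      vectors are handled as coefficient pairs \<open>(a, z)\<close>, so that an \<open>x\<close>
      already lying in the span of unit vectors causes no ambiguity.\<close>
    define W where "W = (\<lambda>a z i. a * x i + (if i < k then z i else (0::real)))"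
    define L where "L = (\<lambda>a z. a * p x + (\<Sum>i<k. d i * z i))"
    define e where "e = (\<lambda>i. if i = k then 1 else (0::real))"
    have L: "L a z \<le> p (W a z)" for a z
      using d by (simp add: L_def W_def)
    have cross: "L a z - p (\<lambda>i. W a z i - e i) \<le> p (\<lambda>i. W b w i + e i) - L b w" for a z b w
    proof -
      have "L a z + L b w = L (a + b) (\<lambda>i. z i + w i)"
        by (simp add: L_def algebra_simps sum.distrib)
      also have "\<dots> \<le> p (W (a + b) (\<lambda>i. z i + w i))"
        by (rule L)
      also have "W (a + b) (\<lambda>i. z i + w i) = (\<lambda>i. (W a z i - e i) + (W b w i + e i))"
        by (auto simp: W_def algebra_simps)
      also have "p \<dots> \<le> p (\<lambda>i. W a z i - e i) + p (\<lambda>i. W b w i + e i)"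
        by (rule sub)
      finally show ?thesis by simp
    qed
    \<comment> \<open>The coefficient of the new coordinate has to lie between the two sides of
      \<open>cross\<close>; the supremum of the left sides is such a value.\<close>
    define D where "D = (SUP (a, z) \<in> UNIV. L a z - p (\<lambda>i. W a z i - e i))"
    have bdd: "bdd_above (range (\<lambda>(a, z). L a z - p (\<lambda>i. W a z i - e i)))"
      using cross[where b = 0 and w = "\<lambda>_. 0"] by (auto intro!: bdd_aboveI)
    have lo: "L a z - D \<le> p (\<lambda>i. W a z i - e i)" for a z
      using cSUP_upper[OF _ bdd, of "(a, z)"] by (simp add: D_def)
    have hi: "L a z + D \<le> p (\<lambda>i. W a z i + e i)" for a z
    proof -
      have "D \<le> p (\<lambda>i. W a z i + e i) - L a z"
        unfolding D_def by (rule cSUP_least) (use cross in auto)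
      then show ?thesis by simp
    qed
    \<comment> \<open>Homogeneity reduces positive and negative \<open>u\<close> to the coefficients
      1 and -1.\<close>
    have main: "L a z + D * u \<le> p (\<lambda>i. W a z i + u * e i)" for a z u
    proof -
      have L_hom: "L a z = r * L (a / r) (\<lambda>i. z i / r)" if "r > 0" for r
        using that by (simp add: L_def sum_distrib_left distrib_left)
      have W_hom: "W a z i = r * W (a / r) (\<lambda>i. z i / r) i" if "r > 0" for r i
        using that by (simp add: W_def distrib_left)
      consider "u = 0" | "u > 0" | "u < 0" by linarith
      then show ?thesis
      proof cases
        case 1
        then show ?thesis using L by simp
      next
        case 2
        have "L a z + D * u = u * (L (a / u) (\<lambda>i. z i / u) + D)"
          using L_hom[OF 2] by (simp add: algebra_simps)
        also have "\<dots> \<le> u * p (\<lambda>i. W (a / u) (\<lambda>i. z i / u) i + e i)"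
          using 2 hi by (intro mult_left_mono) auto
        also have "\<dots> = p (\<lambda>i. u * (W (a / u) (\<lambda>i. z i / u) i + e i))"
          unfolding hom using 2 by simp
        also have "(\<lambda>i. u * (W (a / u) (\<lambda>i. z i / u) i + e i)) = (\<lambda>i. W a z i + u * e i)"
          using W_hom[OF 2] by (simp add: distrib_left)
        finally show ?thesis .
      next
        case 3
        define r where "r = - u"
        have r: "r > 0" using 3 by (simp add: r_def)
        have "L a z + D * u = r * (L (a / r) (\<lambda>i. z i / r) - D)"
          using L_hom[OF r] by (simp add: algebra_simps r_def)
        also have "\<dots> \<le> r * p (\<lambda>i. W (a / r) (\<lambda>i. z i / r) i - e i)"
          using r lo by (intro mult_left_mono) auto
        also have "\<dots> = p (\<lambda>i. r * (W (a / r) (\<lambda>i. z i / r) i - e i))"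
          unfolding hom using r by simp
        also have "(\<lambda>i. r * (W (a / r) (\<lambda>i. z i / r) i - e i)) = (\<lambda>i. W a z i + u * e i)"
          using W_hom[OF r] by (simp add: right_diff_distrib r_def)
        finally show ?thesis .
      qed
    qed
    show ?case
    proof (intro exI[of _ "d(k := D)"] allI)
      fix a z
      have "(\<lambda>i. a * x i + (if i < Suc k then z i else 0)) = (\<lambda>i. W a z i + z k * e i)"
        by (auto simp: W_def e_def less_Suc_eq)
      then show "a * p x + (\<Sum>i<Suc k. (d(k := D)) i * z i)
          \<le> p (\<lambda>i. a * x i + (if i < Suc k then z i else 0))"
        using main[of a z "z k"] by (simp add: L_def)
    qed
  }
qed

text \<open>Replacing the Hahn-Banach coefficients by their moduli keeps the domination, because the
  signs can be moved into the argument, where the norm ignores them, and it can only increase the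
  value at \<open>x\<close>.\<close>

lemma sn_norming_functional:
  fixes x :: "nat \<Rightarrow> complex"
  obtains c :: "nat \<Rightarrow> real" where "\<And>i. 0 \<le> c i" "\<And>i. i \<ge> n \<Longrightarrow> c i = 0"
    "(\<Sum>i<n. c i * cmod (x i)) = \<Phi> (\<lambda>i. if i < n then x i else 0)"
    "\<And>z. z \<in> fin_supp \<Longrightarrow> (\<Sum>i<n. c i * cmod (z i)) \<le> \<Phi> z"
proof -
  define p where "p z = \<Phi> (\<lambda>i. if i < n then of_real (z i) else 0)" for z :: "nat \<Rightarrow> real"
  obtain d where d: "\<And>a z. a * p (\<lambda>i. cmod (x i)) + (\<Sum>i<n. d i * z i)
      \<le> p (\<lambda>i. a * cmod (x i) + (if i < n then z i else 0))"
    using sn_hahn_banach[of n "\<lambda>i. cmod (x i)" n] unfolding p_def by blast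
  define c where "c i = (if i < n then \<bar>d i\<bar> else 0)" for i
  have px: "p (\<lambda>i. cmod (x i)) = \<Phi> (\<lambda>i. if i < n then x i else 0)"
    unfolding p_def by (rule sn_cong_abs) (auto simp: fin_supp_restrict)
  have dz: "(\<Sum>i<n. d i * z i) \<le> p z" for z
    using d[of 0 z] by (simp add: p_def cong: if_cong)
  have cz: "(\<Sum>i<n. c i * cmod (z i)) \<le> \<Phi> z" if "z \<in> fin_supp" for z
  proof -
    have "(\<Sum>i<n. c i * cmod (z i)) = (\<Sum>i<n. d i * (sgn (d i) * cmod (z i)))"
      by (rule sum.cong) (auto simp: c_def abs_sgn)
    also have "\<dots> \<le> p (\<lambda>i. sgn (d i) * cmod (z i))"
      by (rule dz)
    also have "\<dots> \<le> \<Phi> z"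
      unfolding p_def using that
      by (intro sn_mono) (auto simp: norm_mult sgn_if)
    finally show ?thesis .
  qed
  \<comment> \<open>With \<open>a = 1\<close> and \<open>z\<close> the negative of the moduli, the
    argument on the right vanishes in the first \<open>n\<close> coordinates.\<close>
  have "p (\<lambda>i. cmod (x i)) \<le> (\<Sum>i<n. d i * cmod (x i))"
    using d[of 1 "\<lambda>i. - cmod (x i)"] by (simp add: p_def sum_negf sn_zero cong: if_cong)
  also have "\<dots> \<le> (\<Sum>i<n. c i * cmod (x i))"
    by (intro sum_mono mult_right_mono) (auto simp: c_def)
  also have "\<dots> = (\<Sum>i<n. c i * cmod (if i < n then x i else 0))"
    by (rule sum.cong) auto
  finally have "(\<Sum>i<n. c i * cmod (x i)) = \<Phi> (\<lambda>i. if i < n then x i else 0)"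
    using cz[OF fin_supp_restrict[of n x]] px by (simp add: antisym)
  then show ?thesis
    by (rule that[rotated 2]) (use cz in \<open>auto simp: c_def\<close>)
qed

end

section \<open>Rearrangement inequalities\<close>

lemma abel_sum_mono:
  fixes s y z :: "nat \<Rightarrow> real"
  assumes "antimono s" "\<And>k. 0 \<le> s k" "\<And>b. b \<le> m \<Longrightarrow> (\<Sum>k<b. y k) \<le> (\<Sum>k<b. z k)"
  shows "(\<Sum>k<m. y k * s k) \<le> (\<Sum>k<m. z k * s k)"
proof -
  \<comment> \<open>Summation by parts in inductive form: the last weight times the difference of
    the partial sums bounds the weighted sum from below, and the weights decrease.\<close>
  have "s b * (\<Sum>k<b. z k - y k) \<le> (\<Sum>k<b. (z k - y k) * s k)" if "b \<le> m" for b
    using that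
  proof (induction b)
    case (Suc b)
    have "s (Suc b) * (\<Sum>k<Suc b. z k - y k) \<le> s b * (\<Sum>k<Suc b. z k - y k)"
      using assms(3)[OF Suc.prems] antimonoD[OF assms(1), of b "Suc b"]
      by (intro mult_right_mono) (auto simp: sum_subtractf)
    also have "\<dots> = s b * (\<Sum>k<b. z k - y k) + (z b - y b) * s b"
      by (simp add: algebra_simps)
    also have "\<dots> \<le> (\<Sum>k<Suc b. (z k - y k) * s k)"
      using Suc by simp
    finally show ?case .
  qed simp
  from this[of m] have "0 \<le> (\<Sum>k<m. (z k - y k) * s k)"
    using mult_nonneg_nonneg[OF assms(2)[of m], of "\<Sum>k<m. z k - y k"] assms(3)[of m]
    by (simp add: sum_subtractf)
  then show ?thesis
    by (simp add: left_diff_distrib sum_subtractf)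
qed

text \<open>Summation by parts against \<open>s\<close> and then against \<open>c\<close> leaves
  block sums of \<open>M\<close>; a block of a rows and b columns of a doubly substochastic matrix
  has sum at most min a b.\<close>

lemma rearrangement_substochastic:
  fixes c s :: "nat \<Rightarrow> real" and m n :: nat
  assumes c: "antimono c" "\<And>i. 0 \<le> c i" "\<And>i. i \<ge> n \<Longrightarrow> c i = 0"
    and s: "antimono s" "\<And>k. 0 \<le> s k"
    and M: "\<And>i k. 0 \<le> M i k" "\<And>i. i < n \<Longrightarrow> (\<Sum>k<m. M i k) \<le> 1" "\<And>k. k < m \<Longrightarrow> (\<Sum>i<n. M i k) \<le> 1"
  shows "(\<Sum>i<n. \<Sum>k<m. c i * M i k * s k) \<le> (\<Sum>k<m. c k * s k)"
proof -
  have "(\<Sum>k<m. (\<Sum>i<n. c i * M i k) * s k) \<le> (\<Sum>k<m. c k * s k)"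
  proof (rule abel_sum_mono[OF s])
    fix b assume b: "b \<le> m"
    define r where "r i = (\<Sum>k<b. M i k)" for i
    \<comment> \<open>Indicator of the first \<open>b\<close> indices; its partial sums are the
      \<open>min a b\<close> that the block sums have to match.\<close>
    define t where "t i = (if i < b then 1 else (0::real))" for i
    have "(\<Sum>k<b. \<Sum>i<n. c i * M i k) = (\<Sum>i<n. r i * c i)"
      by (subst sum.swap) (simp add: r_def sum_distrib_left sum_distrib_right mult.commute)
    also have "\<dots> \<le> (\<Sum>i<n. t i * c i)"
    proof (rule abel_sum_mono[OF c(1,2)])
      fix a assume a: "a \<le> n"
      have "(\<Sum>i<a. t i) = real (min a b)"
        by (induction a) (auto simp: t_def min_def)
      moreover have "(\<Sum>i<a. r i) \<le> (\<Sum>i<a. 1)"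
      proof (rule sum_mono)
        fix i assume "i \<in> {..<a}"
        then show "r i \<le> 1"
          using M(2)[of i] a b sum_mono2[of "{..<m}" "{..<b}" "M i"] M(1) by (auto simp: r_def)
      qed
      moreover have "(\<Sum>i<a. r i) \<le> (\<Sum>k<b. 1)"
      proof -
        have "(\<Sum>i<a. r i) = (\<Sum>k<b. \<Sum>i<a. M i k)"
          unfolding r_def by (rule sum.swap)
        also have "\<dots> \<le> (\<Sum>k<b. 1)"
        proof (rule sum_mono)
          fix k assume "k \<in> {..<b}"
          then show "(\<Sum>i<a. M i k) \<le> 1"
            using M(3)[of k] a b sum_mono2[of "{..<n}" "{..<a}" "\<lambda>i. M i k"] M(1) by auto
        qed
        finally show ?thesis .
      qed
      ultimately show "(\<Sum>i<a. r i) \<le> (\<Sum>i<a. t i)"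
        by simp
    qed
    also have "\<dots> = (\<Sum>i\<in>{..<n} \<inter> {..<b}. c i)"
      by (simp add: t_def sum.inter_restrict if_distrib[of "\<lambda>u. u * _"] cong: if_cong)
    also have "\<dots> \<le> (\<Sum>k<b. c k)"
      by (rule sum_mono2) (use c in auto)
    finally show "(\<Sum>k<b. \<Sum>i<n. c i * M i k) \<le> (\<Sum>k<b. c k)" .
  qed
  also have "(\<Sum>k<m. (\<Sum>i<n. c i * M i k) * s k) = (\<Sum>i<n. \<Sum>k<m. c i * M i k * s k)"
    unfolding sum_distrib_right by (rule sum.swap)
  finally show ?thesis .
qed

text \<open>Sorts the first \<open>n\<close> values. The permutation is extended by the identity
  because the invariance of a norming function concerns bijections of all natural numbers.\<close>

lemma antimono_permutation:
  fixes c :: "nat \<Rightarrow> real"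
  obtains \<sigma> where "bij \<sigma>" "bij_betw \<sigma> {..<n} {..<n}" "\<And>i. i \<ge> n \<Longrightarrow> \<sigma> i = i"
    "\<And>i j. i \<le> j \<Longrightarrow> j < n \<Longrightarrow> c (\<sigma> j) \<le> c (\<sigma> i)"
proof -
  define xs where "xs = sort_key (\<lambda>i. - c i) [0..<n]"
  have len: "length xs = n" and set: "set xs = {..<n}" and dist: "distinct xs"
    by (auto simp: xs_def)
  have sorted: "sorted (map (\<lambda>i. - c i) xs)"
    by (simp add: xs_def)
  define \<sigma> where "\<sigma> i = (if i < n then xs ! i else i)" for i
  have b1: "bij_betw \<sigma> {..<n} {..<n}"
    using bij_betw_nth[OF dist] len set
    by (subst bij_betw_cong[of _ _ "\<lambda>i. xs ! i"]) (auto simp: \<sigma>_def)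
  have b2: "bij_betw \<sigma> {n..} {n..}"
    by (subst bij_betw_cong[of _ _ "\<lambda>i. i"]) (auto simp: \<sigma>_def bij_betw_def)
  have "bij_betw \<sigma> ({..<n} \<union> {n..}) ({..<n} \<union> {n..})"
    by (rule bij_betw_combine[OF b1 b2]) auto
  moreover have "{..<n} \<union> {n..} = UNIV"
    by auto
  ultimately have "bij \<sigma>" by simp
  moreover have "c (\<sigma> j) \<le> c (\<sigma> i)" if "i \<le> j" "j < n" for i j
    using sorted_nth_mono[OF sorted that(1)] that len by (simp add: \<sigma>_def)
  ultimately show ?thesis
    using that[OF _ b1] by (auto simp: \<sigma>_def)
qed

text \<open>Pair with a norming functional, sort it, and use the rearrangement inequality.\<close>

lemma sn_substochastic_le:
  fixes s :: "nat \<Rightarrow> real" and x :: "nat \<Rightarrow> complex" and m n :: nat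
  assumes sn: "sn_function \<Phi>"
    and s: "antimono s" "\<And>k. 0 \<le> s k"
    and M: "\<And>i k. 0 \<le> M i k" "\<And>i. i < n \<Longrightarrow> (\<Sum>k<m. M i k) \<le> 1" "\<And>k. k < m \<Longrightarrow> (\<Sum>i<n. M i k) \<le> 1"
    and x: "\<And>i. i < n \<Longrightarrow> cmod (x i) \<le> (\<Sum>k<m. M i k * s k)"
  shows "\<Phi> (\<lambda>i. if i < n then x i else 0) \<le> \<Phi> (\<lambda>k. if k < m then of_real (s k) else 0)"
proof -
  define s' where "s' k = (if k < m then complex_of_real (s k) else 0)" for k
  have s': "s' \<in> fin_supp"
    unfolding s'_def by (rule fin_supp_restrict)
  obtain c where c: "\<And>i. 0 \<le> c i" "\<And>i. i \<ge> n \<Longrightarrow> c i = 0"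
    "(\<Sum>i<n. c i * cmod (x i)) = \<Phi> (\<lambda>i. if i < n then x i else 0)"
    "\<And>z. z \<in> fin_supp \<Longrightarrow> (\<Sum>i<n. c i * cmod (z i)) \<le> \<Phi> z"
    by (rule sn_norming_functional[OF sn, of n x]) blast
  obtain \<sigma> where \<sigma>: "bij \<sigma>" "bij_betw \<sigma> {..<n} {..<n}" "\<And>i. i \<ge> n \<Longrightarrow> \<sigma> i = i"
    "\<And>i j. i \<le> j \<Longrightarrow> j < n \<Longrightarrow> c (\<sigma> j) \<le> c (\<sigma> i)"
    by (rule antimono_permutation[of n c]) blast
  have inv: "bij (inv \<sigma>)" "\<And>i. inv \<sigma> (\<sigma> i) = i"
    using \<sigma>(1) by (auto simp: bij_imp_bij_inv bij_is_inj)
  have "(\<Sum>i<n. c i * cmod (x i)) \<le> (\<Sum>i<n. c i * (\<Sum>k<m. M i k * s k))"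
    using c(1) x by (intro sum_mono mult_left_mono) auto
  also have "\<dots> = (\<Sum>i<n. \<Sum>k<m. c i * M i k * s k)"
    by (simp add: sum_distrib_left mult.assoc)
  also have "\<dots> = (\<Sum>i<n. \<Sum>k<m. c (\<sigma> i) * M (\<sigma> i) k * s k)"
    using sum.reindex_bij_betw[OF \<sigma>(2), of "\<lambda>i. \<Sum>k<m. c i * M i k * s k"] by simp
  also have "\<dots> \<le> (\<Sum>k<m. c (\<sigma> k) * s k)"
  proof (rule rearrangement_substochastic[OF _ _ _ s M(1)])
    show "antimono (\<lambda>i. c (\<sigma> i))"
    proof (rule antimonoI)
      fix i j :: nat assume "i \<le> j"
      then show "c (\<sigma> j) \<le> c (\<sigma> i)"
        using \<sigma>(3,4) c(1,2) by (cases "j < n") auto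
    qed
    show "(\<Sum>k<m. M (\<sigma> i) k) \<le> 1" if "i < n" for i
      using M(2) \<sigma>(2) that by (auto simp: bij_betw_def)
    show "(\<Sum>i<n. M (\<sigma> i) k) \<le> 1" if "k < m" for k
      using sum.reindex_bij_betw[OF \<sigma>(2), of "\<lambda>i. M i k"] M(3)[OF that] by simp
  qed (use c(1,2) \<sigma>(3) in auto)
  also have "\<dots> = (\<Sum>k<m. c (\<sigma> k) * cmod (s' k))"
    by (rule sum.cong) (auto simp: s'_def s)
  \<comment> \<open>Going through \<open>m + n\<close> avoids comparing \<open>m\<close> with
    \<open>n\<close>: first the sum may grow, then the coefficients vanish from \<open>n\<close>
    on.\<close>
  also have "\<dots> \<le> (\<Sum>k<m + n. c (\<sigma> k) * cmod (s' k))"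
    by (rule sum_mono2) (use c(1) in auto)
  also have "\<dots> = (\<Sum>k<n. c (\<sigma> k) * cmod (s' k))"
    by (rule sum.mono_neutral_right) (use c(2) \<sigma>(3) in auto)
  \<comment> \<open>The permutation moves from the coefficients to \<open>s'\<close>, where the norm
    does not see it.\<close>
  also have "\<dots> = (\<Sum>k<n. c k * cmod (s' (inv \<sigma> k)))"
    using sum.reindex_bij_betw[OF \<sigma>(2), of "\<lambda>k. c k * cmod (s' (inv \<sigma> k))"] inv(2) by simp
  also have "\<dots> \<le> \<Phi> (\<lambda>k. s' (inv \<sigma> k))"
    by (rule c(4)[OF fin_supp_bij[OF s' inv(1)]])
  also have "\<dots> = \<Phi> s'"
    by (rule sn_bij[OF sn s' inv(1)])
  finally show ?thesis
    by (simp add: c(3) s'_def[abs_def])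
qed

section \<open>The p-modification of a norming function\<close>

lemma powr_convex_nonneg:
  assumes "1 \<le> p" "0 \<le> w" "w \<le> 1" "0 \<le> u" "0 \<le> (v::real)"
  shows "(w * u + (1 - w) * v) powr p \<le> w * u powr p + (1 - w) * v powr p"
proof -
  \<comment> \<open>Covers a vanishing endpoint, through r^p <= r on the unit interval.\<close>
  have one: "(r * v) powr p \<le> r * v powr p" if "0 \<le> r" "r \<le> 1" "0 \<le> v" for r v :: real
  proof (cases "r = 0")
    case False
    have "r powr p \<le> r powr 1"
      using that False assms(1) by (intro powr_mono') auto
    then show ?thesis
      using that False by (simp add: powr_mult mult_right_mono)
  qed (use assms in simp)
  show ?thesis
  proof (cases "u = 0 \<or> v = 0")
    case True
    then show ?thesis
      using one[of w u] one[of "1 - w" v] assms by auto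
  next
    case False
    then show ?thesis
      using convex_onD[OF powr_convex[OF assms(1)], of "1 - w" u v] assms by simp
  qed
qed

lemma p_mod_powr:
  assumes "sn_function \<Phi>" "1 \<le> p" "z \<in> fin_supp"
  shows "p_mod \<Phi> p z powr p = \<Phi> (\<lambda>n. complex_of_real (cmod (z n) powr p))"
proof -
  have "0 \<le> \<Phi> (\<lambda>n. complex_of_real (cmod (z n) powr p))"
    by (rule sn_nonneg[OF assms(1)], rule fin_supp_dominated[OF assms(3)]) (use assms in simp)
  then show ?thesis
    using assms by (simp add: p_mod_def powr_powr)
qed

text \<open>Only the triangle inequality takes an argument, which is Minkowski's: the sum is a
  multiple of a convex combination of the normalised sequences; convexity of the p-th power acts
  entrywise, and monotonicity and the triangle inequality of \<Phi> do the rest.\<close>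

lemma sn_function_p_mod:
  assumes sn: "sn_function \<Phi>" and p: "1 \<le> p"
  shows "sn_function (p_mod \<Phi> p)"
proof -
  define P where "P a = (\<lambda>n. complex_of_real (cmod (a n) powr p))" for a :: "nat \<Rightarrow> complex"
  have fs: "P a \<in> fin_supp" if "a \<in> fin_supp" for a
    using that by (rule fin_supp_dominated) (use p in \<open>simp add: P_def\<close>)
  have pm: "p_mod \<Phi> p a = \<Phi> (P a) powr (1 / p)" for a
    by (simp add: p_mod_def P_def)
  have eq0: "p_mod \<Phi> p a = 0 \<longleftrightarrow> a = (\<lambda>_. 0)" if "a \<in> fin_supp" for a
    using sn_eq_0[OF sn fs[OF that]] p by (auto simp: pm P_def fun_eq_iff)
  have nn: "0 \<le> p_mod \<Phi> p a" for a
    by (simp add: pm)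
  have scale: "p_mod \<Phi> p (\<lambda>n. c * a n) = cmod c * p_mod \<Phi> p a" if a: "a \<in> fin_supp" for a c
  proof -
    have "P (\<lambda>n. c * a n) = (\<lambda>n. complex_of_real (cmod c powr p) * P a n)"
      by (simp add: P_def norm_mult powr_mult)
    then have "\<Phi> (P (\<lambda>n. c * a n)) = cmod c powr p * \<Phi> (P a)"
      using sn_scale[OF sn fs[OF a]] by simp
    then show ?thesis
      using p sn_nonneg[OF sn fs[OF a]] by (simp add: pm powr_mult powr_powr)
  qed
  have tri: "p_mod \<Phi> p (\<lambda>n. a n + b n) \<le> p_mod \<Phi> p a + p_mod \<Phi> p b"
    if a: "a \<in> fin_supp" and b: "b \<in> fin_supp" for a b
  proof (cases "p_mod \<Phi> p a = 0 \<or> p_mod \<Phi> p b = 0")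
    case True
    then show ?thesis
      using eq0[OF a] eq0[OF b] nn by auto
  next
    case False
    define \<alpha> where "\<alpha> = p_mod \<Phi> p a"
    define \<beta> where "\<beta> = p_mod \<Phi> p b"
    have pos: "\<alpha> > 0" "\<beta> > 0"
      using False nn[of a] nn[of b] by (auto simp: \<alpha>_def \<beta>_def)
    define w where "w = \<alpha> / (\<alpha> + \<beta>)"
    have w: "0 \<le> w" "w \<le> 1" "1 - w = \<beta> / (\<alpha> + \<beta>)"
      using pos by (auto simp: w_def field_simps)
    \<comment> \<open>Normalised p-th powers, weighted so that \<Phi> takes the values
      \<open>w\<close> and \<open>1 - w\<close> on \<open>u\<close> and \<open>v\<close>.\<close>
    define u where "u n = complex_of_real (w * (\<alpha> powr (- p))) * P a n" for n
    define v where "v n = complex_of_real ((1 - w) * (\<beta> powr (- p))) * P b n" for n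
    have uv: "u \<in> fin_supp" "v \<in> fin_supp"
      unfolding u_def v_def by (intro fin_supp_scale fs a b)+
    have Pa: "\<Phi> (P a) = \<alpha> powr p" "\<Phi> (P b) = \<beta> powr p"
      using p_mod_powr[OF sn p a] p_mod_powr[OF sn p b] by (simp_all add: P_def \<alpha>_def \<beta>_def)
    have pt: "cmod (a n + b n) powr p \<le> (\<alpha> + \<beta>) powr p * cmod (u n + v n)" for n
    proof -
      have "cmod (a n + b n) powr p \<le> (cmod (a n) + cmod (b n)) powr p"
        using p by (intro powr_mono2 norm_triangle_ineq) auto
      also have "cmod (a n) + cmod (b n)
          = (\<alpha> + \<beta>) * (w * (cmod (a n) / \<alpha>) + (1 - w) * (cmod (b n) / \<beta>))"
      proof -
        have "w * (cmod (a n) / \<alpha>) = cmod (a n) / (\<alpha> + \<beta>)"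
            "(1 - w) * (cmod (b n) / \<beta>) = cmod (b n) / (\<alpha> + \<beta>)"
          unfolding w(3) using pos by (simp_all add: w_def)
        then show ?thesis
          using pos by (simp add: distrib_left)
      qed
      also have "\<dots> powr p = (\<alpha> + \<beta>) powr p
          * (w * (cmod (a n) / \<alpha>) + (1 - w) * (cmod (b n) / \<beta>)) powr p"
        by (rule powr_mult)
      also have "\<dots> \<le> (\<alpha> + \<beta>) powr p
          * (w * (cmod (a n) / \<alpha>) powr p + (1 - w) * (cmod (b n) / \<beta>) powr p)"
        using w pos p by (intro mult_left_mono powr_convex_nonneg) auto
      also have "w * (cmod (a n) / \<alpha>) powr p + (1 - w) * (cmod (b n) / \<beta>) powr p = cmod (u n + v n)"
      proof -
        have "u n + v n = of_real (w * (cmod (a n) / \<alpha>) powr p + (1 - w) * (cmod (b n) / \<beta>) powr p)"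
          using pos by (simp add: u_def v_def P_def powr_divide powr_minus_divide)
        moreover have "0 \<le> w * (cmod (a n) / \<alpha>) powr p + (1 - w) * (cmod (b n) / \<beta>) powr p"
          using w(1,2) by simp
        ultimately show ?thesis
          by (simp only: norm_of_real abs_of_nonneg)
      qed
      finally show ?thesis .
    qed
    have "\<Phi> (P (\<lambda>n. a n + b n)) \<le> \<Phi> (\<lambda>n. complex_of_real ((\<alpha> + \<beta>) powr p) * (u n + v n))"
      by (rule sn_mono[OF sn])
        (use pt in \<open>auto intro!: fin_supp_scale fin_supp_add uv simp: P_def norm_mult\<close>)
    also have "\<dots> = (\<alpha> + \<beta>) powr p * \<Phi> (\<lambda>n. u n + v n)"
      using sn_scale[OF sn fin_supp_add[OF uv]] by simp
    also have "\<dots> \<le> (\<alpha> + \<beta>) powr p * (\<Phi> u + \<Phi> v)"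
      by (intro mult_left_mono sn_triangle[OF sn] uv) simp
    also have "\<Phi> u = w"
      unfolding u_def sn_scale[OF sn fs[OF a]] Pa norm_of_real
      using w pos by (simp add: powr_minus_divide)
    also have "\<Phi> v = 1 - w"
      unfolding v_def sn_scale[OF sn fs[OF b]] Pa norm_of_real
      using w pos by (simp add: powr_minus_divide)
    finally have "\<Phi> (P (\<lambda>n. a n + b n)) \<le> (\<alpha> + \<beta>) powr p"
      by simp
    then have "\<Phi> (P (\<lambda>n. a n + b n)) powr (1 / p) \<le> ((\<alpha> + \<beta>) powr p) powr (1 / p)"
      using p sn_nonneg[OF sn fs[OF fin_supp_add[OF a b]]] by (intro powr_mono2) auto
    then show ?thesis
      using p pos by (simp add: pm powr_powr \<alpha>_def[symmetric] \<beta>_def[symmetric] flip: pm)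
  qed
  have unit: "p_mod \<Phi> p (\<lambda>n. if n = 0 then 1 else 0) = 1"
  proof -
    have "P (\<lambda>n. if n = 0 then 1 else 0) = (\<lambda>n. if n = 0 then 1 else 0)"
      using p by (auto simp: P_def)
    then show ?thesis
      by (simp add: pm sn_unit[OF sn])
  qed
  have bij: "p_mod \<Phi> p (\<lambda>n. a (\<sigma> n)) = p_mod \<Phi> p a" if "a \<in> fin_supp" "bij \<sigma>" for a \<sigma>
    using sn_bij[OF sn fs[OF that(1)] that(2)] by (simp add: pm P_def)
  show ?thesis
    unfolding sn_function_def
    using nn eq0 scale tri unit bij by (auto simp: p_mod_def)
qed

section \<open>Functional calculus\<close>

instance complex_hilbert \<subseteq> banach ..

text \<open>Complex linearity comes with the symmetry, see \<open>selfadj_bop\<close>.\<close>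

definition selfadj :: "'h::complex_hilbert \<Rightarrow>\<^sub>L 'h \<Rightarrow> bool"
  where "selfadj T \<longleftrightarrow> (\<forall>x y. cinner (T x) y = cinner x (T y))"

definition pos_op :: "'h::complex_hilbert \<Rightarrow>\<^sub>L 'h \<Rightarrow> bool"
  where "pos_op T \<longleftrightarrow> selfadj T \<and> (\<forall>x. 0 \<le> Re (cinner (T x) x))"

lemma selfadjD: "selfadj T \<Longrightarrow> cinner (T x) y = cinner x (T y)"
  by (simp add: selfadj_def)

lemma selfadj_bop: "selfadj T \<Longrightarrow> T \<in> bop"
  by (intro bopI cinner_eqI) (simp add: selfadjD cinner_scaleC_left)

lemma pos_op_bop: "pos_op T \<Longrightarrow> T \<in> bop"
  by (simp add: pos_op_def selfadj_bop)

lemma pos_opD: "pos_op T \<Longrightarrow> 0 \<le> Re (cinner (T x) x)"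
  by (simp add: pos_op_def)

lemma selfadj_limit:
  assumes "\<And>n. selfadj (X n)" "X \<longlonglongrightarrow> A"
  shows "selfadj A"
  unfolding selfadj_def
proof (intro allI)
  fix x y
  have ev: "(\<lambda>n. X n z) \<longlonglongrightarrow> A z" for z
    by (intro blinfun.tendsto assms tendsto_const)
  have "(\<lambda>n. cinner (X n x) y) \<longlonglongrightarrow> cinner (A x) y"
    by (intro tendsto_cinner_left ev)
  moreover have "(\<lambda>n. cinner (X n x) y) \<longlonglongrightarrow> cinner x (A y)"
    unfolding selfadjD[OF assms(1)] by (intro tendsto_cinner_right ev)
  ultimately show "cinner (A x) y = cinner x (A y)"
    by (rule LIMSEQ_unique)
qed

lemma selfadj_cinner_real: "selfadj T \<Longrightarrow> cinner (T x) x = of_real (Re (cinner (T x) x))"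
proof -
  assume T: "selfadj T"
  have "Im (cinner (T x) x) = - Im (cinner (T x) x)"
    using arg_cong[OF cinner_commute[of "T x" x], of Im] selfadjD[OF T, of x x] by simp
  then show ?thesis
    by (simp add: complex_eq_iff)
qed

lemma norm_attained_approx:
  fixes S :: "'h::complex_hilbert \<Rightarrow>\<^sub>L 'h"
  assumes "S \<noteq> 0"
  obtains x where "\<And>n. norm (x n) = 1" "(\<lambda>n. norm (S (x n))) \<longlonglongrightarrow> norm S"
proof -
  define N where "N = norm S"
  have N: "N > 0" using assms by (simp add: N_def)
  have "\<exists>x. norm x = 1 \<and> N - N / (real n + 2) < norm (S x)" for n
  proof (rule ccontr)
    assume "\<not> ?thesis"
    then have *: "norm (S x) \<le> N - N / (real n + 2)" if "norm x = 1" for x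
      using that by (meson not_le)
    have "N / (real n + 2) \<le> N"
      using N by (simp add: field_simps)
    then have "norm S \<le> N - N / (real n + 2)"
      by (intro norm_blinfun_le_unit *) auto
    then show False
      using N by (simp add: N_def[symmetric] divide_le_0_iff)
  qed
  then obtain x where x: "\<And>n. norm (x n) = 1" "\<And>n. N - N / (real n + 2) < norm (S (x n))"
    by metis
  have up: "norm (S (x n)) \<le> N" for n
    using norm_blinfun[of S "x n"] x(1) by (simp add: N_def)
  have "(\<lambda>n. N / (real n + 2)) \<longlonglongrightarrow> 0"
    using LIMSEQ_ignore_initial_segment[OF lim_const_over_n[of N], of 2] by (simp add: add.commute)
  from tendsto_diff[OF tendsto_const[of N] this]
  have lo: "(\<lambda>n. N - N / (real n + 2)) \<longlonglongrightarrow> N"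
    by simp
  have "(\<lambda>n. norm (S (x n))) \<longlonglongrightarrow> N"
    by (rule tendsto_sandwich[OF _ _ lo tendsto_const])
      (auto intro!: always_eventually less_imp_le[OF x(2)] up)
  then show ?thesis
    by (intro that[of x]) (simp_all add: N_def x(1))
qed

text \<open>Expanding the square bounds it by 2 N^4 - 2 N^2 ||S x_n||^2, which tends to 0. The
  square of \<open>S\<close> appears because a self-adjoint operator may attain its norm N at the
  spectral value N or at -N.\<close>

lemma selfadj_approx_eigen:
  fixes S :: "'h::complex_hilbert \<Rightarrow>\<^sub>L 'h"
  assumes "selfadj S" "\<And>n. norm (x n) = 1" "(\<lambda>n. norm (S (x n))) \<longlonglongrightarrow> norm S"
  shows "(\<lambda>n. S (S (x n)) - (norm S)\<^sup>2 *\<^sub>R x n) \<longlonglongrightarrow> 0"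
proof -
  define N where "N = norm S"
  have sq: "(norm (S (S (x n)) - N\<^sup>2 *\<^sub>R x n))\<^sup>2 \<le> 2 * N^4 - 2 * N\<^sup>2 * (norm (S (x n)))\<^sup>2" for n
  proof -
    have "(norm (S (S (x n)) - N\<^sup>2 *\<^sub>R x n))\<^sup>2
        = (norm (S (S (x n))))\<^sup>2 - 2 * N\<^sup>2 * (norm (S (x n)))\<^sup>2 + N^4"
      using assms(2)[of n] selfadjD[OF assms(1), of "S (x n)" "x n"]
      by (simp add: norm_diff_sq cinner_scaleR_right cinner_self_Re)
    moreover have "norm (S (S (x n))) \<le> N * (N * 1)"
      unfolding N_def using norm_blinfun[of S "x n"] assms(2)[of n]
      by (intro order_trans[OF norm_blinfun] mult_left_mono) auto
    then have "(norm (S (S (x n))))\<^sup>2 \<le> N^4"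
      using power_mono[of "norm (S (S (x n)))" "N * N" 2] by (simp add: power_mult_distrib)
    ultimately show ?thesis by simp
  qed
  have "(\<lambda>n. 2 * N^4 - 2 * N\<^sup>2 * (norm (S (x n)))\<^sup>2) \<longlonglongrightarrow> 2 * N^4 - 2 * N\<^sup>2 * N\<^sup>2"
    unfolding N_def by (intro tendsto_intros assms)
  then have "(\<lambda>n. 2 * N^4 - 2 * N\<^sup>2 * (norm (S (x n)))\<^sup>2) \<longlonglongrightarrow> 0"
    by (simp add: power2_eq_square power4_eq_xxxx)
  then have "(\<lambda>n. (norm (S (S (x n)) - N\<^sup>2 *\<^sub>R x n))\<^sup>2) \<longlonglongrightarrow> 0"
    by (rule tendsto_sandwich[OF _ _ tendsto_const, rotated 2])
      (auto intro!: always_eventually sq)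
  then have "(\<lambda>n. sqrt ((norm (S (S (x n)) - N\<^sup>2 *\<^sub>R x n))\<^sup>2)) \<longlonglongrightarrow> sqrt 0"
    by (rule tendsto_real_sqrt)
  then show ?thesis
    by (simp add: tendsto_norm_zero_iff N_def)
qed

section \<open>Polynomials in an operator, bounded by their supremum norm\<close>

lemma poly_op_upto:
  "n \<ge> degree P \<Longrightarrow> poly_op P T = (\<Sum>i\<le>n. coeff P i *\<^sub>R (((o\<^sub>L) T ^^ i) id_blinfun))"
  unfolding poly_op_def
  by (rule sum.mono_neutral_left) (auto simp: coeff_eq_0)

lemma blinfun_compose_sum_right: "T o\<^sub>L (\<Sum>i\<in>I. f i) = (\<Sum>i\<in>I. T o\<^sub>L f i)"
  by (rule blinfun_eqI) (simp add: blinfun.sum_left blinfun.sum_right)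

lemma blinfun_compose_scaleR_right: "T o\<^sub>L (r *\<^sub>R f) = r *\<^sub>R (T o\<^sub>L f)"
  by (rule blinfun_eqI) (simp add: blinfun.scaleR_left blinfun.scaleR_right)

lemma poly_op_pCons: "poly_op (pCons a P) T = a *\<^sub>R id_blinfun + (T o\<^sub>L poly_op P T)"
proof -
  have "poly_op (pCons a P) T
      = (\<Sum>i\<le>Suc (degree P). coeff (pCons a P) i *\<^sub>R (((o\<^sub>L) T ^^ i) id_blinfun))"
    by (rule poly_op_upto) (rule degree_pCons_le)
  then show ?thesis
    by (simp only: sum.atMost_Suc_shift)
      (simp add: poly_op_def blinfun_compose_sum_right blinfun_compose_scaleR_right)
qed

lemma poly_op_0: "poly_op 0 T = 0"
  by (simp add: poly_op_def)

lemma poly_op_add: "poly_op (P + Q) T = poly_op P T + poly_op Q T"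
  by (induction P Q rule: poly_induct2)
    (auto simp: poly_op_0 poly_op_pCons intro!: blinfun_eqI
      simp: blinfun.add_left blinfun.add_right blinfun.scaleR_left scaleR_add_left)

lemma poly_op_smult: "poly_op (smult r P) T = r *\<^sub>R poly_op P T"
  by (induction P) (auto simp: poly_op_0 poly_op_pCons intro!: blinfun_eqI
      simp: blinfun.add_left blinfun.scaleR_left blinfun.scaleR_right scaleR_add_right)

lemma poly_op_diff: "poly_op (P - Q) T = poly_op P T - poly_op Q T"
  using poly_op_add[of P "smult (-1) Q" T] poly_op_smult[of "-1" Q T] by simp

lemma poly_op_mult: "poly_op (P * Q) T = poly_op P T o\<^sub>L poly_op Q T"
proof (induction P)
  case 0
  show ?case by (auto simp: poly_op_0 intro!: blinfun_eqI)
next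
  case (pCons a P)
  have "poly_op (pCons a P * Q) T = a *\<^sub>R poly_op Q T + (T o\<^sub>L (poly_op P T o\<^sub>L poly_op Q T))"
    using pCons by (simp add: poly_op_add poly_op_smult poly_op_pCons)
  then show ?case
    by (auto intro!: blinfun_eqI simp: poly_op_pCons blinfun.add_left blinfun.scaleR_left)
qed

lemma poly_op_commute: "T (poly_op P T x) = poly_op P T (T x)"
  by (induction P)
    (simp_all add: poly_op_0 poly_op_pCons blinfun.add_left blinfun.add_right blinfun.scaleR_left
      blinfun.scaleR_right)

lemma selfadj_poly_op: "selfadj T \<Longrightarrow> selfadj (poly_op P T)"
proof (induction P)
  case 0
  show ?case by (simp add: poly_op_0 selfadj_def)
next
  case (pCons a P)
  then show ?case
    by (simp add: selfadj_def poly_op_pCons blinfun.add_left blinfun.scaleR_left cinner_simps)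
      (simp add: poly_op_commute selfadjD)
qed

text \<open>Complex polynomials in \<open>T\<close>, by Horner's scheme on vectors. They are there
  because a real polynomial has to be split into linear factors over the complex numbers.\<close>

definition cpoly_act :: "complex poly \<Rightarrow> ('h::complex_hilbert \<Rightarrow>\<^sub>L 'h) \<Rightarrow> 'h \<Rightarrow> 'h"
  where "cpoly_act P T = fold_coeffs (\<lambda>a f x. a *\<^sub>C x + T (f x)) P (\<lambda>_. 0)"

lemma cpoly_act_0: "cpoly_act 0 T x = 0"
  by (simp add: cpoly_act_def)

lemma cpoly_act_pCons: "cpoly_act (pCons a P) T x = a *\<^sub>C x + T (cpoly_act P T x)"
  by (cases "P = 0"; cases "a = 0") (simp_all add: cpoly_act_def)

lemma cpoly_act_add: "cpoly_act (P + Q) T x = cpoly_act P T x + cpoly_act Q T x"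
  by (induction P Q rule: poly_induct2)
    (simp_all add: cpoly_act_0 cpoly_act_pCons blinfun.add_right scaleC_add_left)

lemma cpoly_act_smult: "T \<in> bop \<Longrightarrow> cpoly_act (smult r P) T x = r *\<^sub>C cpoly_act P T x"
  by (induction P)
    (simp_all add: cpoly_act_0 cpoly_act_pCons bop_scaleC scaleC_add_right scaleC_scaleC)

lemma cpoly_act_linear_factor:
  assumes "T \<in> bop"
  shows "cpoly_act ([:- r, 1:] * P) T x = T (cpoly_act P T x) - r *\<^sub>C cpoly_act P T x"
proof -
  have "[:- r, 1:] * P = pCons 0 P + smult (- r) P"
    by simp
  then show ?thesis
    by (simp only: cpoly_act_add cpoly_act_smult[OF assms] cpoly_act_pCons scaleC_minus_left) simp
qed

lemma cpoly_act_of_real: "cpoly_act (map_poly of_real P) T x = poly_op P T x"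
  by (induction P)
    (simp_all add: cpoly_act_0 poly_op_0 map_poly_pCons cpoly_act_pCons poly_op_pCons
      blinfun.add_left blinfun.scaleR_left scaleR_scaleC[of _ "_ :: 'a"])

lemma scaleC_scaleR: "c *\<^sub>C (a *\<^sub>R x) = a *\<^sub>R (c *\<^sub>C (x::'a::complex_vector))"
  by (simp add: scaleR_scaleC scaleC_scaleC mult.commute)

text \<open>Substitute for the spectral mapping theorem. Split off a root, P = (X - r) Q. If Q(T)
  x_n tends to 0, pass to Q; otherwise infinitely many Q(T) x_n stay away from 0 and, normalised,
  they are approximate eigenvectors for r.\<close>

lemma approx_eigenvalue_root:
  fixes T :: "'h::complex_hilbert \<Rightarrow>\<^sub>L 'h"
  assumes "T \<in> bop" "P \<noteq> 0" "\<And>n. norm (x n) = 1" "(\<lambda>n. cpoly_act P T (x n)) \<longlonglongrightarrow> 0"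
  shows "\<exists>r y. poly P r = 0 \<and> (\<forall>n::nat. norm (y n) = 1) \<and> (\<lambda>n. T (y n) - r *\<^sub>C y n) \<longlonglongrightarrow> 0"
  using assms(2-4)
proof (induction "degree P" arbitrary: P x rule: less_induct)
  case less
  show ?case
  \<comment> \<open>The exceptional case of the fundamental theorem of algebra, a nonzero constant;
    it contradicts \<open>norm (x n) = 1\<close>.\<close>
  proof (cases "\<exists>a l. a \<noteq> 0 \<and> l = 0 \<and> P = pCons a l")
    case True
    then obtain a where a: "a \<noteq> 0" "P = [:a:]" by auto
    have "(\<lambda>n. norm (cpoly_act P T (x n))) \<longlonglongrightarrow> 0"
      using less.prems(3) by (simp add: tendsto_norm_zero)
    then show ?thesis
      using a less.prems(2) by (simp add: cpoly_act_pCons cpoly_act_0 norm_scaleC LIMSEQ_const_iff)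
  next
    case False
    then obtain r where r: "poly P r = 0"
      using fundamental_theorem_of_algebra_alt[of P] by auto
    then obtain Q where Q: "P = [:- r, 1:] * Q"
      by (metis poly_eq_0_iff_dvd dvdE)
    have "Q \<noteq> 0" using Q less.prems(1) by auto
    then have deg: "degree Q < degree P"
      unfolding Q by (subst degree_mult_eq) auto
    define z where "z n = cpoly_act Q T (x n)" for n
    have zlim: "(\<lambda>n. T (z n) - r *\<^sub>C z n) \<longlonglongrightarrow> 0"
      using less.prems(3) by (simp only: Q cpoly_act_linear_factor[OF assms(1)] z_def)
    show ?thesis
    proof (cases "z \<longlonglongrightarrow> 0")
      case True
      then obtain r' y where "poly Q r' = 0" "\<forall>n::nat. norm (y n) = 1" "(\<lambda>n. T (y n) - r' *\<^sub>C y n) \<longlonglongrightarrow> 0"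
        using less.hyps[OF deg \<open>Q \<noteq> 0\<close>, of x] less.prems(2) unfolding z_def by auto
      then show ?thesis
        unfolding Q by (intro exI[of _ r'] exI[of _ y]) simp
    next
      case False
      then obtain e where e: "e > 0" "\<And>N. \<exists>n\<ge>N. e \<le> norm (z n)"
        by (auto simp: LIMSEQ_def not_less)
      then obtain f where f: "\<And>N. f N \<ge> N" "\<And>N. e \<le> norm (z (f N))"
        by metis
      have flim: "filterlim f at_top sequentially"
        by (rule filterlim_at_top_mono[OF filterlim_ident]) (use f in auto)
      define y where "y n = (1 / norm (z (f n))) *\<^sub>R z (f n)" for n
      have ny: "norm (y n) = 1" for n
        using f(2)[of n] e(1) by (auto simp: y_def)
      have bd: "norm (T (y n) - r *\<^sub>C y n) \<le> norm (T (z (f n)) - r *\<^sub>C z (f n)) / e" for n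
      proof -
        have "T (y n) - r *\<^sub>C y n = (1 / norm (z (f n))) *\<^sub>R (T (z (f n)) - r *\<^sub>C z (f n))"
          by (simp add: y_def blinfun.scaleR_right scaleC_scaleR scaleR_diff_right)
        then have "norm (T (y n) - r *\<^sub>C y n) = norm (T (z (f n)) - r *\<^sub>C z (f n)) / norm (z (f n))"
          by simp
        also have "\<dots> \<le> norm (T (z (f n)) - r *\<^sub>C z (f n)) / e"
          using f(2)[of n] e(1) by (intro divide_left_mono mult_pos_pos) auto
        finally show ?thesis .
      qed
      have "(\<lambda>n. norm (T (z (f n)) - r *\<^sub>C z (f n)) / e) \<longlonglongrightarrow> 0"
        using tendsto_divide[OF tendsto_norm_zero[OF filterlim_compose[OF zlim flim]] tendsto_const[of e]] e(1)
        by simp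
      then have lim: "(\<lambda>n. T (y n) - r *\<^sub>C y n) \<longlonglongrightarrow> 0"
        by (intro Lim_null_comparison[OF always_eventually[OF allI[OF bd]]])
      then show ?thesis
        by (intro exI[of _ r] exI[of _ y] conjI allI r ny lim)
    qed
  qed
qed

lemma poly_map_of_real: "poly (map_poly complex_of_real P) (of_real x) = of_real (poly P x)"
  by (induction P) (simp_all add: map_poly_pCons)

text \<open>P(T) is self-adjoint with norm N, so P^2 - N^2 at T annihilates some unit vectors
  approximately. A root r of P^2 - N^2 is then an approximate eigenvalue of \<open>T\<close>, hence
  lies in \<open>{0..norm T}\<close>, and |P(r)| = N.\<close>

lemma poly_op_norm_le:
  fixes T :: "'h::complex_hilbert \<Rightarrow>\<^sub>L 'h"
  assumes T: "pos_op T" and K: "\<And>r. r \<in> {0..norm T} \<Longrightarrow> \<bar>poly P r\<bar> \<le> K"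
  shows "norm (poly_op P T) \<le> K"
proof -
  have sa: "selfadj T" using T by (simp add: pos_op_def)
  define S where "S = poly_op P T"
  define N where "N = norm S"
  have K0: "0 \<le> K" using K[of 0] by auto
  show ?thesis
  proof (cases "S = 0")
    case True
    then show ?thesis using K0 by (simp add: S_def)
  next
    case False
    have S: "selfadj S" unfolding S_def by (rule selfadj_poly_op[OF sa])
    obtain x where x: "\<And>n. norm (x n) = 1" "(\<lambda>n. norm (S (x n))) \<longlonglongrightarrow> norm S"
      using norm_attained_approx[OF False] by blast
    define Q where "Q = P * P - [:N\<^sup>2:]"
    have Qx: "poly_op Q T v = S (S v) - N\<^sup>2 *\<^sub>R v" for v
      by (simp add: Q_def poly_op_diff poly_op_mult poly_op_pCons poly_op_0 S_def
          blinfun.diff_left blinfun.add_left blinfun.scaleR_left)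
    have pQ: "poly Q r = (poly P r)\<^sup>2 - N\<^sup>2" for r
      by (simp add: Q_def power2_eq_square)
    have "\<exists>r\<in>{0..norm T}. poly Q r = 0"
    proof (cases "Q = 0")
      case True
      then show ?thesis by (intro bexI[of _ 0]) auto
    next
      case False
      have Q0: "map_poly complex_of_real Q \<noteq> 0"
        using False by (subst map_poly_eq_0_iff) auto
      have "(\<lambda>n. cpoly_act (map_poly of_real Q) T (x n)) \<longlonglongrightarrow> 0"
        unfolding cpoly_act_of_real Qx N_def by (rule selfadj_approx_eigen[OF S x])
      from approx_eigenvalue_root[OF selfadj_bop[OF sa] Q0 x(1) this]
      obtain r and y :: "nat \<Rightarrow> 'h" where r: "poly (map_poly complex_of_real Q) r = 0"
        and y: "\<And>n. norm (y n) = 1" "(\<lambda>n. T (y n) - r *\<^sub>C y n) \<longlonglongrightarrow> 0"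
        by auto
      \<comment> \<open>Rayleigh quotients: positivity keeps them in \<open>{0..norm T}\<close>, and
        their convergence to \<open>r\<close> forces \<open>r\<close> to be real and in that
        interval.\<close>
      define t where "t n = Re (cinner (T (y n)) (y n))" for n
      have t: "t n \<in> {0..norm T}" for n
      proof -
        have "t n \<le> norm (T (y n)) * norm (y n)"
          unfolding t_def using cmod_cinner_le complex_Re_le_cmod order_trans by blast
        then show ?thesis
          using pos_opD[OF T, of "y n"] norm_blinfun[of T "y n"] y(1)[of n] by (simp add: t_def)
      qed
      have "norm (of_real (t n) - r) \<le> norm (T (y n) - r *\<^sub>C y n)" for n
      proof -
        have "of_real (t n) - r = cinner (T (y n) - r *\<^sub>C y n) (y n)"
          using selfadj_cinner_real[OF sa, of "y n"] y(1)[of n]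
          by (simp add: t_def cinner_simps cinner_self)
        then show ?thesis
          using cmod_cinner_le[of "T (y n) - r *\<^sub>C y n" "y n"] y(1)[of n] by simp
      qed
      then have "(\<lambda>n. of_real (t n) - r) \<longlonglongrightarrow> 0"
        by (intro Lim_null_comparison[OF always_eventually tendsto_norm_zero[OF y(2)]]) auto
      then have tl: "(\<lambda>n. of_real (t n)) \<longlonglongrightarrow> r"
        by (simp add: LIM_zero_iff)
      then have "t \<longlonglongrightarrow> Re r"
        using tendsto_Re by fastforce
      then have "Re r \<in> {0..norm T}"
        by (rule closed_sequentially[OF closed_atLeastAtMost t])
      moreover have "Im r = 0"
        using tendsto_Im[OF tl] by (simp add: LIMSEQ_const_iff)
      then have "r = of_real (Re r)"
        by (simp add: complex_eq_iff)
      then have "complex_of_real (poly Q (Re r)) = 0"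
        using r by (metis poly_map_of_real)
      ultimately show ?thesis by auto
    qed
    then obtain r where "r \<in> {0..norm T}" "(poly P r)\<^sup>2 = N\<^sup>2"
      by (auto simp: pQ)
    then show ?thesis
      using K[of r] by (simp add: power2_eq_iff N_def S_def) (metis abs_norm_cancel abs_minus)
  qed
qed

lemma weierstrass_polynomials:
  fixes f :: "real \<Rightarrow> real"
  assumes "continuous_on {a..b} f"
  obtains P :: "nat \<Rightarrow> real poly" where "uniform_limit {a..b} (\<lambda>n. poly (P n)) f sequentially"
proof -
  have "\<exists>P :: real poly. \<forall>x\<in>{a..b}. \<bar>f x - poly P x\<bar> < 1 / real (Suc n)" for n
  proof -
    obtain g where g: "real_polynomial_function g" "\<And>x. x \<in> {a..b} \<Longrightarrow> \<bar>f x - g x\<bar> < 1 / real (Suc n)"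
      by (rule Stone_Weierstrass_real_polynomial_function[OF compact_Icc assms, of "1 / real (Suc n)"]) auto
    then obtain c m where "g = (\<lambda>x. \<Sum>i\<le>m. c i * x ^ i)"
      using real_polynomial_function_iff_sum by blast
    then have "g = poly (\<Sum>i\<le>m. monom (c i) i)"
      by (simp add: poly_sum poly_monom fun_eq_iff)
    then show ?thesis using g(2) by blast
  qed
  then obtain P :: "nat \<Rightarrow> real poly"
    where P: "\<And>n x. x \<in> {a..b} \<Longrightarrow> \<bar>f x - poly (P n) x\<bar> < 1 / real (Suc n)"
    by metis
  have "uniform_limit {a..b} (\<lambda>n. poly (P n)) f sequentially"
    unfolding uniform_limit_sequentially_iff
  proof (intro allI impI)
    fix e :: real assume "e > 0"
    then obtain N where N: "1 / real (Suc N) < e"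
      using nat_approx_posE by blast
    have "dist (poly (P n) x) (f x) < e" if "n \<ge> N" "x \<in> {a..b}" for n x
    proof -
      have "1 / real (Suc n) \<le> 1 / real (Suc N)"
        using that by (intro divide_left_mono) auto
      then show ?thesis
        using P[OF that(2), of n] N by (simp add: dist_real_def abs_minus_commute)
    qed
    then show "\<exists>N. \<forall>n\<ge>N. \<forall>x\<in>{a..b}. dist (poly (P n) x) (f x) < e" by blast
  qed
  then show ?thesis by (rule that)
qed

section \<open>Continuous functional calculus of a positive operator\<close>

context
  fixes T :: "'h::complex_hilbert \<Rightarrow>\<^sub>L 'h"
  assumes T: "pos_op T"
begin

text \<open>The norm bound for \<open>P m - Q n\<close> serves twice: with equal sequences it gives
  the Cauchy property, with different ones the independence of the limit from the approximating
  polynomials.\<close>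

lemma poly_op_close:
  assumes "uniform_limit {0..norm T} (\<lambda>n. poly (P n)) f sequentially"
    and "uniform_limit {0..norm T} (\<lambda>n. poly (Q n)) f sequentially" and "e > 0"
  shows "\<exists>N. \<forall>m\<ge>N. \<forall>n\<ge>N. norm (poly_op (P m) T - poly_op (Q n) T) \<le> e"
proof -
  obtain N1 where N1: "\<And>n x. n \<ge> N1 \<Longrightarrow> x \<in> {0..norm T} \<Longrightarrow> dist (poly (P n) x) (f x) < e / 2"
    using assms unfolding uniform_limit_sequentially_iff by (meson half_gt_zero)
  obtain N2 where N2: "\<And>n x. n \<ge> N2 \<Longrightarrow> x \<in> {0..norm T} \<Longrightarrow> dist (poly (Q n) x) (f x) < e / 2"
    using assms unfolding uniform_limit_sequentially_iff by (meson half_gt_zero)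
  have "norm (poly_op (P m) T - poly_op (Q n) T) \<le> e" if "m \<ge> max N1 N2" "n \<ge> max N1 N2" for m n
    unfolding poly_op_diff[symmetric]
  proof (rule poly_op_norm_le[OF T])
    fix r assume "r \<in> {0..norm T}"
    then have "\<bar>poly (P m) r - f r\<bar> < e / 2" "\<bar>poly (Q n) r - f r\<bar> < e / 2"
      using N1[of m r] N2[of n r] that by (simp_all add: dist_real_def)
    then show "\<bar>poly (P m - Q n) r\<bar> \<le> e"
      unfolding poly_diff by linarith
  qed
  then show ?thesis by blast
qed

lemma poly_op_same_limit:
  assumes "uniform_limit {0..norm T} (\<lambda>n. poly (P n)) f sequentially"
    and "uniform_limit {0..norm T} (\<lambda>n. poly (Q n)) f sequentially"
    and "(\<lambda>n. poly_op (P n) T) \<longlonglongrightarrow> S"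
  shows "(\<lambda>n. poly_op (Q n) T) \<longlonglongrightarrow> S"
proof -
  have "(\<lambda>n. poly_op (P n) T - poly_op (Q n) T) \<longlonglongrightarrow> 0"
    unfolding LIMSEQ_def
  proof (intro allI impI)
    fix r :: real assume "r > 0"
    then show "\<exists>N. \<forall>n\<ge>N. dist (poly_op (P n) T - poly_op (Q n) T) 0 < r"
      using poly_op_close[OF assms(1,2), of "r / 2"] by fastforce
  qed
  from tendsto_diff[OF assms(3) this] show ?thesis by simp
qed

text \<open>Gives meaning to the definite description in \<open>fun_calc\<close>: the limit exists
  by completeness and is the same for every approximating sequence. Some approximating sequence has
  to exist, otherwise the described condition would be vacuous.\<close>

lemma poly_op_tendsto_fun_calc:
  assumes "uniform_limit {0..norm T} (\<lambda>n. poly (P n)) f sequentially"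
  shows "(\<lambda>n. poly_op (P n) T) \<longlonglongrightarrow> fun_calc f T"
proof -
  have "Cauchy (\<lambda>n. poly_op (P n) T)"
  proof (rule metric_CauchyI)
    fix e :: real assume "e > 0"
    then show "\<exists>M. \<forall>m\<ge>M. \<forall>n\<ge>M. dist (poly_op (P m) T) (poly_op (P n) T) < e"
      using poly_op_close[OF assms assms, of "e / 2"] by (fastforce simp: dist_norm)
  qed
  then obtain S where S: "(\<lambda>n. poly_op (P n) T) \<longlonglongrightarrow> S"
    using Cauchy_convergent convergent_def by blast
  have "fun_calc f T = S"
    unfolding fun_calc_def
  proof (rule the_equality)
    show "\<forall>P. uniform_limit {0..norm T} (\<lambda>n. poly (P n)) f sequentially \<longrightarrow> (\<lambda>n. poly_op (P n) T) \<longlonglongrightarrow> S"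
      using poly_op_same_limit[OF assms _ S] by blast
  qed (use assms S LIMSEQ_unique in blast)
  then show ?thesis using S by simp
qed

lemma fun_calc_poly: "fun_calc (poly P) T = poly_op P T"
proof -
  have "uniform_limit {0..norm T} (\<lambda>n. poly P) (poly P) sequentially"
    by (intro uniform_limit_const)
  then have "(\<lambda>n::nat. poly_op P T) \<longlonglongrightarrow> fun_calc (poly P) T"
    by (rule poly_op_tendsto_fun_calc)
  then show ?thesis by (simp add: LIMSEQ_const_iff)
qed

lemma fun_calc_cong:
  assumes "continuous_on {0..norm T} f" "\<And>x. x \<in> {0..norm T} \<Longrightarrow> f x = g x"
  shows "fun_calc f T = fun_calc g T"
proof -
  obtain P where P: "uniform_limit {0..norm T} (\<lambda>n. poly (P n)) f sequentially"
    using weierstrass_polynomials[OF assms(1)] by blast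
  moreover have "uniform_limit {0..norm T} (\<lambda>n. poly (P n)) g sequentially"
    using P assms(2) by (subst uniform_limit_cong'[where h = g and i = f]) auto
  ultimately show ?thesis
    using poly_op_tendsto_fun_calc LIMSEQ_unique by blast
qed

lemma fun_calc_mult:
  assumes "continuous_on {0..norm T} f" "continuous_on {0..norm T} g"
  shows "fun_calc (\<lambda>x. f x * g x) T = fun_calc f T o\<^sub>L fun_calc g T"
proof -
  obtain P where P: "uniform_limit {0..norm T} (\<lambda>n. poly (P n)) f sequentially"
    using weierstrass_polynomials[OF assms(1)] by blast
  obtain Q where Q: "uniform_limit {0..norm T} (\<lambda>n. poly (Q n)) g sequentially"
    using weierstrass_polynomials[OF assms(2)] by blast
  have "bounded (f ` {0..norm T})" "bounded (g ` {0..norm T})"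
    using assms by (auto intro!: compact_imp_bounded compact_continuous_image)
  then have "uniform_limit {0..norm T} (\<lambda>n x. poly (P n) x * poly (Q n) x) (\<lambda>x. f x * g x) sequentially"
    by (intro uniform_lim_mult P Q)
  then have "uniform_limit {0..norm T} (\<lambda>n. poly (P n * Q n)) (\<lambda>x. f x * g x) sequentially"
    by (simp add: poly_mult[abs_def])
  then have "(\<lambda>n. poly_op (P n * Q n) T) \<longlonglongrightarrow> fun_calc (\<lambda>x. f x * g x) T"
    by (rule poly_op_tendsto_fun_calc)
  moreover have "(\<lambda>n. poly_op (P n * Q n) T) \<longlonglongrightarrow> (fun_calc f T o\<^sub>L fun_calc g T)"
    unfolding poly_op_mult
    by (intro bounded_bilinear.tendsto[OF bounded_bilinear_blinfun_compose]
        poly_op_tendsto_fun_calc P Q)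
  ultimately show ?thesis by (rule LIMSEQ_unique)
qed

lemma selfadj_fun_calc:
  assumes "continuous_on {0..norm T} f"
  shows "selfadj (fun_calc f T)"
proof -
  obtain P where "uniform_limit {0..norm T} (\<lambda>n. poly (P n)) f sequentially"
    using weierstrass_polynomials[OF assms] by blast
  from poly_op_tendsto_fun_calc[OF this] show ?thesis
    by (rule selfadj_limit[rotated]) (use T in \<open>auto simp: pos_op_def intro: selfadj_poly_op\<close>)
qed

text \<open>\<open>f\<close> is the square of its root on the interval, so the quadratic form of
  \<open>f(T)\<close> is the squared norm of the root applied to \<open>x\<close>.\<close>

lemma pos_op_fun_calc:
  assumes "continuous_on {0..norm T} f" "\<And>x. x \<in> {0..norm T} \<Longrightarrow> 0 \<le> f x"
  shows "pos_op (fun_calc f T)"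
proof -
  define g where "g = fun_calc (\<lambda>x. sqrt (f x)) T"
  have c: "continuous_on {0..norm T} (\<lambda>x. sqrt (f x))"
    by (intro continuous_intros assms)
  have "fun_calc f T = fun_calc (\<lambda>x. sqrt (f x) * sqrt (f x)) T"
    by (rule fun_calc_cong) (use assms in auto)
  also have "\<dots> = g o\<^sub>L g"
    unfolding g_def by (rule fun_calc_mult[OF c c])
  finally have "cinner (fun_calc f T x) x = cinner (g x) (g x)" for x
    using selfadj_fun_calc[OF c] by (simp add: g_def selfadjD)
  then show ?thesis
    using selfadj_fun_calc[OF assms(1)] by (simp add: pos_op_def cinner_self_Re)
qed

lemma fun_calc_diff_poly:
  assumes "continuous_on {0..norm T} f"
  shows "fun_calc (\<lambda>x. f x - poly L x) T = fun_calc f T - poly_op L T"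
proof -
  obtain P where P: "uniform_limit {0..norm T} (\<lambda>n. poly (P n)) f sequentially"
    using weierstrass_polynomials[OF assms] by blast
  have "uniform_limit {0..norm T} (\<lambda>n x. poly (P n) x - poly L x) (\<lambda>x. f x - poly L x) sequentially"
    by (intro uniform_limit_intros P)
  then have "(\<lambda>n. poly_op (P n - L) T) \<longlonglongrightarrow> fun_calc (\<lambda>x. f x - poly L x) T"
    by (intro poly_op_tendsto_fun_calc) (simp add: poly_diff[abs_def])
  moreover have "(\<lambda>n. poly_op (P n - L) T) \<longlonglongrightarrow> fun_calc f T - poly_op L T"
    unfolding poly_op_diff by (intro tendsto_intros poly_op_tendsto_fun_calc P)
  ultimately show ?thesis by (rule LIMSEQ_unique)
qed

end

section \<open>Absolute value and powers of an operator\<close>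

lemma pos_op_adj_compose: "A \<in> bop \<Longrightarrow> pos_op (adj A o\<^sub>L A)"
  by (simp add: pos_op_def selfadj_def cinner_adj_left cinner_adj_right cinner_self_Re)

lemma pos_op_abs: "A \<in> bop \<Longrightarrow> pos_op (op_abs A)"
  unfolding op_abs_def by (rule pos_op_fun_calc[OF pos_op_adj_compose]) (auto intro!: continuous_intros)

lemma op_abs_square:
  assumes "A \<in> bop"
  shows "op_abs A o\<^sub>L op_abs A = adj A o\<^sub>L A"
proof -
  note T = pos_op_adj_compose[OF assms]
  have "op_abs A o\<^sub>L op_abs A = fun_calc (\<lambda>x. sqrt x * sqrt x) (adj A o\<^sub>L A)"
    unfolding op_abs_def by (rule fun_calc_mult[OF T, symmetric]) (auto intro!: continuous_intros)
  also have "\<dots> = fun_calc (poly [:0, 1:]) (adj A o\<^sub>L A)"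
    by (rule fun_calc_cong[OF T]) (auto intro!: continuous_intros)
  also have "\<dots> = adj A o\<^sub>L A"
    unfolding fun_calc_poly[OF T] by (auto intro!: blinfun_eqI simp: poly_op_pCons poly_op_0 blinfun.add_left)
  finally show ?thesis .
qed

text \<open>Takes the place of the polar decomposition: since |A| and A have the same Gram matrices,
  compactness, singular vectors and remainders pass between them without a partial isometry.\<close>

lemma cinner_op_abs:
  assumes "A \<in> bop"
  shows "cinner (op_abs A x) (op_abs A y) = cinner (A x) (A y)"
proof -
  have "cinner (op_abs A x) (op_abs A y) = cinner ((op_abs A o\<^sub>L op_abs A) x) y"
    using pos_op_abs[OF assms] by (simp add: pos_op_def selfadjD)
  also have "\<dots> = cinner (A x) (A y)"
    unfolding op_abs_square[OF assms] using assms by (simp add: cinner_adj_left)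
  finally show ?thesis .
qed

lemma norm_op_abs: "A \<in> bop \<Longrightarrow> norm (op_abs A x) = norm (A x)"
  using cinner_op_abs[of A x x] by (simp add: norm_eq_sqrt_cinner)

lemma continuous_on_powr_const_nonneg: "0 < p \<Longrightarrow> continuous_on {0..b} (\<lambda>x::real. x powr p)"
  by (rule continuous_on_powr') (auto intro!: continuous_intros)

lemma pos_op_abs_powr:
  assumes "A \<in> bop" "0 < p"
  shows "pos_op (abs_powr A p)"
  unfolding abs_powr_def
  by (rule pos_op_fun_calc[OF pos_op_abs[OF assms(1)]]) (use assms in \<open>auto intro!: continuous_on_powr_const_nonneg\<close>)

text \<open>Young's inequality with exponents \<open>r\<close> and \<open>r / (r - 1)\<close> and
  second factor 1; the result is Bernoulli's inequality in tangent form.\<close>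

lemma powr_tangent:
  fixes t r :: real
  assumes "1 \<le> r" "0 \<le> t"
  shows "1 + r * (t - 1) \<le> t powr r"
proof (cases "r = 1")
  case False
  define r' where "r' = r / (r - 1)"
  have r': "r' > 1" "1 / r + 1 / r' = 1"
    using False assms by (simp_all add: r'_def field_simps)
  have "t * 1 \<le> t powr r / r + 1 powr r' / r'"
    using False assms r' by (intro Youngs_inequality) auto
  then have "t \<le> t powr r / r + (1 - 1 / r)"
    using r' by simp
  then have "r * t \<le> r * (t powr r / r + (1 - 1 / r))"
    using assms by (intro mult_left_mono) auto
  also have "\<dots> = t powr r + (r - 1)"
    using assms by (simp add: field_simps)
  finally show ?thesis
    by (simp add: algebra_simps)
qed (use assms in simp)

text \<open>Jensen's inequality for the spectral measure: apply the functional calculus to the tangent of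
  \<open>u \<mapsto> u\<^bsup>p/2\<^esup>\<close> at \<open>u = \<parallel>A x\<parallel>\<^sup>2\<close>.\<close>

lemma norm_powr_le_abs_powr_unit:
  assumes A: "A \<in> bop" and p: "2 \<le> p" and x: "norm x = 1"
  shows "norm (A x) powr p \<le> Re (cinner (abs_powr A p x) x)"
proof (cases "A x = 0")
  case True
  then show ?thesis
    using pos_opD[OF pos_op_abs_powr[OF A, of p]] p by simp
next
  case False
  define m where "m = (norm (A x))\<^sup>2"
  have m: "m > 0" using False by (simp add: m_def)
  define r where "r = p / 2"
  \<comment> \<open>Slope and intercept of the tangent in the variable u = y^2. Thus
    \<open>L\<close> is even in y, and its value at \<open>S\<close> involves only S^2 = A^*
    A.\<close>
  define a where "a = r * m powr r / m"
  define b where "b = m powr r * (1 - r)"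
  define S where "S = op_abs A"
  have S: "pos_op S" unfolding S_def by (rule pos_op_abs[OF A])
  define L where "L = [:b, 0, a:]"
  have L: "poly L y = a * y\<^sup>2 + b" for y
    by (simp add: L_def power2_eq_square algebra_simps)
  have mr: "m powr r = norm (A x) powr p"
    using False by (simp add: m_def r_def powr_powr flip: powr_numeral)
  have tangent: "0 \<le> y powr p - poly L y" if "0 \<le> y" for y
  proof -
    have "m powr r * (1 + r * (y\<^sup>2 / m - 1)) \<le> m powr r * (y\<^sup>2 / m) powr r"
      using p m by (intro mult_left_mono powr_tangent) (auto simp: r_def)
    also have "\<dots> = (y\<^sup>2) powr r"
      using m by (simp add: powr_divide)
    also have "\<dots> = y powr p"
      using that by (cases "y = 0") (simp_all add: r_def powr_powr flip: powr_numeral)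
    finally show ?thesis
      by (simp add: L a_def b_def algebra_simps)
  qed
  have c: "continuous_on {0..norm S} (\<lambda>x. x powr p)"
    using p by (intro continuous_on_powr_const_nonneg) simp
  have "pos_op (fun_calc (\<lambda>y. y powr p - poly L y) S)"
    by (rule pos_op_fun_calc[OF S]) (use tangent c in \<open>auto intro!: continuous_intros\<close>)
  then have "0 \<le> Re (cinner ((abs_powr A p - poly_op L S) x) x)"
    unfolding fun_calc_diff_poly[OF S c] abs_powr_def S_def[symmetric] by (rule pos_opD)
  moreover have "cinner (poly_op L S x) x = of_real (a * m + b)"
  proof -
    have "cinner (poly_op L S x) x = of_real b * cinner x x + of_real a * cinner (S (S x)) x"
      by (simp add: L_def poly_op_pCons poly_op_0 blinfun.add_left blinfun.scaleR_left
          blinfun.scaleR_right blinfun.add_right cinner_simps)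
    also have "cinner (S (S x)) x = of_real m"
      using cinner_op_abs[OF A, of x x] S
      by (simp add: pos_op_def selfadjD m_def S_def cinner_self)
    finally show ?thesis
      using x by (simp add: cinner_self algebra_simps)
  qed
  ultimately have "a * m + b \<le> Re (cinner (abs_powr A p x) x)"
    by (simp add: blinfun.diff_left cinner_diff_left)
  moreover have "a * m + b = m powr r"
    using m by (simp add: a_def b_def algebra_simps)
  ultimately show ?thesis using mr by simp
qed

text \<open>The two sides scale differently, the left with the p-th power of \<open>norm x\<close>,
  the right with its square. For \<open>2 \<le> p\<close> and \<open>norm x \<le> 1\<close> the
  discrepancy has the right sign, so the unit sphere suffices.\<close>

lemma norm_powr_le_abs_powr:
  assumes A: "A \<in> bop" and p: "2 \<le> p" and x: "norm x \<le> 1"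
  shows "norm (A x) powr p \<le> Re (cinner (abs_powr A p x) x)"
proof (cases "x = 0")
  case False
  define u where "u = (1 / norm x) *\<^sub>R x"
  have u: "norm u = 1" "x = norm x *\<^sub>R u"
    using False by (simp_all add: u_def)
  have "A x = norm x *\<^sub>R A u"
    by (subst u(2)) (simp add: blinfun.scaleR_right)
  then have "norm (A x) powr p = norm x powr p * norm (A u) powr p"
    by (simp add: powr_mult)
  also have "\<dots> \<le> (norm x)\<^sup>2 * Re (cinner (abs_powr A p u) u)"
  proof (rule mult_mono)
    have "norm x powr p \<le> norm x powr 2"
      using p x False by (intro powr_mono') auto
    then show "norm x powr p \<le> (norm x)\<^sup>2"
      using False by simp
  qed (use norm_powr_le_abs_powr_unit[OF A p u(1)] in auto)
  also have "\<dots> = Re (cinner (abs_powr A p (norm x *\<^sub>R u)) (norm x *\<^sub>R u))"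
    by (simp add: blinfun.scaleR_right cinner_simps power2_eq_square)
  finally show ?thesis
    using u(2) by simp
qed (use p in simp)

section \<open>Compact operators\<close>

lemma orthogonal_bessel_sum:
  fixes e :: "'i \<Rightarrow> 'h::complex_inner"
  assumes fin: "finite I" and orth: "\<And>i j. i \<in> I \<Longrightarrow> j \<in> I \<Longrightarrow> i \<noteq> j \<Longrightarrow> cinner (e i) (e j) = 0"
    and nrm: "\<And>i. i \<in> I \<Longrightarrow> norm (e i) \<le> 1"
  shows "(\<Sum>i\<in>I. (cmod (cinner x (e i)))\<^sup>2) \<le> (norm x)\<^sup>2"
proof -
  define y where "y = (\<Sum>i\<in>I. cinner x (e i) *\<^sub>C e i)"
  define N where "N = (\<Sum>i\<in>I. (cmod (cinner x (e i)))\<^sup>2)"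
  have xy: "cinner x y = of_real N"
    by (simp add: y_def N_def cinner_sum_right cinner_scaleC_right mult.commute[of "cnj z" for z]
        flip: complex_norm_square)
  have ey: "cinner (e i) y = cnj (cinner x (e i)) * of_real ((norm (e i))\<^sup>2)" if "i \<in> I" for i
  proof -
    have "cinner (e i) y = (\<Sum>j\<in>I. if i = j then cnj (cinner x (e i)) * cinner (e i) (e i) else 0)"
      unfolding y_def cinner_sum_right cinner_scaleC_right
      using orth[OF that] by (intro sum.cong) auto
    then show ?thesis
      using fin that by (simp add: cinner_self)
  qed
  have "cinner y y = (\<Sum>i\<in>I. cinner x (e i) * cinner (e i) y)"
    by (subst (1) y_def) (simp add: cinner_sum_left cinner_scaleC_left)
  also have "\<dots> = of_real (\<Sum>i\<in>I. (cmod (cinner x (e i)))\<^sup>2 * (norm (e i))\<^sup>2)"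
    unfolding of_real_sum of_real_mult complex_norm_square
    by (intro sum.cong) (simp_all add: ey mult.assoc)
  finally have "(norm y)\<^sup>2 = (\<Sum>i\<in>I. (cmod (cinner x (e i)))\<^sup>2 * (norm (e i))\<^sup>2)"
    unfolding cinner_self_Re[symmetric] by simp
  also have "\<dots> \<le> N"
    unfolding N_def using nrm by (intro sum_mono) (simp add: mult_left_le power_le_one)
  finally have "(norm (x - y))\<^sup>2 \<le> (norm x)\<^sup>2 - N"
    by (simp add: norm_diff_sq xy)
  then show ?thesis
    unfolding N_def by (smt (verit) zero_le_power2)
qed

section \<open>Finite orthonormal sets and their projections\<close>

definition orthonormal :: "'h::complex_hilbert set \<Rightarrow> bool"
  where "orthonormal G \<longleftrightarrow> finite G \<and> (\<forall>g\<in>G. norm g = 1) \<and> (\<forall>g\<in>G. \<forall>h\<in>G. g \<noteq> h \<longrightarrow> cinner g h = 0)"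

definition proj :: "'h::complex_hilbert set \<Rightarrow> 'h \<Rightarrow>\<^sub>L 'h"
  where "proj G = (\<Sum>g\<in>G. rank1 g g)"

lemma proj_apply: "proj G x = (\<Sum>g\<in>G. cinner x g *\<^sub>C g)"
  by (simp add: proj_def blinfun.sum_left rank1.rep_eq)

lemma orthonormal_finite: "orthonormal G \<Longrightarrow> finite G"
  by (simp add: orthonormal_def)

lemma finite_rank_proj: "orthonormal G \<Longrightarrow> finite_rank (proj G)"
  unfolding proj_def by (rule finite_rank_sum_rank1[OF orthonormal_finite])

lemma proj_bop: "proj G \<in> bop"
  unfolding proj_def by (intro bop_sum rank1_bop)

lemma selfadj_proj: "selfadj (proj G)"
  unfolding selfadj_def
  by (simp add: proj_apply cinner_sum_left cinner_sum_right cinner_scaleC_left cinner_scaleC_right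
      mult.commute flip: cinner_commute)

lemma proj_self:
  assumes "orthonormal G" "g \<in> G"
  shows "proj G g = g"
proof -
  have "proj G g = (\<Sum>h\<in>G. if g = h then g else 0)"
    unfolding proj_apply using assms
    by (intro sum.cong) (auto simp: orthonormal_def cinner_self scaleC_one)
  then show ?thesis
    using assms by (simp add: orthonormal_def)
qed

lemma proj_idem:
  assumes "orthonormal G"
  shows "proj G (proj G x) = proj G x"
  by (simp add: proj_apply[of G x] blinfun.sum_right bop_scaleC[OF proj_bop] proj_self[OF assms])

lemma proj_pythagoras:
  assumes "orthonormal G"
  shows "(norm x)\<^sup>2 = (norm (proj G x))\<^sup>2 + (norm (x - proj G x))\<^sup>2"
proof -
  have "cinner (proj G x) (x - proj G x) = 0"
    using selfadjD[OF selfadj_proj[of G], of x "x - proj G x"] proj_idem[OF assms]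
    by (simp add: blinfun.diff_right)
  then show ?thesis
    using norm_add_sq[of "proj G x" "x - proj G x"] by simp
qed

lemma norm_proj_le: "orthonormal G \<Longrightarrow> norm (proj G x) \<le> norm x"
  using proj_pythagoras[of G x] by (simp add: power2_le_imp_le)

lemma norm_diff_proj_le: "orthonormal G \<Longrightarrow> norm (x - proj G x) \<le> norm x"
  using proj_pythagoras[of G x] by (simp add: power2_le_imp_le)

lemma norm_id_minus_proj_le: "orthonormal G \<Longrightarrow> norm (id_blinfun - proj G) \<le> 1"
  by (rule norm_blinfun_bound) (simp_all add: norm_diff_proj_le blinfun.diff_left)

lemma norm_diff_proj_close:
  assumes "orthonormal G" "proj G y = y"
  shows "norm (x - proj G x) \<le> norm (x - y)"
  using norm_diff_proj_le[OF assms(1), of "x - y"] assms(2) by (simp add: blinfun.diff_right)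

text \<open>Containment in the span is expressed by \<open>proj G x = x\<close>, the form in which
  it is applied. Each new vector contributes its normalised residual.\<close>

lemma gram_schmidt:
  assumes "finite S"
  shows "\<exists>G. orthonormal G \<and> (\<forall>x\<in>S. proj G x = x)"
  using assms
proof (induction S)
  case empty
  show ?case by (intro exI[of _ "{}"]) (simp add: orthonormal_def)
next
  case (insert s S)
  then obtain G where G: "orthonormal G" "\<And>x. x \<in> S \<Longrightarrow> proj G x = x" by blast
  define r where "r = s - proj G s"
  show ?case
  proof (cases "r = 0")
    case True
    then show ?thesis using G by (intro exI[of _ G]) (auto simp: r_def)
  next
    case False
    define h where "h = (1 / norm r) *\<^sub>R r"
    have rg: "cinner r g = 0" if "g \<in> G" for g
      using selfadjD[OF selfadj_proj[of G], of s g] proj_self[OF G(1) that]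
      by (simp add: r_def cinner_diff_left)
    have hg: "cinner h g = 0" "cinner g h = 0" if "g \<in> G" for g
      using rg[OF that] cinner_commute[of g r] by (simp_all add: h_def cinner_simps)
    have h1: "norm h = 1" using False by (simp add: h_def)
    then have hG: "h \<notin> G" using hg(1)[of h] by (auto simp: cinner_self)
    have G': "orthonormal (insert h G)"
      using G(1) h1 hg by (auto simp: orthonormal_def)
    have P: "proj (insert h G) x = cinner x h *\<^sub>C h + proj G x" for x
      using hG orthonormal_finite[OF G(1)] by (simp add: proj_apply)
    have "proj (insert h G) x = x" if "x \<in> S" for x
    proof -
      have "cinner x h = cinner (proj G x) h"
        using G(2)[OF that] by simp
      also have "\<dots> = 0"
        by (simp add: proj_apply cinner_sum_left cinner_scaleC_left hg)
      finally show ?thesis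
        using G(2)[OF that] by (simp add: P)
    qed
    moreover have "proj (insert h G) s = s"
    proof -
      have "cinner s h = cinner r h + cinner (proj G s) h"
        by (simp add: r_def cinner_simps)
      also have "cinner (proj G s) h = 0"
        by (simp add: proj_apply cinner_sum_left cinner_scaleC_left hg)
      finally have "cinner s h = of_real (norm r)"
        using False by (simp add: h_def cinner_scaleR_right cinner_self power2_eq_square)
      then have "cinner s h *\<^sub>C h = norm r *\<^sub>R h"
        by (simp only: scaleR_scaleC)
      then have "cinner s h *\<^sub>C h = r"
        using False by (simp add: h_def)
      then show ?thesis by (simp add: P r_def)
    qed
    ultimately show ?thesis
      using G' by (intro exI[of _ "insert h G"]) auto
  qed
qed

lemma finite_rank_proj_fix:
  assumes "finite_rank A"
  obtains G where "orthonormal G" "\<And>x. proj G (A x) = A x"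
proof -
  obtain S where S: "finite S" "range A \<subseteq> cspan S"
    using assms by (auto simp: finite_rank_def)
  obtain G where G: "orthonormal G" "\<forall>x\<in>S. proj G x = x"
    using gram_schmidt[OF S(1)] by blast
  have "complex_vs.subspace {x. proj G x = x}"
    by (rule complex_vs.subspaceI) (simp_all add: blinfun.add_right bop_scaleC[OF proj_bop])
  then have "cspan S \<subseteq> {x. proj G x = x}"
    unfolding cspan_def using G(2) by (intro complex_vs.span_minimal) auto
  then show ?thesis
    using that[OF G(1)] S(2) by auto
qed

text \<open>\<open>A\<close> equals \<open>proj G\<close> after \<open>A\<close>, written out in
  rank one terms. The left factor \<open>B\<close> is carried along for later compositions; the
  identity gives the expansion of \<open>A\<close> itself.\<close>

lemma finite_rank_expand:
  assumes "finite_rank A"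
  obtains G where "orthonormal G" "\<And>B. B \<in> bop \<Longrightarrow> B o\<^sub>L A = (\<Sum>g\<in>G. rank1 (B g) (adj A g))"
proof -
  obtain G where G: "orthonormal G" "\<And>x. proj G (A x) = A x"
    using finite_rank_proj_fix[OF assms] by blast
  have "B o\<^sub>L A = (\<Sum>g\<in>G. rank1 (B g) (adj A g))" if B: "B \<in> bop" for B
  proof (rule blinfun_eqI)
    fix x
    have "B (A x) = B (proj G (A x))"
      by (simp add: G)
    then show "(B o\<^sub>L A) x = (\<Sum>g\<in>G. rank1 (B g) (adj A g)) x"
      by (simp add: proj_apply blinfun.sum_right blinfun.sum_left bop_scaleC[OF B] rank1.rep_eq
          cinner_adj_right finite_rank_bop[OF assms])
  qed
  then show ?thesis
    using that G(1) by blast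
qed

lemma finite_rank_compose_left:
  assumes "finite_rank A" "B \<in> bop"
  shows "finite_rank (B o\<^sub>L A)"
  by (rule finite_rank_expand[OF assms(1)])
    (use assms(2) in \<open>simp add: finite_rank_sum_rank1 orthonormal_finite\<close>)

lemma finite_rank_compose_right: "finite_rank A \<Longrightarrow> B \<in> bop \<Longrightarrow> finite_rank (A o\<^sub>L B)"
  unfolding finite_rank_def by (auto intro: bop_compose)

lemma finite_rank_add:
  assumes "finite_rank A" "finite_rank B"
  shows "finite_rank (A + B)"
proof -
  obtain S where S: "finite S" "range A \<subseteq> cspan S"
    using assms(1) by (auto simp: finite_rank_def)
  obtain S' where S': "finite S'" "range B \<subseteq> cspan S'"
    using assms(2) by (auto simp: finite_rank_def)
  have "range (A + B) \<subseteq> cspan (S \<union> S')"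
  proof safe
    fix x
    have "A x \<in> cspan (S \<union> S')" "B x \<in> cspan (S \<union> S')"
      using S(2) S'(2) complex_vs.span_mono[of S "S \<union> S'"] complex_vs.span_mono[of S' "S \<union> S'"]
      by (auto simp: cspan_def)
    then show "(A + B) x \<in> cspan (S \<union> S')"
      unfolding cspan_def blinfun.add_left by (rule complex_vs.span_add)
  qed
  then show ?thesis
    using assms S S' bop_add by (auto simp: finite_rank_def intro!: exI[of _ "S \<union> S'"])
qed

lemma finite_rank_scaleC: "finite_rank A \<Longrightarrow> finite_rank (c *\<^sub>C A)"
proof -
  assume A: "finite_rank A"
  have "c *\<^sub>C A = (c *\<^sub>C id_blinfun) o\<^sub>L A"
    by (rule blinfun_eqI) (simp add: scaleC_blinfun_apply)
  then show ?thesis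
    using finite_rank_compose_left[OF A bop_scale[OF bop_id]] by simp
qed

lemma finite_rank_diff: "finite_rank A \<Longrightarrow> finite_rank B \<Longrightarrow> finite_rank (A - B)"
  using finite_rank_add[of A "(-1) *\<^sub>C B"] finite_rank_scaleC[of B "-1"]
  by (simp add: scaleC_minus_left scaleC_one)

section \<open>Compactness as approximability by finite-rank operators\<close>

lemma compact_op_approx:
  assumes "compact_op A" "e > 0"
  obtains G where "orthonormal G" "norm (A - (proj G o\<^sub>L A)) \<le> e"
proof -
  \<comment> \<open>A finite net of the image of the ball; the projection onto the span of its
    points approximates at least as well as the points.\<close>
  obtain K where K: "finite K" "closure (A ` cball 0 1) \<subseteq> (\<Union>y\<in>K. ball y e)"
    using assms unfolding compact_op_def compact_eq_totally_bounded by blast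
  obtain G where G: "orthonormal G" "\<forall>x\<in>K. proj G x = x"
    using gram_schmidt[OF K(1)] by blast
  have *: "norm ((A - (proj G o\<^sub>L A)) x) \<le> e" if "norm x \<le> 1" for x
  proof -
    have "A x \<in> closure (A ` cball 0 1)"
      using that by (intro closure_subset[THEN subsetD]) auto
    then obtain y where y: "y \<in> K" "A x \<in> ball y e"
      using K(2) by blast
    have "norm (A x - proj G (A x)) \<le> norm (A x - y)"
      by (rule norm_diff_proj_close) (use G y in auto)
    also have "\<dots> \<le> e"
      using y(2) by (simp add: dist_norm norm_minus_commute)
    finally show ?thesis
      by (simp add: blinfun.diff_left)
  qed
  have "norm (A - (proj G o\<^sub>L A)) \<le> e"
    by (rule norm_blinfun_le_unit[OF *]) (use assms in auto)
  then show ?thesis using that G(1) by blast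
qed

text \<open>Stands in for the compactness of bounded sets in a finite dimensional subspace: sums of
  compact sets, built up one vector at a time.\<close>

lemma compact_combinations:
  fixes G :: "'h::complex_hilbert set"
  assumes "finite G"
  shows "\<exists>K. compact K \<and> (\<forall>c. (\<forall>g. cmod (c g) \<le> R) \<longrightarrow> (\<Sum>g\<in>G. c g *\<^sub>C g) \<in> K)"
  using assms
proof (induction G)
  case empty
  show ?case by (intro exI[of _ "{0}"]) simp
next
  case (insert g G)
  then obtain K where K: "compact K" "\<And>c. (\<forall>g. cmod (c g) \<le> R) \<Longrightarrow> (\<Sum>g\<in>G. c g *\<^sub>C g) \<in> K"
    by blast
  have "bounded_linear (\<lambda>c. c *\<^sub>C g)"
    by (rule bounded_linear_intro[where K = "norm g"])
      (simp_all add: scaleC_add_left norm_scaleC scaleR_scaleC scaleC_scaleC scaleR_conv_of_real)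
  then have "compact ((\<lambda>c. c *\<^sub>C g) ` cball 0 R)"
    by (intro compact_continuous_image linear_continuous_on) auto
  then have "compact {x + y | x y. x \<in> (\<lambda>c. c *\<^sub>C g) ` cball 0 R \<and> y \<in> K}"
    by (rule compact_sums[OF _ K(1)])
  moreover have "(\<Sum>g\<in>insert g G. c g *\<^sub>C g) \<in> {x + y | x y. x \<in> (\<lambda>c. c *\<^sub>C g) ` cball 0 R \<and> y \<in> K}"
    if "\<forall>g. cmod (c g) \<le> R" for c
    using K(2)[OF that] that insert.hyps
    by (intro CollectI exI[of _ "c g *\<^sub>C g"] exI[of _ "\<Sum>g\<in>G. c g *\<^sub>C g"]) auto
  ultimately show ?case by blast
qed

lemma approx_imp_compact_op:
  assumes A: "A \<in> bop" and app: "\<And>e. e > 0 \<Longrightarrow> \<exists>F. finite_rank F \<and> norm (A - F) \<le> e"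
  shows "compact_op A"
  unfolding compact_op_def compact_eq_totally_bounded
proof (intro conjI allI impI A)
  show "complete (closure (A ` cball 0 1))"
    by (simp add: complete_eq_closed)
  fix e :: real assume e: "e > 0"
  obtain F where F: "finite_rank F" "norm (A - F) \<le> e / 4"
    using app[of "e / 4"] e by auto
  obtain G where G: "orthonormal G" "\<And>x. proj G (F x) = F x"
    using finite_rank_proj_fix[OF F(1)] by blast
  obtain K where K: "compact K"
    "\<And>c. (\<forall>g. cmod (c g) \<le> norm F) \<Longrightarrow> (\<Sum>g\<in>G. c g *\<^sub>C g) \<in> K"
    using compact_combinations[OF orthonormal_finite[OF G(1)], of "norm F"] by blast
  obtain k where k: "finite k" "K \<subseteq> (\<Union>x\<in>k. ball x (e / 4))"
    using K(1) e unfolding compact_eq_totally_bounded by (meson divide_pos_pos zero_less_numeral)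
  \<comment> \<open>The error \<open>e / 4\<close> of \<open>F\<close> and the width
    \<open>e / 4\<close> of the net add up to \<open>e / 2\<close>. Closed balls let the inclusion
    pass to the closure, and they still lie in the open balls of radius \<open>e\<close>.\<close>
  have "A ` cball 0 1 \<subseteq> (\<Union>y\<in>k. cball y (e / 2))"
  proof safe
    fix x :: 'a assume "x \<in> cball 0 1"
    then have x: "norm x \<le> 1" by simp
    have Fx: "norm (F x) \<le> norm F"
      using norm_blinfun[of F x] mult_left_le[OF x norm_ge_zero[of F]] by linarith
    define c where "c g = (if g \<in> G then cinner (F x) g else 0)" for g
    have "cmod (c g) \<le> norm F" for g
      using cmod_cinner_le[of "F x" g] G(1) Fx by (auto simp: c_def orthonormal_def)
    then have "(\<Sum>g\<in>G. c g *\<^sub>C g) \<in> K"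
      using K(2) by blast
    then have "F x \<in> K"
      using G(2)[of x] by (simp add: proj_apply c_def)
    then obtain y where y: "y \<in> k" "dist y (F x) < e / 4"
      using k(2) by auto
    have "norm ((A - F) x) \<le> norm (A - F)"
      using norm_blinfun[of "A - F" x] mult_left_le[OF x norm_ge_zero[of "A - F"]] by linarith
    then have "dist (F x) (A x) \<le> e / 4"
      using F(2) by (simp add: blinfun.diff_left dist_norm norm_minus_commute)
    then have "dist y (A x) \<le> e / 2"
      using y(2) dist_triangle[of y "A x" "F x"] by linarith
    then show "A x \<in> (\<Union>y\<in>k. cball y (e / 2))"
      using y(1) by auto
  qed
  moreover have "closed (\<Union>y\<in>k. cball y (e / 2))"
    using k(1) by (intro closed_UN) auto
  ultimately have "closure (A ` cball 0 1) \<subseteq> (\<Union>y\<in>k. cball y (e / 2))"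
    by (rule closure_minimal)
  also have "\<dots> \<subseteq> (\<Union>y\<in>k. ball y e)"
    using e by (auto simp: dist_norm)
  finally show "\<exists>k. finite k \<and> closure (A ` cball 0 1) \<subseteq> (\<Union>y\<in>k. ball y e)"
    using k(1) by blast
qed

lemma compact_op_bop: "compact_op A \<Longrightarrow> A \<in> bop"
  by (simp add: compact_op_def)

lemma compact_op_finite_rank_approx:
  assumes "compact_op A" "e > 0"
  shows "\<exists>F. finite_rank F \<and> norm (A - F) \<le> e"
  by (rule compact_op_approx[OF assms])
    (metis finite_rank_compose_right finite_rank_proj compact_op_bop[OF assms(1)])

lemma finite_rank_compact: "finite_rank A \<Longrightarrow> compact_op A"
  by (rule approx_imp_compact_op) (auto simp: finite_rank_bop intro!: exI[of _ A])

lemma compact_op_diff: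
  assumes "compact_op A" "compact_op B"
  shows "compact_op (A - B)"
proof (rule approx_imp_compact_op)
  show "A - B \<in> bop"
    using assms by (simp add: bop_diff compact_op_bop)
  fix e :: real assume "e > 0"
  then obtain F F' where "finite_rank F" "norm (A - F) \<le> e / 2" "finite_rank F'" "norm (B - F') \<le> e / 2"
    using assms compact_op_finite_rank_approx by (meson half_gt_zero)
  then show "\<exists>F. finite_rank F \<and> norm (A - B - F) \<le> e"
    by (intro exI[of _ "F - F'"] conjI finite_rank_diff)
      (use norm_triangle_ineq4[of "A - F" "B - F'"] in \<open>auto simp: algebra_simps\<close>)
qed

section \<open>Spectral decomposition of compact positive operators and singular values\<close>

definition seq_compact_op :: "'h::complex_hilbert \<Rightarrow>\<^sub>L 'h \<Rightarrow> bool"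
  where "seq_compact_op S \<longleftrightarrow> (\<forall>x :: nat \<Rightarrow> 'h. (\<forall>n. norm (x n) \<le> 1) \<longrightarrow>
    (\<exists>l r. strict_mono (r :: nat \<Rightarrow> nat) \<and> (\<lambda>n. S (x (r n))) \<longlonglongrightarrow> l))"

lemma compact_op_seq_compact: 
  assumes "compact_op A"
  shows "seq_compact_op A"
  unfolding seq_compact_op_def
proof (intro allI impI)
  fix x :: "nat \<Rightarrow> 'a" assume x: "\<forall>n. norm (x n) \<le> 1"
  have "\<forall>n. A (x n) \<in> closure (A ` cball 0 1)"
    using x by (intro allI closure_subset[THEN subsetD]) auto
  moreover have "seq_compact (closure (A ` cball 0 1))"
    using assms by (simp add: compact_op_def compact_eq_seq_compact_metric)
  ultimately obtain l r where "strict_mono (r :: nat \<Rightarrow> nat)" "((\<lambda>n. A (x n)) \<circ> r) \<longlonglongrightarrow> l"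
    unfolding seq_compact_def by metis
  then show "\<exists>l r. strict_mono (r :: nat \<Rightarrow> nat) \<and> (\<lambda>n. A (x (r n))) \<longlonglongrightarrow> l"
    by (auto simp: o_def)
qed

text \<open>The sequential form of compactness transfers at once, because A and |A| stretch
  differences equally and therefore have the same Cauchy subsequences of images.\<close>

lemma seq_compact_op_abs:
  assumes "compact_op A"
  shows "seq_compact_op (op_abs A)"
  unfolding seq_compact_op_def
proof (intro allI impI)
  fix x :: "nat \<Rightarrow> 'a" assume "\<forall>n. norm (x n) \<le> 1"
  then obtain l r where r: "strict_mono (r :: nat \<Rightarrow> nat)" "(\<lambda>n. A (x (r n))) \<longlonglongrightarrow> l"
    using compact_op_seq_compact[OF assms] unfolding seq_compact_op_def by blast
  have "dist (op_abs A (x (r m))) (op_abs A (x (r n))) = dist (A (x (r m))) (A (x (r n)))" for m n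
    using norm_op_abs[OF compact_op_bop[OF assms], of "x (r m) - x (r n)"]
    by (simp add: dist_norm blinfun.diff_right)
  then have "Cauchy (\<lambda>n. op_abs A (x (r n)))"
    using LIMSEQ_imp_Cauchy[OF r(2)] by (simp add: Cauchy_def)
  then show "\<exists>l r. strict_mono (r :: nat \<Rightarrow> nat) \<and> (\<lambda>n. op_abs A (x (r n))) \<longlonglongrightarrow> l"
    using r(1) Cauchy_convergent convergent_def by blast
qed

text \<open>Compactness turns vectors that nearly attain the norm N into a unit vector z with R^2 z
  = N^2 z. Since R^2 - N^2 factors as (R - N)(R + N), the vector (R + N) z is an eigenvector for N;
  positivity of R keeps it from vanishing.\<close>

lemma top_eigenvector:
  fixes R :: "'h::complex_hilbert \<Rightarrow>\<^sub>L 'h"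
  assumes R: "pos_op R" "seq_compact_op R" "R \<noteq> 0"
  shows "\<exists>v. norm v = 1 \<and> R v = norm R *\<^sub>R v"
proof -
  define N where "N = norm R"
  have N: "N > 0" using R(3) by (simp add: N_def)
  have sa: "selfadj R" using R(1) by (simp add: pos_op_def)
  obtain x where x: "\<And>n. norm (x n) = 1" "(\<lambda>n. norm (R (x n))) \<longlonglongrightarrow> norm R"
    using norm_attained_approx[OF R(3)] by blast
  obtain l r where r: "strict_mono (r :: nat \<Rightarrow> nat)" "(\<lambda>n. R (x (r n))) \<longlonglongrightarrow> l"
    using R(2) x(1) unfolding seq_compact_op_def by (metis order_refl)
  have RR: "(\<lambda>n. R (R (x (r n)))) \<longlonglongrightarrow> R l"
    by (intro blinfun.tendsto tendsto_const r)
  have "(\<lambda>n. R (R (x (r n))) - N\<^sup>2 *\<^sub>R x (r n)) \<longlonglongrightarrow> 0"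
    using LIMSEQ_subseq_LIMSEQ[OF selfadj_approx_eigen[OF sa x] r(1)] by (simp add: o_def N_def)
  from tendsto_diff[OF RR this] have "(\<lambda>n. N\<^sup>2 *\<^sub>R x (r n)) \<longlonglongrightarrow> R l"
    by simp
  then have "(\<lambda>n. (1 / N\<^sup>2) *\<^sub>R (N\<^sup>2 *\<^sub>R x (r n))) \<longlonglongrightarrow> (1 / N\<^sup>2) *\<^sub>R R l"
    by (intro tendsto_intros)
  then have xl: "(\<lambda>n. x (r n)) \<longlonglongrightarrow> (1 / N\<^sup>2) *\<^sub>R R l"
    using N by simp
  define z where "z = (1 / N\<^sup>2) *\<^sub>R R l"
  have "(\<lambda>n. norm (x (r n))) \<longlonglongrightarrow> norm z"
    using tendsto_norm[OF xl] by (simp only: z_def)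
  then have z1: "norm z = 1"
    using x(1) by (simp add: LIMSEQ_const_iff)
  have "(\<lambda>n. R (x (r n))) \<longlonglongrightarrow> R z"
    unfolding z_def by (intro blinfun.tendsto tendsto_const xl)
  then have "R z = l"
    using r(2) LIMSEQ_unique by blast
  then have RRz: "R (R z) = N\<^sup>2 *\<^sub>R z"
    using N by (simp add: z_def)
  define w where "w = R z + N *\<^sub>R z"
  have Rw: "R w = N *\<^sub>R w"
    by (simp add: w_def blinfun.add_right blinfun.scaleR_right RRz scaleR_add_right power2_eq_square)
  have "Re (cinner w z) = Re (cinner (R z) z) + N"
    using z1 by (simp add: w_def cinner_simps cinner_self)
  then have "w \<noteq> 0"
    using pos_opD[OF R(1), of z] N by auto
  then show ?thesis
    using Rw by (intro exI[of _ "(1 / norm w) *\<^sub>R w"]) (simp add: N_def blinfun.scaleR_right)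
qed

text \<open>The value 0 for \<open>R = 0\<close> lets the deflation run on trivially once the
  operator is exhausted.\<close>

definition top_vec :: "'h::complex_hilbert \<Rightarrow>\<^sub>L 'h \<Rightarrow> 'h"
  where "top_vec R = (if R = 0 then 0 else SOME v. norm v = 1 \<and> R v = norm R *\<^sub>R v)"

primrec deflate :: "'h::complex_hilbert \<Rightarrow>\<^sub>L 'h \<Rightarrow> nat \<Rightarrow> 'h \<Rightarrow>\<^sub>L 'h"
  where "deflate S 0 = S"
  | "deflate S (Suc n) = deflate S n -
      norm (deflate S n) *\<^sub>R rank1 (top_vec (deflate S n)) (top_vec (deflate S n))"

lemma top_vec:
  assumes "pos_op R" "seq_compact_op R"
  shows "norm (top_vec R) = (if R = 0 then 0 else 1)" "R (top_vec R) = norm R *\<^sub>R top_vec R"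
  using someI_ex[OF top_eigenvector[OF assms]] by (auto simp: top_vec_def)

text \<open>Subtracting the top component amounts to removing the \<open>v\<close> component of the
  argument, which is a contraction. The last claim hands kernel vectors on to the next operator and
  is the source of the orthogonality of the top vectors.\<close>

lemma deflation_step:
  fixes R :: "'h::complex_hilbert \<Rightarrow>\<^sub>L 'h"
  assumes R: "pos_op R" "seq_compact_op R"
  defines "v \<equiv> top_vec R"
  defines "R' \<equiv> R - norm R *\<^sub>R rank1 v v"
  shows "R' x = R (x - cinner x v *\<^sub>C v)" "norm (x - cinner x v *\<^sub>C v) \<le> norm x"
    "pos_op R'" "seq_compact_op R'" "norm R' \<le> norm R" "R' v = 0"
    "R w = 0 \<Longrightarrow> R' w = 0 \<and> cinner w v = 0"
proof -
  have sa: "selfadj R" using R(1) by (simp add: pos_op_def)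
  have v: "norm v = (if R = 0 then 0 else 1)" "R v = norm R *\<^sub>R v"
    using top_vec[OF R] by (simp_all add: v_def)
  have R': "R' x = R (x - cinner x v *\<^sub>C v)" for x
    by (simp add: R'_def blinfun.diff_left blinfun.diff_right blinfun.scaleR_left rank1.rep_eq
        bop_scaleC[OF selfadj_bop[OF sa]] v(2) scaleC_scaleR)
  then show "R' x = R (x - cinner x v *\<^sub>C v)" .
  have sq: "(norm (x - cinner x v *\<^sub>C v))\<^sup>2 \<le> (norm x)\<^sup>2" for x
  proof -
    have "Re (cinner x (cinner x v *\<^sub>C v)) = (cmod (cinner x v))\<^sup>2"
      by (simp add: cinner_scaleC_right complex_norm_square[symmetric] mult.commute flip: of_real_power)
    moreover have "(norm (cinner x v *\<^sub>C v))\<^sup>2 \<le> (cmod (cinner x v))\<^sup>2"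
      using v(1) by (simp add: norm_scaleC power_mult_distrib)
    ultimately show ?thesis
      using zero_le_power2[of "cmod (cinner x v)"] unfolding norm_diff_sq by linarith
  qed
  then show ctr: "norm (x - cinner x v *\<^sub>C v) \<le> norm x" for x
    using power2_le_imp_le norm_ge_zero by blast
  have sa': "selfadj R'"
    unfolding selfadj_def
  proof (intro allI)
    fix x y
    have "cinner v y = cnj (cinner y v)"
      by (rule cinner_commute)
    then show "cinner (R' x) y = cinner x (R' y)"
      by (simp add: R'_def blinfun.diff_left blinfun.scaleR_left rank1.rep_eq cinner_simps selfadjD[OF sa])
  qed
  show R'v: "R' v = 0"
    using v by (simp add: R' cinner_self scaleC_one split: if_splits)
  \<comment> \<open>\<open>R' x\<close> is orthogonal to \<open>v\<close>, so the form of
    \<open>R'\<close> at \<open>x\<close> is that of \<open>R\<close> at \<open>x\<close> without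
    its \<open>v\<close> component.\<close>
  have "0 \<le> Re (cinner (R' x) x)" for x
  proof -
    have "cinner (R' x) v = 0"
      using selfadjD[OF sa', of x v] R'v by simp
    then have "cinner (R' x) x = cinner (R (x - cinner x v *\<^sub>C v)) (x - cinner x v *\<^sub>C v)"
      by (simp add: cinner_simps flip: R')
    then show ?thesis
      using pos_opD[OF R(1)] by simp
  qed
  then show "pos_op R'"
    using sa' by (simp add: pos_op_def)
  show "seq_compact_op R'"
    unfolding seq_compact_op_def R'
    using R(2) ctr unfolding seq_compact_op_def by (meson order_trans)
  show "norm R' \<le> norm R"
  proof (rule norm_blinfun_bound)
    fix x
    show "norm (R' x) \<le> norm R * norm x"
      unfolding R' by (rule order_trans[OF norm_blinfun mult_left_mono[OF ctr]]) simp
  qed simp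
  show "R' w = 0 \<and> cinner w v = 0" if "R w = 0"
  proof -
    have "of_real (norm R) * cinner w v = cinner (R w) v"
      using selfadjD[OF sa, of w v] v(2) by (simp add: cinner_scaleR_right)
    then have "cinner w v = 0"
      using that v(1) by (auto split: if_splits)
    then show ?thesis
      using that by (simp add: R')
  qed
qed

lemma spectral_compact_positive:
  fixes S :: "'h::complex_hilbert \<Rightarrow>\<^sub>L 'h"
  assumes S: "pos_op S" "seq_compact_op S"
  obtains s v where "antimono s" "\<And>n::nat. 0 \<le> s n" "s \<longlonglongrightarrow> 0" "\<And>n. S (v n) = s n *\<^sub>R v n"
    "\<And>n. norm (v n) = (if s n = 0 then 0 else 1)" "\<And>m n. m \<noteq> n \<Longrightarrow> cinner (v m) (v n) = 0"
    "\<And>n. norm (S - (\<Sum>k<n. s k *\<^sub>R rank1 (v k) (v k))) \<le> s n"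
proof -
  define R where "R = deflate S"
  define v where "v n = top_vec (R n)" for n
  define s where "s n = norm (R n)" for n
  have R: "pos_op (R n) \<and> seq_compact_op (R n)" for n
    by (induction n) (use S deflation_step in \<open>auto simp: R_def\<close>)
  have Rs: "R (Suc n) = R n - s n *\<^sub>R rank1 (v n) (v n)" for n
    by (simp add: R_def v_def s_def)
  note step = deflation_step[of "R n" for n, folded v_def s_def, folded Rs]
  have anti: "antimono s"
    by (rule decseq_SucI) (use step(5) R in \<open>simp add: s_def\<close>)
  have nv: "norm (v n) = (if s n = 0 then 0 else 1)" and Rv: "R n (v n) = s n *\<^sub>R v n" for n
    using top_vec[of "R n"] R by (auto simp: v_def s_def)
  \<comment> \<open>Each top vector lies in the kernel of all later deflations, hence is orthogonal
    to all later top vectors.\<close>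
  have kill: "R m (v n) = 0" if "n < m" for m n
    using that
  proof (induction m)
    case (Suc m)
    show ?case
    proof (cases "n = m")
      case True
      then show ?thesis using step(6) R by simp
    next
      case False
      then show ?thesis using step(7) R Suc by simp
    qed
  qed simp
  have lt: "cinner (v n) (v m) = 0" if "n < m" for m n
    using step(7)[of m "v n"] R kill[OF that] by blast
  have orth: "cinner (v m) (v n) = 0" if "m \<noteq> n" for m n
    using that lt[of m n] lt[of n m] cinner_commute[of "v m" "v n"] by (cases "m < n") auto
  have RS: "R n = S - (\<Sum>k<n. s k *\<^sub>R rank1 (v k) (v k))" for n
    by (induction n) (simp_all add: Rs, simp add: R_def)
  have Sv: "S (v n) = s n *\<^sub>R v n" for n
  proof -
    have "S (v n) = R n (v n) + (\<Sum>k<n. s k *\<^sub>R rank1 (v k) (v k)) (v n)"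
      by (simp add: RS blinfun.diff_left)
    also have "(\<Sum>k<n. s k *\<^sub>R rank1 (v k) (v k)) (v n) = 0"
      unfolding blinfun.sum_left by (rule sum.neutral) (auto simp: blinfun.scaleR_left rank1.rep_eq orth)
    finally show ?thesis by (simp add: Rv)
  qed
  \<comment> \<open>If \<open>s\<close> stayed above \<open>e\<close>, the images of distinct
    \<open>v n\<close> would be at distance at least \<open>e\<close>, and no subsequence of them
    could converge.\<close>
  have lim: "s \<longlonglongrightarrow> 0"
  proof (rule ccontr)
    assume "\<not> s \<longlonglongrightarrow> 0"
    then obtain e where e: "e > 0" "\<And>N. \<exists>n\<ge>N. e \<le> s n"
      by (auto simp: LIMSEQ_def not_less s_def)
    have big: "e \<le> s n" for n
      using e(2)[of n] antimonoD[OF anti] by (meson order_trans)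
    have "\<forall>n. norm (v n) \<le> 1" using nv by simp
    then obtain l r where r: "strict_mono (r :: nat \<Rightarrow> nat)" "(\<lambda>n. S (v (r n))) \<longlonglongrightarrow> l"
      using S(2) unfolding seq_compact_op_def by blast
    obtain M where M: "\<And>m n. m \<ge> M \<Longrightarrow> n \<ge> M \<Longrightarrow> dist (S (v (r m))) (S (v (r n))) < e"
      using metric_CauchyD[OF LIMSEQ_imp_Cauchy[OF r(2)] e(1)] by blast
    define a where "a = r M"
    define b where "b = r (Suc M)"
    have ab: "a \<noteq> b" using strict_mono_eq[OF r(1)] by (simp add: a_def b_def)
    have pos: "s a > 0" using big[of a] e(1) by linarith
    have "(norm (s a *\<^sub>R v a - s b *\<^sub>R v b))\<^sup>2 = (s a)\<^sup>2 + (norm (s b *\<^sub>R v b))\<^sup>2"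
      using orth[OF ab] pos nv[of a] by (simp add: norm_diff_sq cinner_simps)
    then have "(s a)\<^sup>2 \<le> (norm (s a *\<^sub>R v a - s b *\<^sub>R v b))\<^sup>2"
      by simp
    then have "s a \<le> norm (s a *\<^sub>R v a - s b *\<^sub>R v b)"
      by (rule power2_le_imp_le) simp
    moreover have "norm (s a *\<^sub>R v a - s b *\<^sub>R v b) < e"
      using M[of M "Suc M"] by (simp add: dist_norm Sv a_def b_def)
    ultimately show False using big[of a] by linarith
  qed
  show ?thesis
  proof (rule that[of s v])
    show "norm (S - (\<Sum>k<n. s k *\<^sub>R rank1 (v k) (v k))) \<le> s n" for n
      unfolding RS[symmetric] by (simp add: s_def)
  qed (use anti lim Sv nv orth in \<open>auto simp: s_def\<close>)
qed

text \<open>Links the decomposition to \<open>sing_val\<close>, which is described by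
  multiplicities: the \<open>v n\<close> with \<open>s n = l\<close> form a basis of the eigenspace
  of \<open>l\<close>.\<close>

lemma cdim_eigenspace:
  fixes S :: "'h::complex_hilbert \<Rightarrow>\<^sub>L 'h" and s :: "nat \<Rightarrow> real"
  assumes S: "selfadj S" and s: "s \<longlonglongrightarrow> 0" "\<And>n. S (v n) = s n *\<^sub>R v n"
    "\<And>n. norm (v n) = (if s n = 0 then 0 else 1)" "\<And>m n. m \<noteq> n \<Longrightarrow> cinner (v m) (v n) = 0"
    "\<And>n. norm (S - (\<Sum>k<n. s k *\<^sub>R rank1 (v k) (v k))) \<le> s n" and l: "l > 0"
  shows "finite {n. s n = l}" "cdim {x. S x = l *\<^sub>R x} = card {n. s n = l}"
proof -
  define J where "J = {n. s n = l}"
  obtain N where N: "\<And>n. n \<ge> N \<Longrightarrow> s n < l"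
    using order_tendstoD(2)[OF s(1) l] by (auto simp: eventually_sequentially)
  have JN: "J \<subseteq> {..<N}" using N by (force simp: J_def not_less[symmetric])
  then show finJ: "finite {n. s n = l}"
    unfolding J_def[symmetric] using finite_subset by blast
  have v1: "cinner (v j) (v j) = 1" if "j \<in> J" for j
    using that l s(3)[of j] by (simp add: J_def cinner_self)
  have inj: "inj_on v J"
    using v1 s(4) by (intro inj_onI) (metis zero_neq_one)
  have indep: "complex_vs.independent (v ` J)"
  proof (rule complex_vs.independent_if_scalars_zero)
    show "finite (v ` J)" using finJ by (simp add: J_def)
    fix f x assume z: "(\<Sum>x\<in>v ` J. f x *\<^sub>C x) = 0" and x: "x \<in> v ` J"
    then obtain j where j: "j \<in> J" "x = v j" by blast
    have "0 = cinner (\<Sum>i\<in>J. f (v i) *\<^sub>C v i) (v j)"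
      using z by (simp add: sum.reindex[OF inj])
    also have "\<dots> = (\<Sum>i\<in>J. if i = j then f (v j) else 0)"
      unfolding cinner_sum_left cinner_scaleC_left
      by (rule sum.cong) (use v1 s(4) j in auto)
    also have "\<dots> = f x"
      using j finJ by (simp add: J_def)
    finally show "f x = 0" by simp
  qed
  have sub: "complex_vs.subspace {x. S x = l *\<^sub>R x}"
    by (rule complex_vs.subspaceI)
      (simp_all add: blinfun.add_right scaleR_add_right bop_scaleC[OF selfadj_bop[OF S]] scaleC_scaleR)
  have expand: "x \<in> complex_vs.span (v ` J)" if x: "S x = l *\<^sub>R x" for x
  proof -
    have orth: "cinner x (v k) = 0" if "k \<notin> J" for k
    proof -
      have "of_real l * cinner x (v k) = of_real (s k) * cinner x (v k)"
        using selfadjD[OF S, of x "v k"] by (simp add: x s(2) cinner_simps)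
      then show ?thesis using that by (auto simp: J_def)
    qed
    define y where "y = (\<Sum>k\<in>J. (of_real l * cinner x (v k)) *\<^sub>C v k)"
    have Y: "(\<Sum>k<n. s k *\<^sub>R rank1 (v k) (v k)) x = y" if "n \<ge> N" for n
    proof -
      have "(\<Sum>k<n. s k *\<^sub>R rank1 (v k) (v k)) x = (\<Sum>k<n. (of_real (s k) * cinner x (v k)) *\<^sub>C v k)"
        unfolding blinfun.sum_left blinfun.scaleR_left rank1.rep_eq
        by (simp add: scaleR_scaleC scaleC_scaleC)
      also have "\<dots> = (\<Sum>k\<in>J. (of_real (s k) * cinner x (v k)) *\<^sub>C v k)"
        using JN that by (intro sum.mono_neutral_right) (auto simp: orth)
      also have "\<dots> = y"
        unfolding y_def by (rule sum.cong) (auto simp: J_def)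
      finally show ?thesis .
    qed
    \<comment> \<open>From \<open>N\<close> on the truncations at \<open>x\<close> no longer change,
      while the bound of the remainder tends to 0.\<close>
    have "norm (S x - y) \<le> s n * norm x" if "n \<ge> N" for n
    proof -
      have "norm ((S - (\<Sum>k<n. s k *\<^sub>R rank1 (v k) (v k))) x) \<le> s n * norm x"
        by (rule order_trans[OF norm_blinfun mult_right_mono[OF s(5)]]) simp
      then show ?thesis using Y[OF that] by (simp add: blinfun.diff_left)
    qed
    moreover have "(\<lambda>n. s n * norm x) \<longlonglongrightarrow> 0 * norm x"
      by (intro tendsto_intros s)
    ultimately have "norm (S x - y) \<le> 0 * norm x"
      by (intro LIMSEQ_le_const) auto
    then have "S x = y" by simp
    then have "x = (1 / l) *\<^sub>R y"
      using x l by auto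
    moreover have "y \<in> complex_vs.span (v ` J)"
      unfolding y_def by (intro complex_vs.span_sum complex_vs.span_scale) (auto intro: complex_vs.span_base)
    ultimately show ?thesis
      unfolding scaleR_scaleC by (metis complex_vs.span_scale)
  qed
  have "complex_vs.span (v ` J) \<subseteq> {x. S x = l *\<^sub>R x}"
    by (rule complex_vs.span_minimal[OF _ sub]) (auto simp: J_def s(2))
  moreover have "complex_vs.span {x. S x = l *\<^sub>R x} = {x. S x = l *\<^sub>R x}"
    using sub by (simp only: complex_vs.span_eq_iff)
  moreover have "{x. S x = l *\<^sub>R x} \<subseteq> complex_vs.span (v ` J)"
    by (intro subsetI expand) simp
  ultimately have "complex_vs.span (v ` J) = complex_vs.span {x. S x = l *\<^sub>R x}"
    by (simp only: subset_antisym)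
  from complex_vs.dim_eq_card[OF this indep] have "complex_vs.dim {x. S x = l *\<^sub>R x} = card J"
    by (simp only: card_image[OF inj])
  then show "cdim {x. S x = l *\<^sub>R x} = card {n. s n = l}"
    by (simp add: cdim_def J_def)
qed

text \<open>Uniqueness for the description in \<open>sing_val\<close>: every superlevel set is an
  initial segment whose length is the sum of the multiplicities above the level. Convergence to 0 is
  given for \<open>s\<close> alone; for \<open>s'\<close> the superlevel sets are finite because it
  takes the same positive values.\<close>

lemma antimono_determined_by_multiplicities:
  fixes s s' :: "nat \<Rightarrow> real"
  assumes s: "antimono s" "\<And>n. 0 \<le> s n" "s \<longlonglongrightarrow> 0"
    and s': "antimono s'" "\<And>n. 0 \<le> s' n"
    and eq: "\<And>l. l > 0 \<Longrightarrow> finite {n. s n = l} \<and> finite {n. s' n = l} \<and> card {n. s' n = l} = card {n. s n = l}"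
  shows "s' = s"
proof -
  have main: "{n. s n > l} = {n. s' n > l}" if l: "l > 0" for l
  proof -
    have empty_iff: "{n. s' n = c} = {} \<longleftrightarrow> {n. s n = c} = {}" if "c > 0" for c
      using eq[OF that] by (metis card_0_eq)
    obtain N where N: "\<And>n. n \<ge> N \<Longrightarrow> s n < l"
      using order_tendstoD(2)[OF s(3) l] by (auto simp: eventually_sequentially)
    have fin: "finite {n. s n > l}"
      by (rule finite_subset[of _ "{..<N}"]) (use N in \<open>force simp: not_less[symmetric]\<close>)+
    define V where "V = s ` {n. s n > l}"
    have V: "{n. s n > l} = (\<Union>c\<in>V. {n. s n = c})"
      by (auto simp: V_def)
    have V': "{n. s' n > l} = (\<Union>c\<in>V. {n. s' n = c})"
    proof safe
      fix n assume n: "l < s' n"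
      then obtain k where k: "s k = s' n"
        using empty_iff[of "s' n"] l by auto
      then have "s k \<in> V"
        using n unfolding V_def by (intro imageI) simp
      then show "n \<in> (\<Union>c\<in>V. {n. s' n = c})"
        using k by simp
    qed (auto simp: V_def)
    have finV: "finite V" using fin by (simp add: V_def)
    have Vl: "c > 0" if "c \<in> V" for c using that l by (auto simp: V_def)
    have "card {n. s n > l} = (\<Sum>c\<in>V. card {n. s n = c})"
      unfolding V using finV Vl eq by (intro card_UN_disjoint) auto
    also have "\<dots> = (\<Sum>c\<in>V. card {n. s' n = c})"
      using Vl eq by (intro sum.cong) auto
    also have "\<dots> = card {n. s' n > l}"
      unfolding V' using finV Vl eq by (intro card_UN_disjoint[symmetric]) auto
    finally have card: "card {n. s n > l} = card {n. s' n > l}" .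
    have fin': "finite {n. s' n > l}"
      unfolding V' using finV Vl eq by auto
    have init: "{n. a n > l} = {..<card {n. a n > l}}" if a: "antimono a" and fa: "finite {n. a n > l}" for a :: "nat \<Rightarrow> real"
    proof -
      have down: "m \<in> {n. a n > l}" if "k \<in> {n. a n > l}" "m \<le> k" for m k
        using that antimonoD[OF a that(2)] by simp
      obtain b where "b \<notin> {n. a n > l}"
        using ex_new_if_finite[OF _ fa] by auto
      define b0 where "b0 = (LEAST b. b \<notin> {n. a n > l})"
      have "b0 \<notin> {n. a n > l}"
        unfolding b0_def by (rule LeastI) fact
      moreover have "m \<in> {n. a n > l}" if "m < b0" for m
        using not_less_Least[OF that[unfolded b0_def]] by blast
      ultimately have "{n. a n > l} = {..<b0}"
        using down by (metis (no_types, lifting) lessThan_iff not_le subsetI subset_antisym)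
      then show ?thesis by simp
    qed
    show ?thesis
      using init[OF s(1) fin] init[OF s'(1) fin'] card by simp
  qed
  then have iff: "s n > l \<longleftrightarrow> s' n > l" if "l > 0" for l n
    using that by blast
  \<comment> \<open>The midpoint of two different values would be a level that separates
    them.\<close>
  have "s' n \<le> s n" for n
    using iff[of "(s n + s' n) / 2" n] s(2)[of n] by argo
  moreover have "s n \<le> s' n" for n
    using iff[of "(s n + s' n) / 2" n] s'(2)[of n] by argo
  ultimately show ?thesis
    by (intro ext antisym)
qed

definition bessel :: "(nat \<Rightarrow> 'h::complex_hilbert) \<Rightarrow> bool"
  where "bessel e \<longleftrightarrow> (\<forall>x n. (\<Sum>i<n. (cmod (cinner x (e i)))\<^sup>2) \<le> (norm x)\<^sup>2)"

lemma bessel_orthogonal: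
  "(\<And>m n. m \<noteq> n \<Longrightarrow> cinner (e m) (e n) = 0) \<Longrightarrow> (\<And>n. norm (e n) \<le> 1) \<Longrightarrow> bessel e"
  unfolding bessel_def by (intro allI orthogonal_bessel_sum) auto

text \<open>Spectral decomposition of |A| together with u_n = A v_n / s_n; both vectors are 0 where
  s_n = 0. The last clause says that they are unit vectors elsewhere, in the form that diagonal sums
  call for.\<close>

lemma schmidt_decomposition:
  fixes A :: "'h::complex_hilbert \<Rightarrow>\<^sub>L 'h"
  assumes A: "compact_op A"
  obtains u v where "antimono (sing_val A)" "\<And>n. 0 \<le> sing_val A n" "sing_val A \<longlonglongrightarrow> 0"
    "bessel u" "bessel v" "\<And>n. cinner (A (v n)) (u n) = of_real (sing_val A n)"
    "\<And>n. norm (A - (\<Sum>k<n. sing_val A k *\<^sub>R rank1 (u k) (v k))) \<le> sing_val A n"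
    "\<And>m n. m \<noteq> n \<Longrightarrow> cinner (v m) (v n) = 0"
    "\<And>n. of_real (sing_val A n) * (cinner (v n) (v n) * cinner (u n) (u n)) = of_real (sing_val A n)"
proof -
  note Ab = compact_op_bop[OF A]
  define S where "S = op_abs A"
  have S: "pos_op S" "seq_compact_op S"
    unfolding S_def using pos_op_abs[OF Ab] seq_compact_op_abs[OF A] by auto
  have sa: "selfadj S" using S(1) by (simp add: pos_op_def)
  obtain s v where s: "antimono s" "\<And>n::nat. 0 \<le> s n" "s \<longlonglongrightarrow> 0" "\<And>n. S (v n) = s n *\<^sub>R v n"
    "\<And>n. norm (v n) = (if s n = 0 then 0 else 1)" "\<And>m n. m \<noteq> n \<Longrightarrow> cinner (v m) (v n) = 0"
    "\<And>n. norm (S - (\<Sum>k<n. s k *\<^sub>R rank1 (v k) (v k))) \<le> s n"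
    using spectral_compact_positive[OF S] by blast
  note eig = cdim_eigenspace[OF sa s(3-7)]
  have sv: "sing_val A = s"
    unfolding sing_val_def
  proof (rule the_equality)
    show "antimono s \<and> (\<forall>n. 0 \<le> s n) \<and>
        (\<forall>l>0. finite {n. s n = l} \<and> card {n. s n = l} = cdim {x. op_abs A x = l *\<^sub>R x})"
      using s(1,2) eig by (auto simp: S_def)
    fix s' :: "nat \<Rightarrow> real"
    assume "antimono s' \<and> (\<forall>n. 0 \<le> s' n) \<and>
        (\<forall>l>0. finite {n. s' n = l} \<and> card {n. s' n = l} = cdim {x. op_abs A x = l *\<^sub>R x})"
    then show "s' = s"
      by (intro antimono_determined_by_multiplicities[OF s(1-3)]) (use eig in \<open>auto simp: S_def\<close>)
  qed
  define u where "u n = (1 / s n) *\<^sub>R A (v n)" for n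
  have AA: "cinner (A (v m)) (A (v n)) = of_real (s m * s n) * cinner (v m) (v n)" for m n
    using cinner_op_abs[OF Ab, of "v m" "v n", folded S_def] by (simp add: s(4) cinner_simps mult_ac)
  have v0: "v n = 0" if "s n = 0" for n
    using s(5)[of n] that by simp
  have su: "s n *\<^sub>R u n = A (v n)" for n
    using v0[of n] by (cases "s n = 0") (simp_all add: u_def)
  have uorth: "cinner (u m) (u n) = 0" if "m \<noteq> n" for m n
    using that by (simp add: u_def cinner_simps AA s(6))
  have "norm (u n) \<le> 1" for n
  proof (cases "s n = 0")
    case False
    have "(norm (A (v n)))\<^sup>2 = (s n)\<^sup>2"
      using AA[of n n] s(5)[of n] False
      by (simp add: cinner_self power2_eq_square flip: of_real_mult)
    then have "norm (A (v n)) = s n"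
      using s(2) by (simp add: power2_eq_iff_nonneg)
    then show ?thesis
      using False s(2)[of n] by (simp add: u_def)
  qed (simp add: u_def)
  then have bu: "bessel u"
    by (intro bessel_orthogonal uorth)
  have bv: "bessel v"
    by (rule bessel_orthogonal[OF s(6)]) (simp_all add: s(5))
  have Avu: "cinner (A (v n)) (u n) = of_real (s n)" for n
  proof (cases "s n = 0")
    case False
    then show ?thesis
      unfolding u_def cinner_scaleR_right AA using s(5)[of n] by (simp add: cinner_self)
  qed (simp add: v0 u_def)
  \<comment> \<open>The two remainders at \<open>x\<close> are \<open>A y\<close> and |A| y for the
    same \<open>y\<close>, so they have equal norms and the spectral estimate carries over.\<close>
  have tail: "norm (A - (\<Sum>k<n. s k *\<^sub>R rank1 (u k) (v k))) \<le> s n" for n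
  proof (rule norm_blinfun_bound[OF s(2)])
    fix x
    define y where "y = x - (\<Sum>k<n. cinner x (v k) *\<^sub>C v k)"
    have "(A - (\<Sum>k<n. s k *\<^sub>R rank1 (u k) (v k))) x = A y"
      by (simp add: y_def blinfun.diff_left blinfun.diff_right blinfun.sum_left blinfun.sum_right
          blinfun.scaleR_left rank1.rep_eq bop_scaleC[OF Ab] su flip: scaleC_scaleR)
    moreover have "(S - (\<Sum>k<n. s k *\<^sub>R rank1 (v k) (v k))) x = S y"
      by (simp add: y_def blinfun.diff_left blinfun.diff_right blinfun.sum_left blinfun.sum_right
          blinfun.scaleR_left rank1.rep_eq bop_scaleC[OF selfadj_bop[OF sa]] s(4) scaleC_scaleR)
    ultimately show "norm ((A - (\<Sum>k<n. s k *\<^sub>R rank1 (u k) (v k))) x) \<le> s n * norm x"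
      using norm_op_abs[OF Ab, of y]
        order_trans[OF norm_blinfun[of "S - (\<Sum>k<n. s k *\<^sub>R rank1 (v k) (v k))" x]
          mult_right_mono[OF s(7)[of n] norm_ge_zero[of x]]]
      by (simp add: S_def)
  qed
  have uv: "of_real (s n) * (cinner (v n) (v n) * cinner (u n) (u n)) = of_real (s n)" for n
  proof (cases "s n = 0")
    case False
    have "cinner (v n) (v n) = 1"
      using False s(5)[of n] by (simp add: cinner_self)
    moreover have "cinner (u n) (u n) = 1"
      unfolding u_def cinner_scaleR_left cinner_scaleR_right AA using False calculation by simp
    ultimately show ?thesis by simp
  qed simp
  show ?thesis
    by (rule that[of u v]) (unfold sv, fact+)
qed

section \<open>A variational formula for the ideal norm\<close>

lemma cmod_cinner_commute: "cmod (cinner x y) = cmod (cinner y (x::'a::complex_inner))"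
  by (subst cinner_commute) simp

lemma bessel_norm_le_1: "bessel e \<Longrightarrow> norm (e i) \<le> 1"
proof -
  assume e: "bessel e"
  have "(cmod (cinner (e i) (e i)))\<^sup>2 \<le> (\<Sum>j<Suc i. (cmod (cinner (e i) (e j)))\<^sup>2)"
    by (rule member_le_sum) auto
  also have "\<dots> \<le> (norm (e i))\<^sup>2"
    using e unfolding bessel_def by blast
  finally have "((norm (e i))\<^sup>2)\<^sup>2 \<le> (norm (e i))\<^sup>2"
    by (simp add: cinner_self norm_power)
  then have *: "(norm (e i))\<^sup>2 * (norm (e i))\<^sup>2 \<le> (norm (e i))\<^sup>2 * 1"
    by (simp only: power2_eq_square mult_1_right)
  show ?thesis
  proof (cases "e i = 0")
    case False
    then have "(norm (e i))\<^sup>2 \<le> 1\<^sup>2"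
      using mult_le_cancel_left_pos[of "(norm (e i))\<^sup>2" "(norm (e i))\<^sup>2" 1] * by simp
    then show ?thesis
      by (rule power2_le_imp_le) simp
  qed simp
qed

text \<open>Cauchy-Schwarz. It supplies the row bounds as well as the column bounds of the
  substochastic matrix attached to a Schmidt sum.\<close>

lemma bessel_pair_sum_le:
  assumes "bessel e" "bessel f"
  shows "(\<Sum>i<n. cmod (cinner x (e i)) * cmod (cinner y (f i))) \<le> norm x * norm y"
proof (rule power2_le_imp_le)
  have "(\<Sum>i<n. cmod (cinner x (e i)) * cmod (cinner y (f i)))\<^sup>2
      \<le> (\<Sum>i<n. (cmod (cinner x (e i)))\<^sup>2) * (\<Sum>i<n. (cmod (cinner y (f i)))\<^sup>2)"
    by (rule Cauchy_Schwarz_ineq_sum)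
  also have "\<dots> \<le> (norm x)\<^sup>2 * (norm y)\<^sup>2"
    using assms unfolding bessel_def by (intro mult_mono sum_nonneg) auto
  finally show "(\<Sum>i<n. cmod (cinner x (e i)) * cmod (cinner y (f i)))\<^sup>2 \<le> (norm x * norm y)\<^sup>2"
    by (simp add: power_mult_distrib)
qed simp

text \<open>Products with \<open>D (e i)\<close> are products of \<open>adj D x\<close> with
  \<open>e i\<close>, and the adjoint is a contraction too.\<close>

lemma bessel_contraction:
  assumes "bessel e" "D \<in> bop" "norm D \<le> 1"
  shows "bessel (\<lambda>i. D (e i))"
  unfolding bessel_def
proof (intro allI)
  fix x n
  have "(\<Sum>i<n. (cmod (cinner x (D (e i))))\<^sup>2) = (\<Sum>i<n. (cmod (cinner (adj D x) (e i)))\<^sup>2)"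
    using assms(2) by (simp add: cinner_adj_left)
  also have "\<dots> \<le> (norm (adj D x))\<^sup>2"
    using assms(1) unfolding bessel_def by blast
  also have "\<dots> \<le> (norm x)\<^sup>2"
  proof (rule power_mono)
    have "norm (adj D x) \<le> norm (adj D) * norm x"
      by (rule norm_blinfun)
    also have "\<dots> \<le> 1 * norm x"
      using norm_adj_le[OF assms(2)] assms(3) by (intro mult_right_mono) auto
    finally show "norm (adj D x) \<le> norm x" by simp
  qed simp
  finally show "(\<Sum>i<n. (cmod (cinner x (D (e i))))\<^sup>2) \<le> (norm x)\<^sup>2" .
qed

lemma ennreal_add_finite: "a < \<infinity> \<Longrightarrow> b < \<infinity> \<Longrightarrow> a + b < (\<infinity>::ennreal)"
  by (cases a; cases b) (auto simp flip: ennreal_plus)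

lemma enn2real_less_iff:
  assumes "a < \<infinity>" "0 < e"
  shows "enn2real a < e \<longleftrightarrow> a < ennreal e"
  using assms by (cases a) (auto simp: ennreal_less_iff)

text \<open>Extended values on all operators, so that the triangle and ideal inequalities are
  available before compactness or finiteness is known.\<close>

definition gnorm :: "((nat \<Rightarrow> complex) \<Rightarrow> real) \<Rightarrow> 'h::complex_hilbert \<Rightarrow>\<^sub>L 'h \<Rightarrow> ennreal"
  where "gnorm \<Phi> A = (SUP (e, f, n) \<in> {(e, f, n :: nat). bessel e \<and> bessel f}.
    ennreal (\<Phi> (\<lambda>i. if i < n then cinner (A (e i)) (f i) else 0)))"

lemma gnorm_upper:
  fixes A :: "'h::complex_hilbert \<Rightarrow>\<^sub>L 'h"
  assumes "bessel e" "bessel f"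
  shows "ennreal (\<Phi> (\<lambda>i. if i < n then cinner (A (e i)) (f i) else 0)) \<le> gnorm \<Phi> A"
  unfolding gnorm_def using assms by (intro SUP_upper2[of "(e, f, n)"]) auto

lemma gnorm_least:
  fixes A :: "'h::complex_hilbert \<Rightarrow>\<^sub>L 'h"
  assumes "\<And>e f n. bessel e \<Longrightarrow> bessel f \<Longrightarrow>
    ennreal (\<Phi> (\<lambda>i. if i < n then cinner (A (e i)) (f i) else 0)) \<le> K"
  shows "gnorm \<Phi> A \<le> K"
  unfolding gnorm_def using assms by (intro SUP_least) auto

context
  fixes \<Phi> :: "(nat \<Rightarrow> complex) \<Rightarrow> real"
  assumes sn: "sn_function \<Phi>"
begin

lemma gnorm_triangle: "gnorm \<Phi> (A + B) \<le> gnorm \<Phi> A + gnorm \<Phi> B"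
proof (rule gnorm_least)
  fix e f :: "nat \<Rightarrow> 'a" and n :: nat
  assume ef: "bessel e" "bessel f"
  define x where "x A i = (if i < n then cinner (blinfun_apply A (e i)) (f i) else 0)" for A i
  have x: "x A \<in> fin_supp" for A
    unfolding x_def by (rule fin_supp_restrict)
  have "x (A + B) = (\<lambda>i. x A i + x B i)"
    by (auto simp: x_def blinfun.add_left cinner_add_left)
  then have "\<Phi> (x (A + B)) \<le> \<Phi> (x A) + \<Phi> (x B)"
    using sn_triangle[OF sn x x] by simp
  then have "ennreal (\<Phi> (x (A + B))) \<le> ennreal (\<Phi> (x A)) + ennreal (\<Phi> (x B))"
    using sn_nonneg[OF sn x] by (simp flip: ennreal_plus)
  also have "\<dots> \<le> gnorm \<Phi> A + gnorm \<Phi> B"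
    unfolding x_def by (intro add_mono gnorm_upper ef)
  finally show "ennreal (\<Phi> (\<lambda>i. if i < n then cinner ((A + B) (e i)) (f i) else 0)) \<le> gnorm \<Phi> A + gnorm \<Phi> B"
    unfolding x_def .
qed

lemma gnorm_zero: "gnorm \<Phi> 0 = 0"
proof -
  have "gnorm \<Phi> (0 :: 'a \<Rightarrow>\<^sub>L 'a) \<le> 0"
    by (rule gnorm_least) (simp add: sn_zero[OF sn] blinfun.zero_left cong: if_cong)
  then show ?thesis by simp
qed

lemma gnorm_sum_le: "gnorm \<Phi> (\<Sum>i\<in>I. A i) \<le> (\<Sum>i\<in>I. gnorm \<Phi> (A i))"
proof (induction I rule: infinite_finite_induct)
  case (insert i I)
  have "gnorm \<Phi> (A i + (\<Sum>i\<in>I. A i)) \<le> gnorm \<Phi> (A i) + (\<Sum>i\<in>I. gnorm \<Phi> (A i))"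
    by (rule order_trans[OF gnorm_triangle add_left_mono[OF insert.IH]])
  then show ?case
    using insert.hyps by simp
qed (simp_all add: gnorm_zero)

lemma gnorm_scale: "gnorm \<Phi> (c *\<^sub>C A) = ennreal (cmod c) * gnorm \<Phi> A"
proof -
  have "\<Phi> (\<lambda>i. if i < n then cinner ((c *\<^sub>C A) (e i)) (f i) else 0)
      = cmod c * \<Phi> (\<lambda>i. if i < n then cinner (A (e i)) (f i) else 0)" for e f :: "nat \<Rightarrow> 'a" and n
  proof -
    have "(\<lambda>i. if i < n then cinner ((c *\<^sub>C A) (e i)) (f i) else 0)
        = (\<lambda>i. c * (if i < n then cinner (A (e i)) (f i) else 0))"
      by (auto simp: scaleC_blinfun_apply cinner_scaleC_left)
    then show ?thesis
      using sn_scale[OF sn fin_supp_restrict] by simp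
  qed
  then have "ennreal (\<Phi> (\<lambda>i. if i < n then cinner ((c *\<^sub>C A) (e i)) (f i) else 0))
      = ennreal (cmod c) * ennreal (\<Phi> (\<lambda>i. if i < n then cinner (A (e i)) (f i) else 0))"
    for e f :: "nat \<Rightarrow> 'a" and n
    using sn_nonneg[OF sn fin_supp_restrict] by (simp add: ennreal_mult)
  then show ?thesis
    by (simp add: gnorm_def SUP_mult_left_ennreal case_prod_unfold)
qed

lemma gnorm_diff_le: "gnorm \<Phi> (A - B) \<le> gnorm \<Phi> A + gnorm \<Phi> B"
  using gnorm_triangle[of A "(-1) *\<^sub>C B"] gnorm_scale[of "-1" B]
  by (simp add: scaleC_minus_left scaleC_one)

lemma gnorm_compose_right:
  assumes "D \<in> bop" "norm D \<le> 1"
  shows "gnorm \<Phi> (A o\<^sub>L D) \<le> gnorm \<Phi> A"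
proof (rule gnorm_least)
  fix e f :: "nat \<Rightarrow> 'a" and n :: nat
  assume ef: "bessel e" "bessel f"
  show "ennreal (\<Phi> (\<lambda>i. if i < n then cinner ((A o\<^sub>L D) (e i)) (f i) else 0)) \<le> gnorm \<Phi> A"
    using gnorm_upper[OF bessel_contraction[OF ef(1) assms] ef(2), of \<Phi> n A] by (simp cong: if_cong)
qed

text \<open>After normalisation the contraction moves to the second family as its adjoint, which
  preserves Bessel's inequality.\<close>

lemma gnorm_compose_left:
  assumes C: "C \<in> bop"
  shows "gnorm \<Phi> (C o\<^sub>L A) \<le> ennreal (norm C) * gnorm \<Phi> A"
proof (cases "C = 0")
  case True
  then have "C o\<^sub>L A = 0"
    by (auto intro!: blinfun_eqI)
  then show ?thesis by (simp add: gnorm_zero)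
next
  case False
  define D where "D = (1 / norm C) *\<^sub>R C"
  have D: "D \<in> bop" "norm D = 1"
    using False bop_scaleR[OF C] by (simp_all add: D_def)
  have "gnorm \<Phi> (D o\<^sub>L A) \<le> gnorm \<Phi> A"
  proof (rule gnorm_least)
    fix e f :: "nat \<Rightarrow> 'a" and n :: nat
    assume ef: "bessel e" "bessel f"
    have "norm (adj D) \<le> 1"
      using norm_adj_le[OF D(1)] D(2) by simp
    then have "bessel (\<lambda>i. adj D (f i))"
      by (rule bessel_contraction[OF ef(2) adj_bop[OF D(1)]])
    from gnorm_upper[OF ef(1) this, of \<Phi> n A]
    show "ennreal (\<Phi> (\<lambda>i. if i < n then cinner ((D o\<^sub>L A) (e i)) (f i) else 0)) \<le> gnorm \<Phi> A"
      by (simp add: cinner_adj_right[OF D(1)] cong: if_cong)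
  qed
  moreover have "C o\<^sub>L A = of_real (norm C) *\<^sub>C (D o\<^sub>L A)"
  proof (rule blinfun_eqI)
    fix x
    have "C (A x) = norm C *\<^sub>R D (A x)"
      using False by (simp add: D_def blinfun.scaleR_left)
    then show "(C o\<^sub>L A) x = (of_real (norm C) *\<^sub>C (D o\<^sub>L A)) x"
      by (simp add: scaleC_blinfun_apply scaleR_scaleC)
  qed
  ultimately show ?thesis
    by (simp add: gnorm_scale mult_left_mono)
qed

lemma gnorm_rank1_le: "gnorm \<Phi> (rank1 u v) \<le> ennreal (norm u * norm v)"
proof (rule gnorm_least)
  fix e f :: "nat \<Rightarrow> 'a" and n :: nat
  assume ef: "bessel e" "bessel f"
  have "\<Phi> (\<lambda>i. if i < n then cinner (rank1 u v (e i)) (f i) else 0)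
      \<le> (\<Sum>i<n. cmod (cinner (rank1 u v (e i)) (f i)))"
    by (rule sn_le_sum[OF sn])
  also have "\<dots> = (\<Sum>i<n. cmod (cinner v (e i)) * cmod (cinner u (f i)))"
    by (simp add: rank1.rep_eq cinner_scaleC_left norm_mult cmod_cinner_commute[of v])
  also have "\<dots> \<le> norm v * norm u"
    by (rule bessel_pair_sum_le[OF ef])
  finally show "ennreal (\<Phi> (\<lambda>i. if i < n then cinner (rank1 u v (e i)) (f i) else 0))
      \<le> ennreal (norm u * norm v)"
    by (simp add: mult.commute ennreal_leI)
qed

text \<open>Tested on families with a single nonzero vector, where the norming function reduces to
  the modulus.\<close>

lemma norm_le_gnorm: "ennreal (norm A) \<le> gnorm \<Phi> A"
proof (cases "gnorm \<Phi> A")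
  case (real r)
  have bes: "bessel (\<lambda>i. if i = 0 then x else 0)" if "norm x \<le> 1" for x :: 'a
    by (rule bessel_orthogonal) (use that in auto)
  have unit: "norm (A x) \<le> r" if "norm x \<le> 1" for x
  proof (rule norm_le_cinnerI)
    fix y :: 'a assume y: "norm y \<le> 1"
    define z where "z = (\<lambda>i::nat. if i < 1 then cinner (A (if i = 0 then x else 0)) (if i = 0 then y else 0) else 0)"
    have "ennreal (\<Phi> z) \<le> ennreal r"
      unfolding real(2)[symmetric] z_def by (rule gnorm_upper[OF bes[OF that] bes[OF y]])
    moreover have "\<Phi> z = cmod (cinner (A x) y)"
      using sn_coord[OF sn, of 0 "cinner (A x) y"] by (simp add: z_def if_distrib cong: if_cong)
    ultimately show "cmod (cinner (A x) y) \<le> r"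
      using real(1) by simp
  qed (rule real)
  have "norm A \<le> r"
    by (rule norm_blinfun_le_unit[OF unit real(1)]) simp
  then show ?thesis
    by (simp add: real ennreal_leI)
qed simp

lemma gnorm_finite_rank: "finite_rank A \<Longrightarrow> gnorm \<Phi> A < \<infinity>"
proof -
  assume "finite_rank A"
  then obtain G where G: "orthonormal G" "\<And>B. B \<in> bop \<Longrightarrow> B o\<^sub>L A = (\<Sum>g\<in>G. rank1 (B g) (adj A g))"
    using finite_rank_expand by blast
  have "A = (\<Sum>g\<in>G. rank1 g (adj A g))"
  proof (rule blinfun_eqI)
    fix x
    show "A x = (\<Sum>g\<in>G. rank1 g (adj A g)) x"
      using arg_cong[OF G(2)[OF bop_id], of "\<lambda>B. blinfun_apply B x"]
      by (simp add: blinfun.sum_left rank1.rep_eq)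
  qed
  then have "gnorm \<Phi> A \<le> (\<Sum>g\<in>G. gnorm \<Phi> (rank1 g (adj A g)))"
    using gnorm_sum_le by metis
  also have "\<dots> \<le> (\<Sum>g\<in>G. ennreal (norm g * norm (adj A g)))"
    by (intro sum_mono gnorm_rank1_le)
  also have "\<dots> < \<infinity>"
    by (simp add: sum_ennreal)
  finally show ?thesis .
qed

text \<open>The moduli of the products of \<open>cinner (e i) (v k)\<close> and
  \<open>cinner (u k) (f i)\<close> form a doubly substochastic matrix, by Bessel's inequality for
  either pair of families, and \<open>sn_substochastic_le\<close> applies.\<close>

lemma gnorm_schmidt_sum_le:
  assumes "antimono s" "\<And>k. 0 \<le> s k" "bessel u" "bessel v"
  shows "gnorm \<Phi> (\<Sum>k<m. s k *\<^sub>R rank1 (u k) (v k))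
    \<le> ennreal (\<Phi> (\<lambda>k. if k < m then of_real (s k) else 0))"
proof (rule gnorm_least)
  fix e f :: "nat \<Rightarrow> 'a" and n :: nat
  assume ef: "bessel e" "bessel f"
  define M where "M i k = cmod (cinner (e i) (v k)) * cmod (cinner (u k) (f i))" for i k
  have "\<Phi> (\<lambda>i. if i < n then cinner ((\<Sum>k<m. s k *\<^sub>R rank1 (u k) (v k)) (e i)) (f i) else 0)
      \<le> \<Phi> (\<lambda>k. if k < m then of_real (s k) else 0)"
  proof (rule sn_substochastic_le[OF sn assms(1,2), of M])
    show "0 \<le> M i k" for i k by (simp add: M_def)
    show "(\<Sum>k<m. M i k) \<le> 1" for i
    proof -
      have "(\<Sum>k<m. M i k) = (\<Sum>k<m. cmod (cinner (e i) (v k)) * cmod (cinner (f i) (u k)))"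
        by (simp add: M_def cmod_cinner_commute[of "f i"])
      also have "\<dots> \<le> norm (e i) * norm (f i)"
        by (rule bessel_pair_sum_le[OF assms(4,3)])
      also have "\<dots> \<le> 1"
        using bessel_norm_le_1[OF ef(1), of i] bessel_norm_le_1[OF ef(2), of i] by (simp add: mult_le_one)
      finally show ?thesis .
    qed
    show "(\<Sum>i<n. M i k) \<le> 1" for k
    proof -
      have "(\<Sum>i<n. M i k) = (\<Sum>i<n. cmod (cinner (v k) (e i)) * cmod (cinner (u k) (f i)))"
        by (simp add: M_def cmod_cinner_commute[of "v k"])
      also have "\<dots> \<le> norm (v k) * norm (u k)"
        by (rule bessel_pair_sum_le[OF ef])
      also have "\<dots> \<le> 1"
        using bessel_norm_le_1[OF assms(3), of k] bessel_norm_le_1[OF assms(4), of k] by (simp add: mult_le_one)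
      finally show ?thesis .
    qed
    fix i
    have "cinner ((\<Sum>k<m. s k *\<^sub>R rank1 (u k) (v k)) (e i)) (f i)
        = (\<Sum>k<m. of_real (s k) * (cinner (e i) (v k) * cinner (u k) (f i)))"
      by (simp add: blinfun.sum_left blinfun.scaleR_left rank1.rep_eq cinner_sum_left cinner_simps)
    then have "cmod (cinner ((\<Sum>k<m. s k *\<^sub>R rank1 (u k) (v k)) (e i)) (f i))
        \<le> (\<Sum>k<m. cmod (of_real (s k) * (cinner (e i) (v k) * cinner (u k) (f i))))"
      by (simp only: norm_sum)
    also have "\<dots> = (\<Sum>k<m. M i k * s k)"
      using assms(2) by (simp add: norm_mult M_def mult_ac)
    finally show "cmod (cinner ((\<Sum>k<m. s k *\<^sub>R rank1 (u k) (v k)) (e i)) (f i)) \<le> (\<Sum>k<m. M i k * s k)" .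
  qed
  then show "ennreal (\<Phi> (\<lambda>i. if i < n then cinner ((\<Sum>k<m. s k *\<^sub>R rank1 (u k) (v k)) (e i)) (f i) else 0))
      \<le> ennreal (\<Phi> (\<lambda>k. if k < m then of_real (s k) else 0))"
    by (rule ennreal_leI)
qed

text \<open>The norms of the truncations increase, so the \<open>lim\<close> in
  \<open>sn_ext\<close> is a true limit.\<close>

lemma sn_ext_eq_SUP:
  "sn_ext \<Phi> a = (SUP n. ennreal (\<Phi> (\<lambda>k. if k < n then a k else 0)))"
proof -
  have "incseq (\<lambda>n. ennreal (\<Phi> (\<lambda>k. if k < n then a k else 0)))"
    by (intro incseq_SucI ennreal_leI sn_mono[OF sn] fin_supp_restrict) auto
  from LIMSEQ_SUP[OF this] show ?thesis
    unfolding sn_ext_def by (rule limI)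
qed

text \<open>One inequality evaluates at the Schmidt vectors. For the other, \<open>A\<close> is
  split into a partial Schmidt sum and a remainder of norm at most \<open>s m\<close>; the length
  \<open>n\<close> of the test families is fixed, so the remainder contributes at most
  \<open>real n * s m\<close>, which vanishes as \<open>m\<close> grows.\<close>

lemma sn_ext_sing_val:
  assumes A: "compact_op A"
  shows "sn_ext \<Phi> (\<lambda>n. complex_of_real (sing_val A n)) = gnorm \<Phi> A"
proof (rule antisym)
  obtain u v where s: "antimono (sing_val A)" "\<And>n. 0 \<le> sing_val A n" "sing_val A \<longlonglongrightarrow> 0"
    "bessel u" "bessel v" "\<And>n. cinner (A (v n)) (u n) = of_real (sing_val A n)"
    "\<And>n. norm (A - (\<Sum>k<n. sing_val A k *\<^sub>R rank1 (u k) (v k))) \<le> sing_val A n"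
    by (rule schmidt_decomposition[OF A]) blast
  define s where "s = sing_val A"
  define S where "S = sn_ext \<Phi> (\<lambda>n. complex_of_real (s n))"
  have up: "ennreal (\<Phi> (\<lambda>k. if k < m then of_real (s k) else 0)) \<le> S" for m
    unfolding S_def sn_ext_eq_SUP by (rule SUP_upper) simp
  show "sn_ext \<Phi> (\<lambda>n. complex_of_real (sing_val A n)) \<le> gnorm \<Phi> A"
    unfolding sn_ext_eq_SUP
  proof (rule SUP_least)
    fix n
    show "ennreal (\<Phi> (\<lambda>k. if k < n then complex_of_real (sing_val A k) else 0)) \<le> gnorm \<Phi> A"
      using gnorm_upper[OF s(5,4), of \<Phi> n A] by (simp add: s(6) cong: if_cong)
  qed
  have "gnorm \<Phi> A \<le> S"
  proof (rule gnorm_least)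
    fix e f :: "nat \<Rightarrow> 'a" and n :: nat
    assume ef: "bessel e" "bessel f"
    define x where "x B i = (if i < n then cinner (blinfun_apply B (e i)) (f i) else 0)" for B i
    have x: "x B \<in> fin_supp" for B
      unfolding x_def by (rule fin_supp_restrict)
    show "ennreal (\<Phi> (\<lambda>i. if i < n then cinner (A (e i)) (f i) else 0)) \<le> S"
    proof (cases S)
      case (real r)
      have bound: "\<Phi> (x A) \<le> r + real n * s m" for m
      proof -
        define Am where "Am = (\<Sum>k<m. s k *\<^sub>R rank1 (u k) (v k))"
        have "x A = (\<lambda>i. x Am i + x (A - Am) i)"
          by (auto simp: x_def blinfun.diff_left cinner_diff_left)
        then have "\<Phi> (x A) \<le> \<Phi> (x Am) + \<Phi> (x (A - Am))"
          using sn_triangle[OF sn x x, of Am "A - Am"] by simp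
        moreover have "ennreal (\<Phi> (x Am)) \<le> ennreal r"
        proof -
          have "ennreal (\<Phi> (x Am)) \<le> gnorm \<Phi> Am"
            unfolding x_def by (rule gnorm_upper[OF ef])
          also have "\<dots> \<le> ennreal (\<Phi> (\<lambda>k. if k < m then of_real (s k) else 0))"
            unfolding Am_def by (rule gnorm_schmidt_sum_le) (use s in \<open>auto simp: s_def\<close>)
          also have "\<dots> \<le> ennreal r"
            using up[of m] by (simp add: real)
          finally show ?thesis .
        qed
        then have "\<Phi> (x Am) \<le> r"
          using real(1) by simp
        moreover have "\<Phi> (x (A - Am)) \<le> real n * s m"
        proof -
          have "\<Phi> (x (A - Am)) \<le> (\<Sum>i<n. cmod (cinner ((A - Am) (e i)) (f i)))"
            unfolding x_def by (rule sn_le_sum[OF sn])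
          also have "\<dots> \<le> (\<Sum>i<n. s m)"
          proof (rule sum_mono)
            fix i
            have "cmod (cinner ((A - Am) (e i)) (f i)) \<le> norm ((A - Am) (e i)) * norm (f i)"
              by (rule cmod_cinner_le)
            also have "\<dots> \<le> (norm (A - Am) * norm (e i)) * norm (f i)"
              by (intro mult_right_mono norm_blinfun) simp
            also have "\<dots> \<le> (s m * 1) * 1"
              using s(2,7) bessel_norm_le_1[OF ef(1)] bessel_norm_le_1[OF ef(2)]
              by (intro mult_mono) (auto simp: Am_def s_def)
            finally show "cmod (cinner ((A - Am) (e i)) (f i)) \<le> s m" by simp
          qed
          finally show ?thesis by simp
        qed
        ultimately show ?thesis by linarith
      qed
      have "(\<lambda>m. r + real n * s m) \<longlonglongrightarrow> r + real n * 0"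
        unfolding s_def by (intro tendsto_intros s)
      then have "\<Phi> (x A) \<le> r + real n * 0"
        by (rule LIMSEQ_le_const) (use bound in blast)
      then have "ennreal (\<Phi> (x A)) \<le> ennreal r"
        by (simp add: ennreal_leI)
      then show ?thesis
        unfolding real(2) x_def .
    qed simp
  qed
  then show "gnorm \<Phi> A \<le> sn_ext \<Phi> (\<lambda>n. complex_of_real (sing_val A n))"
    by (simp add: S_def s_def)
qed

section \<open>Membership in the ideal and in the closure of the finite-rank operators\<close>

lemma sn_ideal_iff: "A \<in> sn_ideal \<Phi> \<longleftrightarrow> compact_op A \<and> gnorm \<Phi> A < \<infinity>"
proof -
  have "(\<lambda>n. complex_of_real (sing_val A n)) \<longlonglongrightarrow> 0" if A: "compact_op A"
  proof -
    have "sing_val A \<longlonglongrightarrow> 0"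
      by (rule schmidt_decomposition[OF A])
    then show ?thesis
      using tendsto_of_real[of "sing_val A" 0 sequentially] by simp
  qed
  then show ?thesis
    using sn_ext_sing_val[of A] by (auto simp: sn_ideal_def sn_space_def)
qed

lemma sn_norm_eq: "compact_op A \<Longrightarrow> sn_norm \<Phi> A = enn2real (gnorm \<Phi> A)"
  by (simp add: sn_norm_def sn_ext_sing_val)

lemma finite_rank_sn_ideal: "finite_rank F \<Longrightarrow> F \<in> sn_ideal \<Phi>"
  using gnorm_finite_rank by (auto simp: sn_ideal_iff finite_rank_compact)

lemma gnorm_approx_compact:
  assumes "A \<in> bop" "\<And>e. e > 0 \<Longrightarrow> \<exists>F. finite_rank F \<and> gnorm \<Phi> (A - F) < ennreal e"
  shows "compact_op A"
proof (rule approx_imp_compact_op[OF assms(1)])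
  fix e :: real assume e: "e > 0"
  then obtain F where F: "finite_rank F" "gnorm \<Phi> (A - F) < ennreal e"
    using assms(2) by blast
  then have "ennreal (norm (A - F)) < ennreal e"
    using norm_le_gnorm[of "A - F"] by (metis le_less_trans)
  then have "norm (A - F) \<le> e"
    using e by (simp add: ennreal_less_iff)
  then show "\<exists>F. finite_rank F \<and> norm (A - F) \<le> e"
    using F(1) by blast
qed

text \<open>Approximability in \<open>gnorm\<close> already forces compactness and a finite norm, so
  later membership proofs only have to produce finite-rank approximants.\<close>

lemma sn_ideal0_iff:
  "A \<in> sn_ideal0 \<Phi> \<longleftrightarrow> A \<in> bop \<and> (\<forall>e>0. \<exists>F. finite_rank F \<and> gnorm \<Phi> (A - F) < ennreal e)"
proof safe
  assume A: "A \<in> sn_ideal0 \<Phi>"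
  then have Ai: "compact_op A" "gnorm \<Phi> A < \<infinity>"
    by (auto simp: sn_ideal0_def sn_ideal_iff)
  then show "A \<in> bop" by (simp add: compact_op_bop)
  fix e :: real assume "e > 0"
  then obtain F where F: "finite_rank F" "sn_norm \<Phi> (A - F) < e"
    using A by (auto simp: sn_ideal0_def)
  have "compact_op (A - F)"
    by (intro compact_op_diff Ai finite_rank_compact F)
  moreover have "gnorm \<Phi> (A - F) < \<infinity>"
    using gnorm_diff_le[of A F] ennreal_add_finite[OF Ai(2) gnorm_finite_rank[OF F(1)]]
    by (rule le_less_trans)
  ultimately have "gnorm \<Phi> (A - F) < ennreal e"
    using F(2) \<open>e > 0\<close> by (simp add: sn_norm_eq enn2real_less_iff)
  then show "\<exists>F. finite_rank F \<and> gnorm \<Phi> (A - F) < ennreal e"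
    using F(1) by blast
next
  assume A: "A \<in> bop" and app: "\<forall>e>0. \<exists>F. finite_rank F \<and> gnorm \<Phi> (A - F) < ennreal e"
  have comp: "compact_op A"
    by (rule gnorm_approx_compact[OF A]) (use app in auto)
  obtain F where F: "finite_rank F" "gnorm \<Phi> (A - F) < ennreal 1"
    using app zero_less_one by blast
  have "gnorm \<Phi> A \<le> gnorm \<Phi> (A - F) + gnorm \<Phi> F"
    using gnorm_triangle[of "A - F" F] by simp
  also have "\<dots> < \<infinity>"
    by (rule ennreal_add_finite[OF less_trans[OF F(2)] gnorm_finite_rank[OF F(1)]]) simp
  finally have "A \<in> sn_ideal \<Phi>"
    using comp by (simp add: sn_ideal_iff)
  moreover have "\<exists>F\<in>sn_ideal \<Phi>. finite_rank F \<and> sn_norm \<Phi> (A - F) < e" if "e > 0" for e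
  proof -
    obtain F where F: "finite_rank F" "gnorm \<Phi> (A - F) < ennreal e"
      using app \<open>e > 0\<close> by blast
    have "compact_op (A - F)"
      by (intro compact_op_diff comp finite_rank_compact F)
    moreover have "enn2real (gnorm \<Phi> (A - F)) < e"
      using F(2) \<open>e > 0\<close> less_trans[OF F(2), of \<infinity>] by (simp add: enn2real_less_iff)
    ultimately show ?thesis
      using F(1) finite_rank_sn_ideal[OF F(1)] by (intro bexI[of _ F]) (auto simp: sn_norm_eq)
  qed
  ultimately show "A \<in> sn_ideal0 \<Phi>"
    by (simp add: sn_ideal0_def)
qed

lemma sn_ideal0_bop: "A \<in> sn_ideal0 \<Phi> \<Longrightarrow> A \<in> bop"
  by (simp add: sn_ideal0_iff)

lemma sn_ideal0_finite: "A \<in> sn_ideal0 \<Phi> \<Longrightarrow> gnorm \<Phi> A < \<infinity>"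
  and sn_ideal0_compact: "A \<in> sn_ideal0 \<Phi> \<Longrightarrow> compact_op A"
  and sn_norm_ideal0: "A \<in> sn_ideal0 \<Phi> \<Longrightarrow> ennreal (sn_norm \<Phi> A) = gnorm \<Phi> A"
  by (auto simp: sn_ideal0_def sn_ideal_iff sn_norm_eq)

lemma finite_rank_sn_ideal0: "finite_rank F \<Longrightarrow> F \<in> sn_ideal0 \<Phi>"
  unfolding sn_ideal0_iff by (auto simp: finite_rank_bop gnorm_zero intro!: exI[of _ F])

lemma sn_ideal0_add:
  assumes "A \<in> sn_ideal0 \<Phi>" "B \<in> sn_ideal0 \<Phi>"
  shows "A + B \<in> sn_ideal0 \<Phi>"
  unfolding sn_ideal0_iff
proof (intro conjI allI impI)
  show "A + B \<in> bop" using assms by (simp add: sn_ideal0_bop bop_add)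
  fix e :: real assume e: "e > 0"
  then have e2: "e / 2 > 0" by simp
  obtain F F' where F: "finite_rank F" "gnorm \<Phi> (A - F) < ennreal (e / 2)"
    and F': "finite_rank F'" "gnorm \<Phi> (B - F') < ennreal (e / 2)"
    using assms e2 unfolding sn_ideal0_iff by meson
  have "gnorm \<Phi> (A + B - (F + F')) \<le> gnorm \<Phi> (A - F) + gnorm \<Phi> (B - F')"
    using gnorm_triangle[of "A - F" "B - F'"] by (simp add: algebra_simps)
  also have "\<dots> < ennreal (e / 2) + ennreal (e / 2)"
    by (rule add_strict_mono[OF F(2) F'(2)])
  also have "\<dots> = ennreal e"
    using e by (simp flip: ennreal_plus)
  finally show "\<exists>F. finite_rank F \<and> gnorm \<Phi> (A + B - F) < ennreal e"
    using finite_rank_add[OF F(1) F'(1)] by blast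
qed

lemma sn_ideal0_compose_left:
  assumes A: "A \<in> sn_ideal0 \<Phi>" and C: "C \<in> bop"
  shows "C o\<^sub>L A \<in> sn_ideal0 \<Phi>"
  unfolding sn_ideal0_iff
proof (intro conjI allI impI)
  show "C o\<^sub>L A \<in> bop" using A C by (simp add: sn_ideal0_bop bop_compose)
  fix e :: real assume e: "e > 0"
  \<comment> \<open>The summand 1 keeps the denominator positive for \<open>C = 0\<close>.\<close>
  define d where "d = e / (norm C + 1)"
  have d: "d > 0" using e by (simp add: d_def add_nonneg_pos)
  obtain F where F: "finite_rank F" "gnorm \<Phi> (A - F) < ennreal d"
    using A d unfolding sn_ideal0_iff by meson
  have "(C o\<^sub>L A) - (C o\<^sub>L F) = C o\<^sub>L (A - F)"
    by (auto intro!: blinfun_eqI simp: blinfun.diff_left blinfun.diff_right)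
  then have "gnorm \<Phi> ((C o\<^sub>L A) - (C o\<^sub>L F)) \<le> ennreal (norm C) * gnorm \<Phi> (A - F)"
    using gnorm_compose_left[OF C] by simp
  also have "\<dots> \<le> ennreal (norm C) * ennreal d"
    using F(2) by (intro mult_left_mono) auto
  also have "\<dots> = ennreal (norm C * d)"
    using d by (simp add: ennreal_mult)
  also have "\<dots> < ennreal e"
  proof (rule ennreal_lessI[OF e])
    have "norm C * d < (norm C + 1) * d"
      using d by (intro mult_strict_right_mono) auto
    also have "\<dots> = e"
      by (simp add: d_def add_nonneg_eq_0_iff)
    finally show "norm C * d < e" .
  qed
  finally show "\<exists>F. finite_rank F \<and> gnorm \<Phi> ((C o\<^sub>L A) - F) < ennreal e"
    using finite_rank_compose_left[OF F(1) C] by blast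
qed

lemma sn_ideal0_scale: "A \<in> sn_ideal0 \<Phi> \<Longrightarrow> c *\<^sub>C A \<in> sn_ideal0 \<Phi>"
proof -
  assume A: "A \<in> sn_ideal0 \<Phi>"
  have "c *\<^sub>C A = (c *\<^sub>C id_blinfun) o\<^sub>L A"
    by (rule blinfun_eqI) (simp add: scaleC_blinfun_apply)
  then show ?thesis
    using sn_ideal0_compose_left[OF A bop_scale[OF bop_id]] by simp
qed

lemma sn_norm_scale:
  assumes "A \<in> sn_ideal0 \<Phi>"
  shows "sn_norm \<Phi> (c *\<^sub>C A) = cmod c * sn_norm \<Phi> A"
  by (simp add: sn_norm_eq sn_ideal0_compact assms sn_ideal0_scale gnorm_scale enn2real_mult)

text \<open>For a finite-rank F the product F Q_n is a finite sum of rank one operators whose right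
  vectors Q_n F^* g tend to 0. Approximation in the ideal norm together with ||Q_n|| <= 1 extends
  this to \<open>A\<close>.\<close>

lemma gnorm_diff_proj_small:
  fixes A :: "'h::complex_hilbert \<Rightarrow>\<^sub>L 'h"
  assumes A: "A \<in> sn_ideal0 \<Phi>" and G: "\<And>n. orthonormal (G n)"
    and lim: "\<And>x. (\<lambda>n. proj (G n) x) \<longlonglongrightarrow> x" and e: "e > 0"
  shows "\<exists>N. \<forall>n\<ge>N. gnorm \<Phi> (A o\<^sub>L (id_blinfun - proj (G n))) \<le> ennreal e"
proof -
  define Q where "Q n = id_blinfun - proj (G n)" for n
  have Q: "Q n \<in> bop" "norm (Q n) \<le> 1" for n
    unfolding Q_def by (intro bop_diff bop_id proj_bop, rule norm_id_minus_proj_le[OF G])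
  have Qlim: "(\<lambda>n. norm (Q n x)) \<longlonglongrightarrow> 0" for x
    using tendsto_norm[OF tendsto_diff[OF tendsto_const[of x] lim[of x]]]
    by (simp add: Q_def blinfun.diff_left)
  have e2: "e / 2 > 0" using e by simp
  obtain F where F: "finite_rank F" "gnorm \<Phi> (A - F) < ennreal (e / 2)"
    using A e2 unfolding sn_ideal0_iff by meson
  obtain H where H: "orthonormal H" "\<And>B. B \<in> bop \<Longrightarrow> B o\<^sub>L F = (\<Sum>g\<in>H. rank1 (B g) (adj F g))"
    using finite_rank_expand[OF F(1)] by blast
  have FQ: "F o\<^sub>L Q n = (\<Sum>g\<in>H. rank1 g (Q n (adj F g)))" for n
  proof (rule blinfun_eqI)
    fix x
    have "F (Q n x) = (\<Sum>g\<in>H. cinner (Q n x) (adj F g) *\<^sub>C g)"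
      using arg_cong[OF H(2)[OF bop_id], of "\<lambda>B. blinfun_apply B (Q n x)"]
      by (simp add: blinfun.sum_left rank1.rep_eq)
    then show "(F o\<^sub>L Q n) x = (\<Sum>g\<in>H. rank1 g (Q n (adj F g))) x"
      by (simp add: blinfun.sum_left rank1.rep_eq Q_def blinfun.diff_left cinner_simps
          selfadjD[OF selfadj_proj])
  qed
  have "(\<lambda>n. \<Sum>g\<in>H. norm g * norm (Q n (adj F g))) \<longlonglongrightarrow> (\<Sum>g\<in>H. norm g * 0)"
    by (intro tendsto_intros Qlim)
  then have "eventually (\<lambda>n. (\<Sum>g\<in>H. norm g * norm (Q n (adj F g))) < e / 2) sequentially"
    by (intro order_tendstoD(2)[where y = 0] e2) simp
  then obtain N where N: "\<And>n. n \<ge> N \<Longrightarrow> (\<Sum>g\<in>H. norm g * norm (Q n (adj F g))) < e / 2"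
    by (auto simp: eventually_sequentially)
  have "gnorm \<Phi> (A o\<^sub>L Q n) \<le> ennreal e" if "n \<ge> N" for n
  proof -
    have "A o\<^sub>L Q n = ((A - F) o\<^sub>L Q n) + (F o\<^sub>L Q n)"
      by (auto intro!: blinfun_eqI simp: blinfun.diff_left blinfun.add_left)
    then have "gnorm \<Phi> (A o\<^sub>L Q n) \<le> gnorm \<Phi> ((A - F) o\<^sub>L Q n) + gnorm \<Phi> (F o\<^sub>L Q n)"
      using gnorm_triangle by metis
    also have "\<dots> \<le> ennreal (e / 2) + ennreal (e / 2)"
    proof (rule add_mono)
      show "gnorm \<Phi> ((A - F) o\<^sub>L Q n) \<le> ennreal (e / 2)"
        using gnorm_compose_right[OF Q, of "A - F" n] F(2) by simp
      have "gnorm \<Phi> (F o\<^sub>L Q n) \<le> (\<Sum>g\<in>H. ennreal (norm g * norm (Q n (adj F g))))"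
        unfolding FQ by (rule order_trans[OF gnorm_sum_le]) (intro sum_mono gnorm_rank1_le)
      also have "\<dots> = ennreal (\<Sum>g\<in>H. norm g * norm (Q n (adj F g)))"
        by (rule sum_ennreal) simp
      also have "\<dots> \<le> ennreal (e / 2)"
        using N[OF that] by (intro ennreal_leI) simp
      finally show "gnorm \<Phi> (F o\<^sub>L Q n) \<le> ennreal (e / 2)" .
    qed
    also have "\<dots> = ennreal e"
      using e by (simp flip: ennreal_plus)
    finally show ?thesis .
  qed
  then show ?thesis
    unfolding Q_def by blast
qed

text \<open>Raised to the power \<open>p\<close>, the hypothesis bounds the entries of
  \<open>Z\<close> by multiples of diagonal entries of \<open>T\<close>; these are tested by the
  family \<open>e\<close> used on both sides, so the norm of \<open>T\<close> takes over.\<close>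

lemma gnorm_p_mod_le:
  fixes T Z :: "'h::complex_hilbert \<Rightarrow>\<^sub>L 'h"
  assumes p: "1 \<le> p" and K: "0 \<le> K" and t: "0 \<le> t" "gnorm \<Phi> T \<le> ennreal t"
    and T: "\<And>e. 0 \<le> Re (cinner (T e) e)"
    and Z: "\<And>e f. norm e \<le> 1 \<Longrightarrow> norm f \<le> 1 \<Longrightarrow>
      cmod (cinner (Z e) f) \<le> K * Re (cinner (T e) e) powr (1 / p)"
  shows "gnorm (p_mod \<Phi> p) Z \<le> ennreal (K * t powr (1 / p))"
proof (rule gnorm_least)
  fix e f :: "nat \<Rightarrow> 'h" and n :: nat
  assume ef: "bessel e" "bessel f"
  define z where "z i = (if i < n then cinner (Z (e i)) (f i) else 0)" for i
  define y where "y i = (if i < n then cinner (T (e i)) (e i) else 0)" for i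
  have y: "y \<in> fin_supp" and z: "z \<in> fin_supp"
    unfolding y_def z_def by (rule fin_supp_restrict)+
  have "\<Phi> (\<lambda>i. complex_of_real (cmod (z i) powr p)) \<le> \<Phi> (\<lambda>i. complex_of_real (K powr p) * y i)"
  proof (rule sn_mono[OF sn])
    show "(\<lambda>i. complex_of_real (K powr p) * y i) \<in> fin_supp"
      by (rule fin_supp_scale[OF y])
    fix i
    show "cmod (complex_of_real (cmod (z i) powr p)) \<le> cmod (complex_of_real (K powr p) * y i)"
    proof (cases "i < n")
      case True
      have "cmod (z i) powr p \<le> (K * Re (cinner (T (e i)) (e i)) powr (1 / p)) powr p"
        using True p Z[OF bessel_norm_le_1[OF ef(1)] bessel_norm_le_1[OF ef(2)]]
        by (intro powr_mono2) (auto simp: z_def)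
      also have "\<dots> = K powr p * Re (cinner (T (e i)) (e i))"
        using p T K by (simp add: powr_mult powr_powr)
      also have "\<dots> \<le> K powr p * cmod (cinner (T (e i)) (e i))"
        by (intro mult_left_mono complex_Re_le_cmod) simp
      finally show ?thesis
        using True by (simp add: y_def norm_mult)
    qed (use p in \<open>simp add: z_def\<close>)
  qed
  also have "\<dots> = K powr p * \<Phi> y"
    using sn_scale[OF sn y] by simp
  also have "\<dots> \<le> K powr p * t"
  proof (rule mult_left_mono)
    have "ennreal (\<Phi> y) \<le> ennreal t"
      unfolding y_def by (rule order_trans[OF gnorm_upper[OF ef(1,1)] t(2)])
    then show "\<Phi> y \<le> t" using t(1) by simp
  qed simp
  finally have "\<Phi> (\<lambda>i. complex_of_real (cmod (z i) powr p)) \<le> K powr p * t" .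
  moreover have "0 \<le> \<Phi> (\<lambda>i. complex_of_real (cmod (z i) powr p))"
    by (rule sn_nonneg[OF sn], rule fin_supp_dominated[OF z]) (use p in simp)
  ultimately have "p_mod \<Phi> p z \<le> (K powr p * t) powr (1 / p)"
    unfolding p_mod_def using p by (intro powr_mono2) auto
  also have "\<dots> = K * t powr (1 / p)"
    using p K t by (simp add: powr_mult powr_powr)
  finally show "ennreal (p_mod \<Phi> p (\<lambda>i. if i < n then cinner (Z (e i)) (f i) else 0)) \<le> ennreal (K * t powr (1 / p))"
    unfolding z_def by (rule ennreal_leI)
qed

end

text \<open>The sets \<open>G n\<close> come from separate Gram-Schmidt runs over growing pieces of
  a dense sequence. They may fail to be nested; the convergence rests on best approximation
  alone.\<close>

lemma separable_projections:
  assumes "separable_space (euclidean :: 'h::complex_hilbert topology)"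
  obtains G :: "nat \<Rightarrow> 'h::complex_hilbert set" where "\<And>n. orthonormal (G n)" "\<And>x. (\<lambda>n. proj (G n) x) \<longlonglongrightarrow> x"
proof -
  obtain D :: "'h set" where D: "countable D" "closure D = UNIV"
    using assms by (auto simp: separable_space_def)
  then have "D \<noteq> {}" by auto
  then obtain d :: "nat \<Rightarrow> 'h" where d: "range d = D"
    using D(1) by (metis range_from_nat_into)
  have "\<exists>G. orthonormal G \<and> (\<forall>x\<in>d ` {..n}. proj G x = x)" for n
    by (rule gram_schmidt) simp
  then obtain G where G: "\<And>n. orthonormal (G n)" "\<And>n x. x \<in> d ` {..n} \<Longrightarrow> proj (G n) x = x"
    by metis
  have "(\<lambda>n. proj (G n) x) \<longlonglongrightarrow> x" for x
    unfolding LIMSEQ_def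
  proof (intro allI impI)
    fix r :: real assume "r > 0"
    then obtain y where "y \<in> D" "dist y x < r"
      using D(2) closure_approachable[of x D] by auto
    then obtain k where k: "dist (d k) x < r"
      using d by auto
    have "dist (proj (G n) x) x < r" if "n \<ge> k" for n
      using norm_diff_proj_close[OF G(1), of n "d k" x] G(2)[of "d k" n] that k
      by (simp add: dist_norm norm_minus_commute)
    then show "\<exists>N. \<forall>n\<ge>N. dist (proj (G n) x) x < r" by blast
  qed
  then show ?thesis
    using that G(1) by blast
qed

section \<open>Measurability and weak integrals\<close>

text \<open>Carried by a sigma-finite set up to a null set: what \<open>mu_measurable\<close>
  demands besides Borel measurability when the measure is not sigma-finite.\<close>

definition sigma_carried :: "'t measure \<Rightarrow> ('t \<Rightarrow> complex) \<Rightarrow> bool"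
  where "sigma_carried M f \<longleftrightarrow> (\<exists>S :: nat \<Rightarrow> 't set. (\<forall>n. S n \<in> sets M \<and> emeasure M (S n) < \<infinity>) \<and>
    (AE t in M. t \<notin> (\<Union>n. S n) \<longrightarrow> f t = 0))"

lemma sigma_carried_countable:
  assumes "\<And>n::nat. sigma_carried M (f n)"
    and "AE t in M. (\<forall>n. f n t = 0) \<longrightarrow> g t = 0"
  shows "sigma_carried M g"
proof -
  obtain S :: "nat \<Rightarrow> nat \<Rightarrow> 'a set" where S: "\<And>n k. S n k \<in> sets M \<and> emeasure M (S n k) < \<infinity>"
    "\<And>n. AE t in M. t \<notin> (\<Union>k. S n k) \<longrightarrow> f n t = 0"
    using assms(1) unfolding sigma_carried_def by metis
  define U where "U i = S (fst (prod_decode i)) (snd (prod_decode i))" for i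
  have sub: "S n k \<subseteq> (\<Union>i. U i)" for n k
    by (rule order_trans[OF _ UN_upper[of "prod_encode (n, k)"]]) (simp_all add: U_def)
  have "AE t in M. \<forall>n. t \<notin> (\<Union>k. S n k) \<longrightarrow> f n t = 0"
    using S(2) by (simp add: AE_all_countable)
  then have "AE t in M. t \<notin> (\<Union>i. U i) \<longrightarrow> g t = 0"
    using assms(2)
  proof eventually_elim
    case (elim t)
    show ?case
    proof
      assume "t \<notin> (\<Union>i. U i)"
      then have "t \<notin> (\<Union>k. S n k)" for n using sub by blast
      then show "g t = 0" using elim by blast
    qed
  qed
  then show ?thesis
    unfolding sigma_carried_def using S(1) by (intro exI[of _ U]) (simp add: U_def)
qed

lemma sigma_carried_mono:
  "sigma_carried M f \<Longrightarrow> (\<And>t. f t = 0 \<Longrightarrow> g t = 0) \<Longrightarrow> sigma_carried M g"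
  by (rule sigma_carried_countable[of M "\<lambda>_. f"]) auto

lemma mu_simple_borel: "mu_simple M s \<Longrightarrow> s \<in> borel_measurable M"
proof -
  assume "mu_simple M s"
  then obtain m :: nat and x :: "nat \<Rightarrow> complex" and E where
    E: "\<forall>k<m. E k \<in> sets M \<and> emeasure M (E k) < \<infinity>" "\<forall>t\<in>space M. s t = (\<Sum>k<m. x k * indicator (E k) t)"
    unfolding mu_simple_def by blast
  have "(\<lambda>t. \<Sum>k<m. x k * indicator (E k) t) \<in> borel_measurable M"
    using E(1) by (intro borel_measurable_sum borel_measurable_times borel_measurable_const borel_measurable_indicator) auto
  then show ?thesis
    using E(2) by (subst measurable_cong[of _ _ "\<lambda>t. \<Sum>k<m. x k * indicator (E k) t"]) auto
qed

lemma mu_simple_carried: "mu_simple M s \<Longrightarrow> sigma_carried M s"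
proof -
  assume "mu_simple M s"
  then obtain m :: nat and x :: "nat \<Rightarrow> complex" and E where
    E: "\<forall>k<m. E k \<in> sets M \<and> emeasure M (E k) < \<infinity>" "\<forall>t\<in>space M. s t = (\<Sum>k<m. x k * indicator (E k) t)"
    unfolding mu_simple_def by blast
  define S where "S k = (if k < m then E k else {})" for k
  have "s t = 0" if "t \<in> space M" "t \<notin> (\<Union>k. S k)" for t
  proof -
    have "t \<notin> E k" if "k < m" for k
      using \<open>t \<notin> (\<Union>k. S k)\<close> that by (auto simp: S_def split: if_splits)
    then have "(\<Sum>k<m. x k * indicator (E k) t) = 0"
      by (intro sum.neutral) (simp add: indicator_def)
    then show ?thesis
      using E(2) that(1) by simp
  qed
  then show ?thesis
    unfolding sigma_carried_def using E(1) by (intro exI[of _ S]) (auto simp: S_def)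
qed

text \<open>Here completeness of the measure enters: preimages under the two functions differ inside
  a null set, all of whose subsets are measurable.\<close>

lemma (in complete_measure) borel_measurable_AE_eq:
  fixes f g :: "'a \<Rightarrow> complex"
  assumes g: "g \<in> borel_measurable M" and ae: "AE t in M. f t = g t"
  shows "f \<in> borel_measurable M"
proof (rule measurableI)
  fix B :: "complex set" assume "B \<in> sets borel"
  then have "g -` B \<inter> space M \<in> sets M"
    using g by (rule measurable_sets[rotated])
  then show "f -` B \<inter> space M \<in> sets M"
    by (rule in_sets_AE[rotated]) (use ae in auto)
qed simp

lemma mu_measurable_imp:
  assumes "complete_measure M" "mu_measurable M f"
  shows "f \<in> borel_measurable M" "sigma_carried M f"
proof -
  interpret complete_measure M by fact
  obtain s where s: "\<And>n. mu_simple M (s n)" "AE t in M. (\<lambda>n. s n t) \<longlonglongrightarrow> f t"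
    using assms(2) unfolding mu_measurable_def by blast
  have "(\<lambda>t. lim (\<lambda>n. s n t)) \<in> borel_measurable M"
    by (intro borel_measurable_lim_metric mu_simple_borel s)
  moreover have "AE t in M. f t = lim (\<lambda>n. s n t)"
    using s(2) by eventually_elim (simp add: limI)
  ultimately show "f \<in> borel_measurable M"
    by (rule borel_measurable_AE_eq)
  show "sigma_carried M f"
  proof (rule sigma_carried_countable[OF mu_simple_carried[OF s(1)]])
    show "AE t in M. (\<forall>n. s n t = 0) \<longrightarrow> f t = 0"
      using s(2) by eventually_elim (auto simp: LIMSEQ_const_iff)
  qed
qed

text \<open>Simple Borel approximants are cut down to sets of finite measure that exhaust the
  carrier; outside the carrier both sides vanish almost everywhere.\<close>

lemma mu_measurableI:
  assumes f: "f \<in> borel_measurable M" and "sigma_carried M f"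
  shows "mu_measurable M f"
proof -
  obtain S :: "nat \<Rightarrow> 'a set" where S: "\<And>n. S n \<in> sets M \<and> emeasure M (S n) < \<infinity>"
    "AE t in M. t \<notin> (\<Union>n. S n) \<longrightarrow> f t = 0"
    using assms(2) unfolding sigma_carried_def by blast
  obtain F where F: "\<And>i. simple_function M (F i)" "\<And>t. t \<in> space M \<Longrightarrow> (\<lambda>i. F i t) \<longlonglongrightarrow> f t"
    using borel_measurable_implies_sequence_metric[OF f, of 0] by blast
  define U where "U n = (\<Union>k<n. S k)" for n :: nat
  have U: "U n \<in> sets M" "emeasure M (U n) < \<infinity>" for n
  proof -
    show "U n \<in> sets M"
      unfolding U_def using S by auto
    have "emeasure M (U n) \<le> (\<Sum>k<n. emeasure M (S k))"
      unfolding U_def using S(1) by (intro emeasure_subadditive_finite) auto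
    also have "\<dots> < \<infinity>"
      using S(1) by simp
    finally show "emeasure M (U n) < \<infinity>" .
  qed
  define s where "s n t = F n t * indicator (U n) t" for n t
  have "mu_simple M (s n)" for n
  proof -
    \<comment> \<open>Level sets, indexed by an enumeration of the finite range, give the disjoint
      form that \<open>mu_simple\<close> asks for.\<close>
    define V where "V = F n ` space M"
    have fin: "finite V"
      using F(1) by (simp add: V_def simple_function_def)
    obtain x where x: "bij_betw x {..<card V} V"
      using ex_bij_betw_nat_finite[OF fin] by (auto simp: atLeast0LessThan)
    define E where "E k = (F n -` {x k} \<inter> space M) \<inter> U n" for k
    have E: "E k \<in> sets M" "emeasure M (E k) < \<infinity>" for k
    proof -
      show "E k \<in> sets M"
        unfolding E_def using simple_functionD(2)[OF F(1), of n "{x k}"] U(1) by auto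
      have "emeasure M (E k) \<le> emeasure M (U n)"
        by (rule emeasure_mono) (use U in \<open>auto simp: E_def\<close>)
      then show "emeasure M (E k) < \<infinity>"
        using U(2) by (rule le_less_trans)
    qed
    have disj: "disjoint_family_on E {..<card V}"
      using x by (auto simp: disjoint_family_on_def E_def bij_betw_def inj_on_def)
    have "s n t = (\<Sum>k<card V. x k * indicator (E k) t)" if t: "t \<in> space M" for t
    proof -
      have "F n t \<in> V" using t by (simp add: V_def)
      then obtain j where j: "j < card V" "x j = F n t"
        using x by (auto simp: bij_betw_def image_iff) (metis imageE lessThan_iff)
      have "indicator (E k) t = (if k = j then indicator (U n) t else (0::complex))" if "k < card V" for k
        using that j x t by (auto simp: E_def indicator_def bij_betw_def inj_on_def)
      then have "(\<Sum>k<card V. x k * indicator (E k) t)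
          = (\<Sum>k<card V. if k = j then x j * indicator (U n) t else 0)"
        by (intro sum.cong) auto
      then show ?thesis
        using j by (simp add: s_def)
    qed
    then show ?thesis
      unfolding mu_simple_def using E disj by blast
  qed
  moreover have "AE t in M. (\<lambda>n. s n t) \<longlonglongrightarrow> f t"
    using S(2) AE_space
  proof eventually_elim
    case (elim t)
    show ?case
    proof (cases "t \<in> (\<Union>n. S n)")
      case True
      then obtain k where "t \<in> S k" by blast
      then have "s n t = F n t" if "n \<ge> Suc k" for n
        using that by (auto simp: s_def U_def indicator_def)
      then have "eventually (\<lambda>n. F n t = s n t) sequentially"
        unfolding eventually_sequentially by metis
      then show ?thesis
        using F(2)[OF elim(2)] by (rule Lim_transform_eventually[rotated])
    next
      case False
      then have "s n t = 0" for n
        by (auto simp: s_def U_def indicator_def)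
      then show ?thesis
        using elim(1) False by simp
    qed
  qed
  ultimately show ?thesis
    unfolding mu_measurable_def by blast
qed

context
  fixes M :: "'t measure"
  assumes cm: "complete_measure M"
begin

lemma mu_measurable_iff: "mu_measurable M f \<longleftrightarrow> f \<in> borel_measurable M \<and> sigma_carried M f"
  using mu_measurable_imp[OF cm] mu_measurableI by blast

lemma mu_measurable_borel: "mu_measurable M f \<Longrightarrow> f \<in> borel_measurable M"
  by (simp add: mu_measurable_iff)

lemma mu_measurable_cnj: "mu_measurable M f \<Longrightarrow> mu_measurable M (\<lambda>t. cnj (f t))"
  unfolding mu_measurable_iff
proof (elim conjE, rule conjI)
  assume f: "f \<in> borel_measurable M"
  have "cnj \<in> borel_measurable borel"
    by (intro borel_measurable_continuous_onI continuous_intros)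
  then show "(\<lambda>t. cnj (f t)) \<in> borel_measurable M"
    by (rule measurable_compose[OF f])
qed (auto elim: sigma_carried_mono)

lemma mu_measurable_mult:
  "mu_measurable M f \<Longrightarrow> g \<in> borel_measurable M \<Longrightarrow> mu_measurable M (\<lambda>t. f t * g t)"
  unfolding mu_measurable_iff by (auto elim: sigma_carried_mono)

lemma mu_measurable_cmult: "mu_measurable M f \<Longrightarrow> mu_measurable M (\<lambda>t. c * f t)"
  using mu_measurable_mult[of f "\<lambda>_. c"] by (simp add: mult.commute)

lemma mu_measurable_add:
  assumes "mu_measurable M f" "mu_measurable M g"
  shows "mu_measurable M (\<lambda>t. f t + g t)"
proof -
  have "sigma_carried M (\<lambda>t. f t + g t)"
  proof (rule sigma_carried_countable[of M "\<lambda>n::nat. if n = 0 then f else g"])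
    show "sigma_carried M (if n = 0 then f else g)" for n :: nat
      using assms by (simp add: mu_measurable_iff)
    show "AE t in M. (\<forall>n::nat. (if n = 0 then f else g) t = 0) \<longrightarrow> f t + g t = 0"
      by (intro AE_I2 impI) (metis add.right_neutral zero_neq_one)
  qed
  then show ?thesis
    using assms by (auto simp: mu_measurable_iff intro: borel_measurable_add)
qed

lemma mu_measurable_zero: "mu_measurable M (\<lambda>_. 0)"
  unfolding mu_measurable_iff sigma_carried_def by (auto intro!: exI[of _ "\<lambda>_. {}"])

lemma mu_measurable_sum:
  "(\<And>i. i \<in> I \<Longrightarrow> mu_measurable M (f i)) \<Longrightarrow> mu_measurable M (\<lambda>t. \<Sum>i\<in>I. f i t)"
  by (induction I rule: infinite_finite_induct) (auto simp: mu_measurable_zero mu_measurable_add)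

lemma mu_measurable_limit:
  assumes "\<And>n. mu_measurable M (f n)" "\<And>t. t \<in> space M \<Longrightarrow> (\<lambda>n. f n t) \<longlonglongrightarrow> g t"
  shows "mu_measurable M g"
  unfolding mu_measurable_iff
proof
  show "g \<in> borel_measurable M"
    by (rule borel_measurable_LIMSEQ_metric[OF _ assms(2)]) (use assms(1) mu_measurable_borel in auto)
  show "sigma_carried M g"
  proof (rule sigma_carried_countable[of M f])
    show "AE t in M. (\<forall>n. f n t = 0) \<longrightarrow> g t = 0"
    proof (intro AE_I2 impI)
      fix t assume "t \<in> space M" "\<forall>n. f n t = 0"
      then show "g t = 0"
        using assms(2)[of t] by (simp add: LIMSEQ_const_iff)
    qed
  qed (use assms(1) mu_measurable_iff in auto)
qed

lemma mu_measurable_cong: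
  "(\<And>t. t \<in> space M \<Longrightarrow> f t = g t) \<Longrightarrow> mu_measurable M f \<longleftrightarrow> mu_measurable M g"
  using mu_measurable_limit[of "\<lambda>_. f" g] mu_measurable_limit[of "\<lambda>_. g" f] by auto

end

text \<open>The definitions speak of the quadratic form only; this carries measurability and
  integrability over to all matrix entries. Differences are written as sums with negative
  coefficients to fit the rules for sums and scalar multiples.\<close>

lemma polarization:
  assumes "A \<in> bop"
  shows "cinner (A x) y = (1/4) * (cinner (A (x + y)) (x + y)) + (-1/4) * (cinner (A (x - y)) (x - y))
    + (\<i>/4) * (cinner (A (x + \<i> *\<^sub>C y)) (x + \<i> *\<^sub>C y)) + (-\<i>/4) * (cinner (A (x - \<i> *\<^sub>C y)) (x - \<i> *\<^sub>C y))"
  by (simp add: blinfun.add_right blinfun.diff_right bop_scaleC[OF assms] cinner_simps field_simps)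

lemma wstar_measurable_cinner:
  assumes cm: "complete_measure M" and A: "wstar_measurable M A"
  shows "mu_measurable M (\<lambda>t. cinner (A t x) y)"
proof -
  have q: "mu_measurable M (\<lambda>t. cinner (A t f) f)" for f
    using A by (simp add: wstar_measurable_def)
  have "mu_measurable M (\<lambda>t. (1/4) * (cinner (A t (x + y)) (x + y)) + (-1/4) * (cinner (A t (x - y)) (x - y))
    + (\<i>/4) * (cinner (A t (x + \<i> *\<^sub>C y)) (x + \<i> *\<^sub>C y)) + (-\<i>/4) * (cinner (A t (x - \<i> *\<^sub>C y)) (x - \<i> *\<^sub>C y)))"
    by (intro mu_measurable_add[OF cm] mu_measurable_cmult[OF cm] q)
  then show ?thesis
    by (subst mu_measurable_cong[OF cm polarization]) (use A in \<open>auto simp: wstar_measurable_def\<close>)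
qed

text \<open>Separability makes the inner product of two weakly measurable vector functions a limit
  of finite sums of products of their coordinates.\<close>

lemma wstar_measurable_cinner_pair:
  fixes A B :: "'t \<Rightarrow> 'h::complex_hilbert \<Rightarrow>\<^sub>L 'h"
  assumes cm: "complete_measure M" and A: "wstar_measurable M A" and B: "wstar_measurable M B"
    and G: "\<And>n. orthonormal (G n)" "\<And>x::'h. (\<lambda>n. proj (G n) x) \<longlonglongrightarrow> x"
  shows "mu_measurable M (\<lambda>t. cinner (B t x) (A t y))"
proof (rule mu_measurable_limit[OF cm])
  show "mu_measurable M (\<lambda>t. \<Sum>g\<in>G n. cinner (B t x) g * cnj (cinner (A t y) g))" for n
    by (intro mu_measurable_sum[OF cm] mu_measurable_mult[OF cm] wstar_measurable_cinner[OF cm]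
        mu_measurable_borel[OF cm] mu_measurable_cnj[OF cm] A B)
  fix t
  have "(\<lambda>n. cinner (proj (G n) (B t x)) (A t y)) \<longlonglongrightarrow> cinner (B t x) (A t y)"
    by (intro tendsto_cinner_left G)
  then show "(\<lambda>n. \<Sum>g\<in>G n. cinner (B t x) g * cnj (cinner (A t y) g)) \<longlonglongrightarrow> cinner (B t x) (A t y)"
    by (simp add: proj_apply cinner_sum_left cinner_scaleC_left flip: cinner_commute)
qed

lemma wstar_integrable_cinner:
  assumes "wstar_integrable M A"
  shows "integrable M (\<lambda>t. cinner (A t x) y)"
proof -
  have q: "integrable M (\<lambda>t. cinner (A t f) f)" for f
    using assms by (simp add: wstar_integrable_def)
  have "integrable M (\<lambda>t. (1/4) * (cinner (A t (x + y)) (x + y)) + (-1/4) * (cinner (A t (x - y)) (x - y))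
    + (\<i>/4) * (cinner (A t (x + \<i> *\<^sub>C y)) (x + \<i> *\<^sub>C y)) + (-\<i>/4) * (cinner (A t (x - \<i> *\<^sub>C y)) (x - \<i> *\<^sub>C y)))"
    by (intro Bochner_Integration.integrable_add integrable_mult_right q)
  then show ?thesis
    by (subst Bochner_Integration.integrable_cong[OF refl polarization])
      (use assms in \<open>auto simp: wstar_measurable_def wstar_integrable_def\<close>)
qed

text \<open>A uniform boundedness principle: the sets where the integral is at most \<open>n\<close> are closed by
  Fatou's lemma, so one of them has interior points.\<close>

lemma integral_uniformly_bounded:
  fixes u :: "'h::{real_normed_vector,complete_space} \<Rightarrow> 't \<Rightarrow> ennreal" and c q :: real
  assumes meas: "\<And>x. u x \<in> borel_measurable M"
    and cont: "\<And>X x t. t \<in> space M \<Longrightarrow> X \<longlonglongrightarrow> x \<Longrightarrow> (\<lambda>n. u (X n) t) \<longlonglongrightarrow> u x t"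
    and fin: "\<And>x. (\<integral>\<^sup>+t. u x t \<partial>M) < \<infinity>"
    and diff: "\<And>x y t. t \<in> space M \<Longrightarrow> u (x - y) t \<le> ennreal c * (u x t + u y t)"
    and hom: "\<And>r x t. 0 < r \<Longrightarrow> t \<in> space M \<Longrightarrow> u (r *\<^sub>R x) t = ennreal (r powr q) * u x t"
    and c: "0 \<le> c"
  shows "\<exists>K\<ge>0. \<forall>x. norm x \<le> 1 \<longrightarrow> (\<integral>\<^sup>+t. u x t \<partial>M) \<le> ennreal K"
proof -
  define I where "I x = (\<integral>\<^sup>+t. u x t \<partial>M)" for x
  define F where "F n = {x. I x \<le> ennreal (real n)}" for n
  have clF: "closed (F n)" for n
    unfolding closed_sequential_limits
  proof (intro allI impI)
    fix X x assume X: "(\<forall>k. X k \<in> F n) \<and> X \<longlonglongrightarrow> x"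
    have "I x = (\<integral>\<^sup>+t. liminf (\<lambda>k. u (X k) t) \<partial>M)"
      unfolding I_def using X cont
      by (intro nn_integral_cong lim_imp_Liminf[symmetric]) auto
    also have "\<dots> \<le> liminf (\<lambda>k. I (X k))"
      unfolding I_def by (rule nn_integral_liminf[OF meas])
    also have "\<dots> \<le> ennreal (real n)"
      using X by (intro Liminf_le) (auto simp: F_def)
    finally show "x \<in> F n" by (simp add: F_def)
  qed
  have "\<exists>n. interior (F n) \<noteq> {}"
  proof (rule ccontr)
    assume "\<not> ?thesis"
    then have "(euclidean :: 'h topology) interior_of (\<Union>(range F)) = {}"
      using clF by (intro Baire_category_alt) (auto simp: completely_metrizable_space_euclidean)
    moreover have "\<Union>(range F) = UNIV"
    proof -
      have "\<exists>n. x \<in> F n" for x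
        using fin[of x] by (cases "I x") (auto simp: F_def I_def ennreal_leI real_arch_simple)
      then show ?thesis by auto
    qed
    ultimately show False by simp
  qed
  then obtain n x0 where "x0 \<in> interior (F n)" by blast
  then obtain r where r: "r > 0" "ball x0 r \<subseteq> F n"
    unfolding mem_interior by blast
  \<comment> \<open>A vector of the unit ball is shrunk by \<open>r / 2\<close> and written as
    \<open>(x0 + y) - x0\<close>. Both integrals are at most \<open>n\<close>, which costs
    \<open>c * (2 * real n)\<close>; undoing the scaling costs
    \<open>(2 / r) powr q\<close>.\<close>
  define K where "K = (2 / r) powr q * (c * (2 * real n))"
  have "I x \<le> ennreal K" if x: "norm x \<le> 1" for x
  proof -
    define y where "y = (r / 2) *\<^sub>R x"
    have "norm y \<le> r / 2 * 1"
      unfolding y_def norm_scaleR using x r by (intro mult_mono) auto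
    then have "norm y < r" using r by linarith
    then have mem: "x0 + y \<in> F n" "x0 \<in> F n"
      using r by (auto simp: dist_norm subset_iff)
    have "I x = I ((2 / r) *\<^sub>R y)"
      using r by (simp add: y_def)
    also have "\<dots> = (\<integral>\<^sup>+t. ennreal ((2 / r) powr q) * u y t \<partial>M)"
      unfolding I_def using r by (intro nn_integral_cong hom) auto
    also have "\<dots> = ennreal ((2 / r) powr q) * I y"
      unfolding I_def by (rule nn_integral_cmult[OF meas])
    also have "I y = I ((x0 + y) - x0)" by simp
    also have "\<dots> \<le> (\<integral>\<^sup>+t. ennreal c * (u (x0 + y) t + u x0 t) \<partial>M)"
      unfolding I_def by (intro nn_integral_mono diff)
    also have "\<dots> = ennreal c * (I (x0 + y) + I x0)"
      unfolding I_def using meas by (simp add: nn_integral_cmult nn_integral_add)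
    also have "\<dots> \<le> ennreal c * (ennreal (real n) + ennreal (real n))"
      using mem by (intro mult_left_mono add_mono) (auto simp: F_def)
    also have "\<dots> = ennreal (c * (2 * real n))"
      using c by (simp add: ennreal_mult flip: ennreal_plus)
    also have "ennreal ((2 / r) powr q) * \<dots> = ennreal K"
      using c by (simp add: K_def ennreal_mult)
    finally show ?thesis by (simp add: mult_left_mono)
  qed
  then show ?thesis
    unfolding I_def using c by (intro exI[of _ K]) (simp add: K_def)
qed

text \<open>Young's inequality after normalisation by \<alpha> and \<beta>; if one of these is 0,
  the integrand vanishes almost everywhere. Majorants of the two integrals take the place of their
  values, as this is what the application supplies.\<close>

lemma nn_integral_Holder:
  fixes a b :: "'t \<Rightarrow> real" and p q \<alpha> \<beta> :: real
  assumes pq: "1 < p" "1 < q" "1 / p + 1 / q = 1"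
    and [measurable]: "a \<in> borel_measurable M" "b \<in> borel_measurable M"
    and nn: "\<And>t. 0 \<le> a t" "\<And>t. 0 \<le> b t" "0 \<le> \<alpha>" "0 \<le> \<beta>"
    and a: "(\<integral>\<^sup>+t. ennreal (a t powr p) \<partial>M) \<le> ennreal \<alpha>"
    and b: "(\<integral>\<^sup>+t. ennreal (b t powr q) \<partial>M) \<le> ennreal \<beta>"
  shows "(\<integral>\<^sup>+t. ennreal (a t * b t) \<partial>M) \<le> ennreal (\<alpha> powr (1 / p) * \<beta> powr (1 / q))"
proof (cases "\<alpha> = 0 \<or> \<beta> = 0")
  case True
  have z: "AE t in M. f t = 0" if [measurable]: "f \<in> borel_measurable M" and "0 < r"
      "(\<integral>\<^sup>+t. ennreal (f t powr r) \<partial>M) \<le> ennreal 0" "\<And>t. 0 \<le> f t" for f :: "'t \<Rightarrow> real" and r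
  proof -
    have "(\<integral>\<^sup>+t. ennreal (f t powr r) \<partial>M) = 0"
      using that(3) by simp
    then have "AE t in M. ennreal (f t powr r) = 0"
      by (subst (asm) nn_integral_0_iff_AE) measurable
    then show ?thesis
      by eventually_elim (simp add: ennreal_eq_0_iff)
  qed
  have "AE t in M. ennreal (a t * b t) = 0"
    using True
  proof
    assume "\<alpha> = 0"
    then have "AE t in M. a t = 0" using z[of a p] a nn pq by auto
    then show ?thesis by eventually_elim simp
  next
    assume "\<beta> = 0"
    then have "AE t in M. b t = 0" using z[of b q] b nn pq by auto
    then show ?thesis by eventually_elim simp
  qed
  then have "(\<integral>\<^sup>+t. ennreal (a t * b t) \<partial>M) = 0"
    by (subst nn_integral_0_iff_AE) measurable
  then show ?thesis by simp
next
  case False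
  then have pos: "\<alpha> > 0" "\<beta> > 0" using nn by auto
  define C where "C = \<alpha> powr (1 / p) * \<beta> powr (1 / q)"
  have C: "C > 0" using pos by (simp add: C_def)
  have pt: "a t * b t \<le> (C / (p * \<alpha>)) * a t powr p + (C / (q * \<beta>)) * b t powr q" for t
  proof -
    have "(a t / \<alpha> powr (1 / p)) * (b t / \<beta> powr (1 / q))
        \<le> (a t / \<alpha> powr (1 / p)) powr p / p + (b t / \<beta> powr (1 / q)) powr q / q"
      using pq nn by (intro Youngs_inequality) auto
    also have "\<dots> = a t powr p / (p * \<alpha>) + b t powr q / (q * \<beta>)"
      using pq nn pos by (simp add: powr_divide powr_powr mult.commute)
    finally have "C * ((a t / \<alpha> powr (1 / p)) * (b t / \<beta> powr (1 / q)))
        \<le> C * (a t powr p / (p * \<alpha>) + b t powr q / (q * \<beta>))"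
      using C by (intro mult_left_mono) auto
    moreover have "C * ((a t / \<alpha> powr (1 / p)) * (b t / \<beta> powr (1 / q))) = a t * b t"
      using pos by (simp add: C_def)
    ultimately show ?thesis by (simp add: algebra_simps)
  qed
  have "(\<integral>\<^sup>+t. ennreal (a t * b t) \<partial>M)
      \<le> (\<integral>\<^sup>+t. ennreal (C / (p * \<alpha>)) * ennreal (a t powr p) + ennreal (C / (q * \<beta>)) * ennreal (b t powr q) \<partial>M)"
  proof (intro nn_integral_mono)
    fix t
    have "ennreal (a t * b t) \<le> ennreal ((C / (p * \<alpha>)) * a t powr p + (C / (q * \<beta>)) * b t powr q)"
      by (rule ennreal_leI[OF pt])
    also have "\<dots> = ennreal (C / (p * \<alpha>)) * ennreal (a t powr p) + ennreal (C / (q * \<beta>)) * ennreal (b t powr q)"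
    proof -
      have "0 \<le> C / (p * \<alpha>)" "0 \<le> C / (q * \<beta>)"
        using C pos pq by simp_all
      then show ?thesis
        by (simp only: ennreal_plus ennreal_mult mult_nonneg_nonneg powr_ge_zero)
    qed
    finally show "ennreal (a t * b t) \<le> ennreal (C / (p * \<alpha>)) * ennreal (a t powr p)
        + ennreal (C / (q * \<beta>)) * ennreal (b t powr q)" .
  qed
  also have "\<dots> = ennreal (C / (p * \<alpha>)) * (\<integral>\<^sup>+t. ennreal (a t powr p) \<partial>M)
      + ennreal (C / (q * \<beta>)) * (\<integral>\<^sup>+t. ennreal (b t powr q) \<partial>M)"
    by (simp add: nn_integral_add nn_integral_cmult)
  also have "\<dots> \<le> ennreal (C / (p * \<alpha>)) * ennreal \<alpha> + ennreal (C / (q * \<beta>)) * ennreal \<beta>"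
    by (intro add_mono mult_left_mono a b) auto
  also have "\<dots> = ennreal (C * (1 / p + 1 / q))"
    using C pos pq by (simp add: field_simps flip: ennreal_mult ennreal_plus)
  also have "\<dots> = ennreal C" using pq by simp
  finally show ?thesis unfolding C_def .
qed

text \<open>By scaling, a bound on the unit balls makes the integrated form bounded, hence the form
  of an operator. The weight \<theta> will be constant, a phase or an indicator function.\<close>

lemma weak_integral_exists:
  fixes C :: "'t \<Rightarrow> 'h::complex_hilbert \<Rightarrow>\<^sub>L 'h" and \<theta> :: "'t \<Rightarrow> complex"
  assumes C: "\<And>t. t \<in> space M \<Longrightarrow> C t \<in> bop"
    and int: "\<And>x y. integrable M (\<lambda>t. \<theta> t * cinner (C t x) y)"
    and bd: "\<And>x y. norm x \<le> 1 \<Longrightarrow> norm y \<le> 1 \<Longrightarrow> cmod (LINT t|M. \<theta> t * cinner (C t x) y) \<le> K"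
    and "0 \<le> K"
  obtains Z where "Z \<in> bop" "\<And>x y. cinner (Z x) y = (LINT t|M. \<theta> t * cinner (C t x) y)"
proof -
  define s where "s x y = (LINT t|M. \<theta> t * cinner (C t x) y)" for x y
  have addl: "s (x + y) z = s x z + s y z" for x y z
    unfolding s_def Bochner_Integration.integral_add[OF int int, symmetric]
    by (rule Bochner_Integration.integral_cong) (simp_all add: blinfun.add_right cinner_simps distrib_left)
  have addr: "s z (x + y) = s z x + s z y" for x y z
    unfolding s_def Bochner_Integration.integral_add[OF int int, symmetric]
    by (rule Bochner_Integration.integral_cong) (simp_all add: cinner_simps distrib_left)
  have scl: "s (c *\<^sub>C x) z = c * s x z" for c x z
    unfolding s_def integral_mult_right_zero[symmetric]
    by (rule Bochner_Integration.integral_cong) (simp_all add: bop_scaleC[OF C] cinner_simps)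
  have scr: "s z (c *\<^sub>C x) = cnj c * s z x" for c x z
    unfolding s_def integral_mult_right_zero[symmetric]
    by (rule Bochner_Integration.integral_cong) (simp_all add: cinner_simps)
  have z: "s 0 y = 0" "s x 0 = 0" for x y
    using scl[of 0 0 y] scr[of x 0 0] by simp_all
  have bound: "cmod (s x y) \<le> K * norm x * norm y" for x y
  proof (cases "x = 0 \<or> y = 0")
    case True
    then show ?thesis using z by auto
  next
    case False
    define x' where "x' = (1 / norm x) *\<^sub>R x"
    define y' where "y' = (1 / norm y) *\<^sub>R y"
    have xy: "x = of_real (norm x) *\<^sub>C x'" "y = of_real (norm y) *\<^sub>C y'" "norm x' \<le> 1" "norm y' \<le> 1"
      using False by (simp_all add: x'_def y'_def flip: scaleR_scaleC)
    have "s x y = of_real (norm x) * (of_real (norm y) * s x' y')"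
      by (subst xy(1), subst xy(2)) (simp add: scl scr)
    then have "cmod (s x y) = norm x * (norm y * cmod (s x' y'))"
      by (simp add: norm_mult)
    also have "\<dots> \<le> norm x * (norm y * K)"
      using bd[OF xy(3,4)] by (intro mult_left_mono) (auto simp: s_def)
    finally show ?thesis by (simp add: mult_ac)
  qed
  obtain S where "S \<in> bop" "\<And>x y. s x y = cinner (S x) y" "norm S \<le> K"
    by (rule sesquilinear_operator[of s K]) (use addl addr scl scr bound \<open>0 \<le> K\<close> in auto)
  then show ?thesis
    using that[of S] by (simp add: s_def)
qed

text \<open>Positivity at x - \<omega> y, where \<omega> is the phase of the entry. The arithmetic
  mean, unlike the geometric mean of Cauchy-Schwarz, is linear in \<open>S\<close> and can be
  integrated directly.\<close>

lemma pos_op_cinner_bound: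
  assumes "pos_op S"
  shows "cmod (cinner (S x) y) \<le> (Re (cinner (S x) x) + Re (cinner (S y) y)) / 2"
proof -
  define \<omega> where "\<omega> = sgn (cinner (S x) y)"
  have sa: "selfadj S" using assms by (simp add: pos_op_def)
  have cyx: "cinner (S y) x = cnj (cinner (S x) y)"
    using selfadjD[OF sa, of y x] cinner_commute[of y "S x"] by simp
  have om: "cnj \<omega> * cinner (S x) y = of_real (cmod (cinner (S x) y))"
    by (simp add: \<omega>_def sgn_div_norm scaleR_conv_of_real complex_norm_square[symmetric] power2_eq_square
        mult.commute field_simps)
  have om1: "cmod \<omega> \<le> 1" by (simp add: \<omega>_def norm_sgn)
  have "0 \<le> Re (cinner (S (x - \<omega> *\<^sub>C y)) (x - \<omega> *\<^sub>C y))"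
    by (rule pos_opD[OF assms])
  also have "cinner (S (x - \<omega> *\<^sub>C y)) (x - \<omega> *\<^sub>C y)
      = cinner (S x) x - cnj \<omega> * cinner (S x) y - cnj (cnj \<omega> * cinner (S x) y) + of_real ((cmod \<omega>)\<^sup>2) * cinner (S y) y"
    unfolding complex_norm_square
    by (simp add: blinfun.diff_right bop_scaleC[OF selfadj_bop[OF sa]] cinner_simps cyx algebra_simps)
  also have "Re \<dots> = Re (cinner (S x) x) - 2 * cmod (cinner (S x) y) + (cmod \<omega>)\<^sup>2 * Re (cinner (S y) y)"
    by (simp add: om del: of_real_power)
  also have "(cmod \<omega>)\<^sup>2 * Re (cinner (S y) y) \<le> 1 * Re (cinner (S y) y)"
    using om1 pos_opD[OF assms] by (intro mult_right_mono) (auto simp: power_le_one)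
  finally show ?thesis by simp
qed

text \<open>Gives meaning to the definite description in \<open>wstar_integral\<close> for positive
  integrands. Finiteness is given for each single vector; the bound on the unit ball comes from
  \<open>integral_uniformly_bounded\<close>.\<close>

lemma wstar_integral_pos:
  fixes S :: "'t \<Rightarrow> 'h::complex_hilbert \<Rightarrow>\<^sub>L 'h"
  assumes int: "wstar_integrable M S" and pos: "\<And>t. t \<in> space M \<Longrightarrow> pos_op (S t)"
  defines "T \<equiv> wstar_integral M (space M) S"
  shows "pos_op T" "\<And>x y. cinner (T x) y = (LINT t|M. cinner (S t x) y)"
    "\<And>x. (\<integral>\<^sup>+t. ennreal (Re (cinner (S t x) x)) \<partial>M) = ennreal (Re (cinner (T x) x))"
proof -
  note I = wstar_integrable_cinner[OF int]
  have IR: "integrable M (\<lambda>t. Re (cinner (S t x) x))" for x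
    using I by simp
  have eq: "(\<integral>\<^sup>+t. ennreal (Re (cinner (S t x) x)) \<partial>M) = ennreal (LINT t|M. Re (cinner (S t x) x))" for x
    by (rule nn_integral_eq_integral[OF IR]) (use pos pos_opD in auto)
  define u where "u x t = ennreal (Re (cinner (S t x) x))" for x t
  have "\<exists>K\<ge>0. \<forall>x. norm x \<le> 1 \<longrightarrow> (\<integral>\<^sup>+t. u x t \<partial>M) \<le> ennreal K"
  \<comment> \<open>The constant 2 is that of the parallelogram identity for the positive form, with
    the value at \<open>x + y\<close> dropped; the exponent 2 is the homogeneity of the
    form.\<close>
  proof (rule integral_uniformly_bounded[where c = 2 and q = 2])
    show "u x \<in> borel_measurable M" for x
      unfolding u_def using IR by measurable
    show "(\<lambda>n. u (X n) t) \<longlonglongrightarrow> u x t" if "X \<longlonglongrightarrow> x" for X x t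
      unfolding u_def by (intro tendsto_ennrealI tendsto_Re tendsto_cinner blinfun.tendsto tendsto_const that)
    show "(\<integral>\<^sup>+t. u x t \<partial>M) < \<infinity>" for x
      unfolding u_def eq by simp
    show "u (r *\<^sub>R x) t = ennreal (r powr 2) * u x t" if "0 < r" for r x t
      using that by (simp add: u_def blinfun.scaleR_right cinner_simps power2_eq_square mult.assoc
          ennreal_mult' flip: ennreal_mult')
    fix x y t assume t: "t \<in> space M"
    have "0 \<le> Re (cinner (S t (x + y)) (x + y))"
      by (rule pos_opD[OF pos[OF t]])
    then have "Re (cinner (S t (x - y)) (x - y)) \<le> 2 * (Re (cinner (S t x) x) + Re (cinner (S t y) y))"
      by (simp add: blinfun.diff_right blinfun.add_right cinner_simps)
    from ennreal_leI[OF this] show "u (x - y) t \<le> ennreal 2 * (u x t + u y t)"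
      unfolding u_def
      by (simp only: ennreal_plus ennreal_mult add_nonneg_nonneg pos_opD[OF pos[OF t]] zero_le_numeral)
  qed simp
  then obtain K where K: "K \<ge> 0" "\<And>x. norm x \<le> 1 \<Longrightarrow> (LINT t|M. Re (cinner (S t x) x)) \<le> K"
    unfolding u_def eq by auto
  obtain Z where Z: "Z \<in> bop" "\<And>x y. cinner (Z x) y = (LINT t|M. 1 * cinner (S t x) y)"
  proof (rule weak_integral_exists[of M S "\<lambda>_. 1" K])
    show "S t \<in> bop" if "t \<in> space M" for t
      using pos_op_bop[OF pos[OF that]] .
    show "integrable M (\<lambda>t. 1 * cinner (S t x) y)" for x y
      using I by simp
    show "cmod (LINT t|M. 1 * cinner (S t x) y) \<le> K" if "norm x \<le> 1" "norm y \<le> 1" for x y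
    proof -
      have "cmod (LINT t|M. cinner (S t x) y) \<le> (LINT t|M. cmod (cinner (S t x) y))"
        by (rule integral_norm_bound)
      also have "\<dots> \<le> (LINT t|M. (Re (cinner (S t x) x) + Re (cinner (S t y) y)) / 2)"
        using I IR pos_op_cinner_bound[OF pos] by (intro integral_mono) auto
      also have "\<dots> = ((LINT t|M. Re (cinner (S t x) x)) + (LINT t|M. Re (cinner (S t y) y))) / 2"
        using IR by simp
      also have "\<dots> \<le> K"
        using K(2)[OF that(1)] K(2)[OF that(2)] by simp
      finally show ?thesis by simp
    qed
  qed (use K in auto)
  have "T = Z"
    unfolding T_def wstar_integral_def
  proof (rule the_equality)
    have sp: "(LINT t:space M|M. cinner (S t f) g) = (LINT t|M. cinner (S t f) g)" for f g
      by (rule set_integral_space[OF I])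
    show "Z \<in> bop \<and> (\<forall>f g. cinner (Z f) g = (LINT t:space M|M. cinner (S t f) g))"
      using Z by (simp add: sp)
    show "T = Z" if "T \<in> bop \<and> (\<forall>f g. cinner (T f) g = (LINT t:space M|M. cinner (S t f) g))" for T
      using that Z by (intro blinfun_eqI cinner_eqI) (simp add: sp)
  qed
  then show TI: "cinner (T x) y = (LINT t|M. cinner (S t x) y)" for x y
    using Z by simp
  have Re: "Re (cinner (T x) x) = (LINT t|M. Re (cinner (S t x) x))" for x
    unfolding TI using integral_Re[OF I] by simp
  show "(\<integral>\<^sup>+t. ennreal (Re (cinner (S t x) x)) \<partial>M) = ennreal (Re (cinner (T x) x))" for x
    unfolding eq Re ..
  show "pos_op T"
    unfolding pos_op_def selfadj_def
  proof (intro conjI allI)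
    fix x y
    have "cinner x (T y) = cnj (LINT t|M. cinner (S t y) x)"
      by (subst cinner_commute) (simp add: TI)
    also have "\<dots> = (LINT t|M. cnj (cinner (S t y) x))"
      by simp
    also have "\<dots> = (LINT t|M. cinner (S t x) y)"
    proof (rule Bochner_Integration.integral_cong[OF refl])
      fix t assume "t \<in> space M"
      then have "selfadj (S t)" using pos by (simp add: pos_op_def)
      then show "cnj (cinner (S t y) x) = cinner (S t x) y"
        using selfadjD[of "S t" x y] cinner_commute[of x "S t y"] by simp
    qed
    finally show "cinner (T x) y = cinner x (T y)" by (simp add: TI)
    show "0 \<le> Re (cinner (T x) x)"
      unfolding Re by (rule integral_nonneg_AE) (use pos pos_opD in auto)
  qed
qed

section \<open>Pettis integrability\<close>

lemma sn_ideal0_compose_right: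
  assumes sn: "sn_function \<Phi>" and A: "A \<in> sn_ideal0 \<Phi>" and D: "D \<in> bop" "norm D \<le> 1"
  shows "A o\<^sub>L D \<in> sn_ideal0 \<Phi>"
  unfolding sn_ideal0_iff[OF sn]
proof (intro conjI allI impI)
  show "A o\<^sub>L D \<in> bop" using A D by (simp add: sn_ideal0_bop[OF sn] bop_compose)
  fix e :: real assume "e > 0"
  then obtain F where F: "finite_rank F" "gnorm \<Phi> (A - F) < ennreal e"
    using A unfolding sn_ideal0_iff[OF sn] by meson
  have "(A o\<^sub>L D) - (F o\<^sub>L D) = (A - F) o\<^sub>L D"
    by (auto intro!: blinfun_eqI simp: blinfun.diff_left)
  then have "gnorm \<Phi> ((A o\<^sub>L D) - (F o\<^sub>L D)) < ennreal e"
    using gnorm_compose_right[OF sn D, of "A - F"] F(2) by simp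
  then show "\<exists>F. finite_rank F \<and> gnorm \<Phi> ((A o\<^sub>L D) - F) < ennreal e"
    using finite_rank_compose_right[OF F(1) D(1)] by blast
qed

lemma gnorm_conjugate_le:
  assumes sn: "sn_function \<Phi>" and D: "D \<in> bop" "norm D \<le> 1"
  shows "gnorm \<Phi> (adj D o\<^sub>L (T o\<^sub>L D)) \<le> gnorm \<Phi> (T o\<^sub>L D)"
proof -
  have "gnorm \<Phi> (adj D o\<^sub>L (T o\<^sub>L D)) \<le> ennreal (norm (adj D)) * gnorm \<Phi> (T o\<^sub>L D)"
    by (rule gnorm_compose_left[OF sn adj_bop[OF D(1)]])
  also have "\<dots> \<le> ennreal 1 * gnorm \<Phi> (T o\<^sub>L D)"
    using norm_adj_le[OF D(1)] D(2) by (intro mult_right_mono ennreal_leI) auto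
  finally show ?thesis by simp
qed

lemma blinfun_compose_id_right: "A o\<^sub>L id_blinfun = A"
  by (rule blinfun_eqI) simp

lemma compose_proj_eq: "W \<in> bop \<Longrightarrow> W o\<^sub>L proj G = (\<Sum>g\<in>G. rank1 (W g) g)"
  by (rule blinfun_eqI)
    (simp add: proj_apply blinfun.sum_left blinfun.sum_right rank1.rep_eq bop_scaleC)

lemma norm_proj_blinfun_le: "orthonormal G \<Longrightarrow> norm (proj G) \<le> 1"
  by (rule norm_blinfun_bound) (simp_all add: norm_proj_le)

text \<open>Abstract setting of the main argument: \<open>C t\<close> will be the product of the
  adjoint of \<open>A t\<close> with \<open>B t\<close>, \<open>T\<close> the weak integral of the
  p-th powers, and \<open>K\<close> the norm of \<open>A\<close>. The two given functions enter
  through \<open>bd\<close>, the measurability of the entries and the membership of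
  \<open>C t\<close> in the ideal.\<close>

context
  fixes M :: "'t measure" and \<Phi> \<Psi> :: "(nat \<Rightarrow> complex) \<Rightarrow> real" and p K :: real
    and C :: "'t \<Rightarrow> 'h::complex_hilbert \<Rightarrow>\<^sub>L 'h" and T :: "'h \<Rightarrow>\<^sub>L 'h" and G :: "nat \<Rightarrow> 'h set"
  assumes cm: "complete_measure M" and sn: "sn_function \<Phi>" and p: "1 \<le> p" and K: "0 \<le> K"
    and Psi: "\<Psi> = p_mod \<Phi> p"
    and G: "\<And>n. orthonormal (G n)" "\<And>x. (\<lambda>n. proj (G n) x) \<longlonglongrightarrow> x"
    and C: "\<And>t. t \<in> space M \<Longrightarrow> C t \<in> sn_ideal0 \<Psi>"
    and meas: "\<And>x y. mu_measurable M (\<lambda>t. cinner (C t x) y)"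
    and T: "pos_op T" "T \<in> sn_ideal0 \<Phi>"
    and bd: "\<And>x y. norm x \<le> 1 \<Longrightarrow> norm y \<le> 1 \<Longrightarrow>
      (\<integral>\<^sup>+t. ennreal (cmod (cinner (C t x) y)) \<partial>M) \<le> ennreal (K * Re (cinner (T x) x) powr (1 / p))"
begin

lemma sn_Psi: "sn_function \<Psi>"
  unfolding Psi by (rule sn_function_p_mod[OF sn p])

lemma C_bop: "t \<in> space M \<Longrightarrow> C t \<in> bop"
  using C sn_ideal0_bop[OF sn_Psi] by blast

lemma borel_C: "(\<lambda>t. cinner (C t x) y) \<in> borel_measurable M"
  by (rule mu_measurable_borel[OF cm meas])

lemma integrable_C: "integrable M (\<lambda>t. cinner (C t x) y)"
proof -
  \<comment> \<open>Dividing by \<open>norm x + 1\<close> covers the zero vector as well.\<close>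
  define x' where "x' = (1 / (norm x + 1)) *\<^sub>R x"
  define y' where "y' = (1 / (norm y + 1)) *\<^sub>R y"
  have n: "norm x + 1 > 0" "norm y + 1 > 0" by (simp_all add: add_nonneg_pos)
  have xy: "x = (norm x + 1) *\<^sub>R x'" "y = (norm y + 1) *\<^sub>R y'" "norm x' \<le> 1" "norm y' \<le> 1"
    using n by (simp_all add: x'_def y'_def field_simps)
  have "integrable M (\<lambda>t. cinner (C t x') y')"
  proof (rule integrableI_bounded[OF borel_C])
    show "(\<integral>\<^sup>+t. ennreal (cmod (cinner (C t x') y')) \<partial>M) < \<infinity>"
      using bd[OF xy(3,4)] by (rule le_less_trans) simp
  qed
  then have "integrable M (\<lambda>t. of_real (norm x + 1) * (of_real (norm y + 1) * cinner (C t x') y'))"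
    by (intro integrable_mult_right)
  moreover have "cinner (C t x) y = of_real (norm x + 1) * (of_real (norm y + 1) * cinner (C t x') y')" for t
    by (subst xy(1), subst xy(2))
      (simp only: blinfun.scaleR_right cinner_scaleR_left cinner_scaleR_right mult_ac)
  ultimately show ?thesis by simp
qed

lemma weighted_integral:
  fixes \<theta> :: "'t \<Rightarrow> complex"
  assumes th: "\<theta> \<in> borel_measurable M" "\<And>t. cmod (\<theta> t) \<le> 1"
  shows "integrable M (\<lambda>t. \<theta> t * cinner (C t x) y)"
    and "norm x \<le> 1 \<Longrightarrow> norm y \<le> 1 \<Longrightarrow>
      cmod (LINT t|M. \<theta> t * cinner (C t x) y) \<le> K * Re (cinner (T x) x) powr (1 / p)"
proof -
  show int: "integrable M (\<lambda>t. \<theta> t * cinner (C t x) y)"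
    by (rule Bochner_Integration.integrable_bound[OF integrable_C[of x y]])
      (use th borel_C in \<open>auto simp: norm_mult intro!: AE_I2 mult_left_le_one_le\<close>)
  assume xy: "norm x \<le> 1" "norm y \<le> 1"
  have "ennreal (cmod (LINT t|M. \<theta> t * cinner (C t x) y)) \<le> (\<integral>\<^sup>+t. ennreal (cmod (\<theta> t * cinner (C t x) y)) \<partial>M)"
    by (rule integral_norm_bound_ennreal[OF int])
  also have "\<dots> \<le> (\<integral>\<^sup>+t. ennreal (cmod (cinner (C t x) y)) \<partial>M)"
    using th(2) by (intro nn_integral_mono ennreal_leI) (auto simp: norm_mult intro!: mult_left_le_one_le)
  also have "\<dots> \<le> ennreal (K * Re (cinner (T x) x) powr (1 / p))"
    by (rule bd[OF xy])
  finally show "cmod (LINT t|M. \<theta> t * cinner (C t x) y) \<le> K * Re (cinner (T x) x) powr (1 / p)"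
    using K by (subst (asm) ennreal_le_iff) auto
qed

text \<open>The clause on \<open>D\<close> is the working tool: the identity gives the norm bound,
  and \<open>D = id_blinfun - proj (G n)\<close> makes tails small, because
  \<open>Z o\<^sub>L D\<close> is controlled by the compression of \<open>T\<close> by
  \<open>D\<close> just as \<open>Z\<close> is by \<open>T\<close>.\<close>

lemma weighted_operator:
  fixes \<theta> :: "'t \<Rightarrow> complex"
  assumes th: "\<theta> \<in> borel_measurable M" "\<And>t. cmod (\<theta> t) \<le> 1"
  obtains Z where "Z \<in> bop" "\<And>x y. cinner (Z x) y = (LINT t|M. \<theta> t * cinner (C t x) y)"
    "\<And>D \<tau>. D \<in> bop \<Longrightarrow> norm D \<le> 1 \<Longrightarrow> 0 \<le> \<tau> \<Longrightarrow> gnorm \<Phi> (adj D o\<^sub>L (T o\<^sub>L D)) \<le> ennreal \<tau> \<Longrightarrow>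
      gnorm \<Psi> (Z o\<^sub>L D) \<le> ennreal (K * \<tau> powr (1 / p))"
proof -
  have Tle: "Re (cinner (T x) x) \<le> norm T" if "norm x \<le> 1" for x
  proof -
    have "Re (cinner (T x) x) \<le> norm (T x) * norm x"
      using complex_Re_le_cmod cmod_cinner_le order_trans by blast
    also have "\<dots> \<le> (norm T * norm x) * norm x"
      by (intro mult_right_mono norm_blinfun) simp
    also have "\<dots> \<le> (norm T * 1) * 1"
      using that by (intro mult_mono) auto
    finally show ?thesis by simp
  qed
  obtain Z where Z: "Z \<in> bop" "\<And>x y. cinner (Z x) y = (LINT t|M. \<theta> t * cinner (C t x) y)"
  proof (rule weak_integral_exists[of M C \<theta> "K * norm T powr (1 / p)"])
    show "cmod (LINT t|M. \<theta> t * cinner (C t x) y) \<le> K * norm T powr (1 / p)"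
      if "norm x \<le> 1" "norm y \<le> 1" for x y
    proof -
      have "K * Re (cinner (T x) x) powr (1 / p) \<le> K * norm T powr (1 / p)"
        using K p Tle[OF that(1)] pos_opD[OF T(1)] by (intro mult_left_mono powr_mono2) auto
      then show ?thesis
        using weighted_integral(2)[OF th that] by linarith
    qed
  qed (use C_bop weighted_integral(1)[OF th] K in auto)
  have "gnorm \<Psi> (Z o\<^sub>L D) \<le> ennreal (K * \<tau> powr (1 / p))"
    if D: "D \<in> bop" "norm D \<le> 1" and \<tau>: "0 \<le> \<tau>" "gnorm \<Phi> (adj D o\<^sub>L (T o\<^sub>L D)) \<le> ennreal \<tau>" for D \<tau>
    unfolding Psi
  proof (rule gnorm_p_mod_le[OF sn p K \<tau>])
    have eq: "cinner ((adj D o\<^sub>L (T o\<^sub>L D)) e) e = cinner (T (D e)) (D e)" for e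
      by (simp add: cinner_adj_left[OF D(1)])
    show "0 \<le> Re (cinner ((adj D o\<^sub>L (T o\<^sub>L D)) e) e)" for e
      unfolding eq by (rule pos_opD[OF T(1)])
    fix e f :: 'h assume ef: "norm e \<le> 1" "norm f \<le> 1"
    have "norm (D e) \<le> norm D * norm e" by (rule norm_blinfun)
    also have "\<dots> \<le> 1 * 1" using D(2) ef(1) by (intro mult_mono) auto
    finally have "norm (D e) \<le> 1" by simp
    then show "cmod (cinner ((Z o\<^sub>L D) e) f) \<le> K * Re (cinner ((adj D o\<^sub>L (T o\<^sub>L D)) e) e) powr (1 / p)"
      unfolding eq using weighted_integral(2)[OF th _ ef(2)] by (simp add: Z(2))
  qed
  then show ?thesis
    using that Z by blast
qed

text \<open>The bound \<open>c\<close> of \<open>h\<close> stays a parameter: integrability uses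
  whatever nonnegative constant is at hand, the norm estimate uses 1.\<close>

context
  fixes h :: "('h \<Rightarrow>\<^sub>L 'h) \<Rightarrow> complex" and c :: real
  assumes h: "h \<in> dual_space (sn_ideal0 \<Psi>) (sn_norm \<Psi>)" and c: "0 \<le> c"
    and hc: "\<forall>u\<in>sn_ideal0 \<Psi>. cmod (h u) \<le> c * sn_norm \<Psi> u"
begin

lemma h_add: "u \<in> sn_ideal0 \<Psi> \<Longrightarrow> v \<in> sn_ideal0 \<Psi> \<Longrightarrow> h (u + v) = h u + h v"
  and h_scale: "u \<in> sn_ideal0 \<Psi> \<Longrightarrow> h (a *\<^sub>C u) = a * h u"
  using h by (auto simp: dual_space_def)

lemma rank1_ideal: "rank1 u v \<in> sn_ideal0 \<Psi>"
  using finite_rank_sn_ideal0[OF sn_Psi finite_rank_sum_rank1[of "{()}" "\<lambda>_. u" "\<lambda>_. v"]] by simp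

lemma h_zero: "h 0 = 0"
  using h_scale[OF rank1_ideal, of 0 0 0] by simp

lemma sum_ideal0: "(\<And>i. i \<in> I \<Longrightarrow> f i \<in> sn_ideal0 \<Psi>) \<Longrightarrow> (\<Sum>i\<in>I. f i) \<in> sn_ideal0 \<Psi>"
proof (induction I rule: infinite_finite_induct)
  case (insert i I)
  then show ?case by (simp add: sn_ideal0_add[OF sn_Psi])
qed (use sn_ideal0_scale[OF sn_Psi rank1_ideal, of 0 0 0] in simp_all)

lemma h_sum: "(\<And>i. i \<in> I \<Longrightarrow> f i \<in> sn_ideal0 \<Psi>) \<Longrightarrow> h (\<Sum>i\<in>I. f i) = (\<Sum>i\<in>I. h (f i))"
proof (induction I rule: infinite_finite_induct)
  case (insert i I)
  then show ?case by (simp add: h_add sum_ideal0)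
qed (simp_all add: h_zero)

lemma h_bound:
  assumes "u \<in> sn_ideal0 \<Psi>" "gnorm \<Psi> u \<le> ennreal r" "0 \<le> r"
  shows "cmod (h u) \<le> c * r"
proof -
  have "sn_norm \<Psi> u \<le> r"
    using sn_norm_ideal0[OF sn_Psi assms(1)] assms(2,3) by (metis ennreal_le_iff)
  then show ?thesis
    using bspec[OF hc assms(1)] c by (meson mult_left_mono order_trans)
qed

text \<open>Riesz representation in \<open>u\<close>. On finite-rank operators \<open>h\<close> thus
  becomes a finite sum of matrix entries, the only explicit information about it.\<close>

lemma h_rank1:
  obtains w where "\<And>u g. h (rank1 u g) = cinner u (w g)"
proof -
  have "\<exists>w. \<forall>u. h (rank1 u g) = cinner u w" for g
  proof -
    obtain w where "\<And>u. h (rank1 u g) = cinner u w"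
    proof (rule riesz_representation[of "\<lambda>u. h (rank1 u g)" "c * norm g"])
      fix u v :: 'h and a :: complex
      have "rank1 (u + v) g = rank1 u g + rank1 v g"
        by (rule blinfun_eqI) (simp add: rank1.rep_eq blinfun.add_left scaleC_add_right)
      then show "h (rank1 (u + v) g) = h (rank1 u g) + h (rank1 v g)"
        by (simp add: h_add rank1_ideal)
      have "rank1 (a *\<^sub>C u) g = a *\<^sub>C rank1 u g"
        by (rule blinfun_eqI) (simp add: rank1.rep_eq scaleC_blinfun_apply scaleC_scaleC mult.commute)
      then show "h (rank1 (a *\<^sub>C u) g) = a * h (rank1 u g)"
        by (simp add: h_scale rank1_ideal)
      show "cmod (h (rank1 u g)) \<le> c * norm g * norm u"
        using h_bound[OF rank1_ideal gnorm_rank1_le[OF sn_Psi], of u g] by (simp add: mult_ac)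
    qed blast
    then show ?thesis by blast
  qed
  then show ?thesis using that by metis
qed

text \<open>Truncations converge in the ideal norm, for which \<open>h\<close> is continuous.
  Measurability and the integral bound for \<open>h (C t)\<close> are obtained through this
  limit.\<close>

lemma h_tendsto:
  assumes A: "A \<in> sn_ideal0 \<Psi>"
  shows "(\<lambda>n. h (A o\<^sub>L proj (G n))) \<longlonglongrightarrow> h A"
  unfolding LIMSEQ_def
proof (intro allI impI)
  fix r :: real assume r: "r > 0"
  define e where "e = r / (c + 1)"
  have e: "e > 0" using r c by (simp add: e_def)
  obtain N where N: "\<And>n. n \<ge> N \<Longrightarrow> gnorm \<Psi> (A o\<^sub>L (id_blinfun - proj (G n))) \<le> ennreal e"
    using gnorm_diff_proj_small[OF sn_Psi A G e] by blast
  have "dist (h (A o\<^sub>L proj (G n))) (h A) < r" if "n \<ge> N" for n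
  proof -
    define Q where "Q = id_blinfun - proj (G n)"
    have Q: "Q \<in> bop" "norm Q \<le> 1"
      unfolding Q_def by (intro bop_diff bop_id proj_bop, rule norm_id_minus_proj_le[OF G(1)])
    have AQ: "A o\<^sub>L Q \<in> sn_ideal0 \<Psi>"
      by (rule sn_ideal0_compose_right[OF sn_Psi A Q])
    have AP: "A o\<^sub>L proj (G n) \<in> sn_ideal0 \<Psi>"
      by (rule sn_ideal0_compose_right[OF sn_Psi A proj_bop norm_proj_blinfun_le[OF G(1)]])
    have "A = (A o\<^sub>L proj (G n)) + (A o\<^sub>L Q)"
      by (auto intro!: blinfun_eqI simp: Q_def blinfun.add_left blinfun.diff_left blinfun.diff_right)
    then have "h A = h (A o\<^sub>L proj (G n)) + h (A o\<^sub>L Q)"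
      using h_add[OF AP AQ] by simp
    then have "dist (h (A o\<^sub>L proj (G n))) (h A) = cmod (h (A o\<^sub>L Q))"
      by (simp add: dist_norm)
    also have "\<dots> \<le> c * e"
      using N[OF that] e by (intro h_bound AQ) (auto simp: Q_def)
    also have "\<dots> < (c + 1) * e"
      using e by (intro mult_strict_right_mono) auto
    also have "\<dots> = r"
      using c by (simp add: e_def)
    finally show ?thesis .
  qed
  then show "\<exists>N. \<forall>n\<ge>N. dist (h (A o\<^sub>L proj (G n))) (h A) < r" by blast
qed

lemma h_compose_proj_measurable:
  assumes "D \<in> bop"
  shows "mu_measurable M (\<lambda>t. h ((C t o\<^sub>L D) o\<^sub>L proj (G n)))"
    and "integrable M (\<lambda>t. h ((C t o\<^sub>L D) o\<^sub>L proj (G n)))"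
proof -
  obtain w where w: "\<And>u g. h (rank1 u g) = cinner u (w g)"
    using h_rank1 by blast
  have eq: "h ((C t o\<^sub>L D) o\<^sub>L proj (G n)) = (\<Sum>g\<in>G n. cinner (C t (D g)) (w g))" if "t \<in> space M" for t
    by (subst compose_proj_eq[OF bop_compose[OF C_bop[OF that] assms]])
      (simp add: h_sum[OF rank1_ideal] w)
  show "mu_measurable M (\<lambda>t. h ((C t o\<^sub>L D) o\<^sub>L proj (G n)))"
    by (subst mu_measurable_cong[OF cm eq]) (auto intro: mu_measurable_sum[OF cm] meas)
  show "integrable M (\<lambda>t. h ((C t o\<^sub>L D) o\<^sub>L proj (G n)))"
    by (subst Bochner_Integration.integrable_cong[OF refl eq])
      (auto intro: Bochner_Integration.integrable_sum integrable_C)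
qed

text \<open>On truncations \<open>h\<close> is a finite sum of matrix entries, and \<open>Z\<close>
  is defined by integrating each entry.\<close>

lemma h_weighted_integral:
  fixes \<theta> :: "'t \<Rightarrow> complex"
  assumes D: "D \<in> bop" and th: "\<theta> \<in> borel_measurable M" "\<And>t. cmod (\<theta> t) \<le> 1"
    and Z: "Z \<in> bop" "\<And>x y. cinner (Z x) y = (LINT t|M. \<theta> t * cinner (C t x) y)"
  shows "(LINT t|M. \<theta> t * h ((C t o\<^sub>L D) o\<^sub>L proj (G n))) = h ((Z o\<^sub>L D) o\<^sub>L proj (G n))"
proof -
  obtain w where w: "\<And>u g. h (rank1 u g) = cinner u (w g)"
    using h_rank1 by blast
  have eq: "h ((W o\<^sub>L D) o\<^sub>L proj (G n)) = (\<Sum>g\<in>G n. cinner (W (D g)) (w g))" if "W \<in> bop" for W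
    by (subst compose_proj_eq[OF bop_compose[OF that D]]) (simp add: h_sum[OF rank1_ideal] w)
  have "(LINT t|M. \<theta> t * h ((C t o\<^sub>L D) o\<^sub>L proj (G n)))
      = (LINT t|M. (\<Sum>g\<in>G n. \<theta> t * cinner (C t (D g)) (w g)))"
    by (rule Bochner_Integration.integral_cong[OF refl]) (simp add: eq C_bop sum_distrib_left)
  also have "\<dots> = (\<Sum>g\<in>G n. LINT t|M. \<theta> t * cinner (C t (D g)) (w g))"
    by (rule Bochner_Integration.integral_sum) (rule weighted_integral(1)[OF th])
  also have "\<dots> = h ((Z o\<^sub>L D) o\<^sub>L proj (G n))"
    by (simp add: eq[OF Z(1)] Z(2))
  finally show ?thesis .
qed

text \<open>After truncation by a projection, \<open>h\<close> is a finite combination of matrix entries, so its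
  absolute value can be integrated by moving a phase into the weak integral.\<close>

lemma h_nn_integral_le:
  assumes D: "D \<in> bop" "norm D \<le> 1" and \<tau>: "0 \<le> \<tau>" "gnorm \<Phi> (adj D o\<^sub>L (T o\<^sub>L D)) \<le> ennreal \<tau>"
  shows "(\<integral>\<^sup>+t. ennreal (cmod (h (C t o\<^sub>L D))) \<partial>M) \<le> ennreal (c * (K * \<tau> powr (1 / p)))"
proof -
  define B where "B = K * \<tau> powr (1 / p)"
  have B: "0 \<le> B" using K by (simp add: B_def)
  define k where "k n t = h ((C t o\<^sub>L D) o\<^sub>L proj (G n))" for n t
  have kb: "k n \<in> borel_measurable M" and ki: "integrable M (k n)" for n
    using h_compose_proj_measurable[OF D(1)] mu_measurable_borel[OF cm] by (auto simp: k_def[abs_def])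
  have trunc: "(\<integral>\<^sup>+t. ennreal (cmod (k n t)) \<partial>M) \<le> ennreal (c * B)" for n
  proof -
    \<comment> \<open>The conjugate phase of \<open>k n t\<close>. Where \<open>k n t\<close>
      vanishes, division by zero gives 0, which is harmless there.\<close>
    define \<theta> where "\<theta> t = cnj (k n t) / of_real (cmod (k n t))" for t
    have "cnj \<in> borel_measurable borel"
      by (intro borel_measurable_continuous_onI continuous_intros)
    then have [measurable]: "(\<lambda>t. cnj (k n t)) \<in> borel_measurable M" "k n \<in> borel_measurable M"
      using measurable_compose[OF kb[of n]] kb by auto
    have "\<theta> \<in> borel_measurable M"
      unfolding \<theta>_def by measurable
    moreover have "cmod (\<theta> t) \<le> 1" for t
      by (simp add: \<theta>_def norm_divide)
    ultimately have th: "\<theta> \<in> borel_measurable M" "\<And>t. cmod (\<theta> t) \<le> 1" by auto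
    obtain Z where Z: "Z \<in> bop" "\<And>x y. cinner (Z x) y = (LINT t|M. \<theta> t * cinner (C t x) y)"
      "\<And>D \<tau>. D \<in> bop \<Longrightarrow> norm D \<le> 1 \<Longrightarrow> 0 \<le> \<tau> \<Longrightarrow> gnorm \<Phi> (adj D o\<^sub>L (T o\<^sub>L D)) \<le> ennreal \<tau> \<Longrightarrow>
        gnorm \<Psi> (Z o\<^sub>L D) \<le> ennreal (K * \<tau> powr (1 / p))"
      using weighted_operator[OF th] by blast
    have "\<theta> t * k n t = of_real (cmod (k n t))" for t
      by (cases "k n t = 0")
        (simp_all add: \<theta>_def complex_norm_square[symmetric] power2_eq_square mult.commute[of "cnj _"])
    then have "complex_of_real (LINT t|M. cmod (k n t)) = (LINT t|M. \<theta> t * k n t)"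
      by simp
    also have "\<dots> = h ((Z o\<^sub>L D) o\<^sub>L proj (G n))"
      unfolding k_def by (rule h_weighted_integral[OF D(1) th Z(1,2)])
    finally have eq: "(LINT t|M. cmod (k n t)) = Re (h ((Z o\<^sub>L D) o\<^sub>L proj (G n)))"
      by (metis Re_complex_of_real)
    have "cmod (h ((Z o\<^sub>L D) o\<^sub>L proj (G n))) \<le> c * B"
    proof (rule h_bound[OF _ _ B])
      show "(Z o\<^sub>L D) o\<^sub>L proj (G n) \<in> sn_ideal0 \<Psi>"
        by (intro finite_rank_sn_ideal0[OF sn_Psi] finite_rank_compose_left finite_rank_proj G
            bop_compose Z D)
      show "gnorm \<Psi> ((Z o\<^sub>L D) o\<^sub>L proj (G n)) \<le> ennreal B"
        unfolding B_def
        by (rule order_trans[OF gnorm_compose_right[OF sn_Psi proj_bop norm_proj_blinfun_le[OF G(1)]]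
              Z(3)[OF D \<tau>]])
    qed
    then have "(LINT t|M. cmod (k n t)) \<le> c * B"
      unfolding eq using complex_Re_le_cmod order_trans by blast
    moreover have "(\<integral>\<^sup>+t. ennreal (cmod (k n t)) \<partial>M) = ennreal (LINT t|M. cmod (k n t))"
      by (rule nn_integral_eq_integral) (use ki in auto)
    ultimately show ?thesis
      by (simp add: ennreal_leI)
  qed
  \<comment> \<open>Fatou's lemma passes the bound, which does not depend on \<open>n\<close>, to
    the limit of the truncations.\<close>
  have "(\<integral>\<^sup>+t. ennreal (cmod (h (C t o\<^sub>L D))) \<partial>M) = (\<integral>\<^sup>+t. liminf (\<lambda>n. ennreal (cmod (k n t))) \<partial>M)"
  proof (rule nn_integral_cong)
    fix t assume t: "t \<in> space M"
    have "(\<lambda>n. ennreal (cmod (k n t))) \<longlonglongrightarrow> ennreal (cmod (h (C t o\<^sub>L D)))"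
      unfolding k_def
      by (intro tendsto_ennrealI tendsto_norm h_tendsto sn_ideal0_compose_right[OF sn_Psi C[OF t] D])
    then show "ennreal (cmod (h (C t o\<^sub>L D))) = liminf (\<lambda>n. ennreal (cmod (k n t)))"
      by (intro lim_imp_Liminf[symmetric]) auto
  qed
  also have "\<dots> \<le> liminf (\<lambda>n. \<integral>\<^sup>+t. ennreal (cmod (k n t)) \<partial>M)"
    by (rule nn_integral_liminf) (use kb in measurable)
  also have "\<dots> \<le> ennreal (c * B)"
    by (intro Liminf_le) (auto simp: trunc)
  finally show ?thesis unfolding B_def .
qed

lemma h_measurable: "mu_measurable M (\<lambda>t. h (C t))"
proof (rule mu_measurable_limit[OF cm])
  show "mu_measurable M (\<lambda>t. h ((C t o\<^sub>L id_blinfun) o\<^sub>L proj (G n)))" for n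
    by (rule h_compose_proj_measurable(1)[OF bop_id])
  show "(\<lambda>n. h ((C t o\<^sub>L id_blinfun) o\<^sub>L proj (G n))) \<longlonglongrightarrow> h (C t)" if "t \<in> space M" for t
    using h_tendsto[OF C[OF that]] by (simp add: blinfun_compose_id_right)
qed

lemma h_nn_integral_full:
  "(\<integral>\<^sup>+t. ennreal (cmod (h (C t))) \<partial>M) \<le> ennreal (c * (K * enn2real (gnorm \<Phi> T) powr (1 / p)))"
proof -
  have n: "norm (id_blinfun :: 'h \<Rightarrow>\<^sub>L 'h) \<le> 1"
    by (rule norm_blinfun_bound) auto
  have "gnorm \<Phi> (adj id_blinfun o\<^sub>L (T o\<^sub>L id_blinfun)) \<le> gnorm \<Phi> T"
    using gnorm_conjugate_le[OF sn bop_id n, of T] by (simp add: blinfun_compose_id_right)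
  also have "\<dots> = ennreal (enn2real (gnorm \<Phi> T))"
    using sn_ideal0_finite[OF sn T(2)] by simp
  finally show ?thesis
    using h_nn_integral_le[OF bop_id n enn2real_nonneg] by (simp add: blinfun_compose_id_right)
qed

lemma h_integrable: "integrable M (\<lambda>t. h (C t))"
  by (rule integrableI_bounded[OF mu_measurable_borel[OF cm h_measurable]])
    (rule le_less_trans[OF h_nn_integral_full], simp)

end

text \<open>\<open>T\<close> lies in the closure of the finite-rank operators, so its right tails
  are small, and the contraction on the left does no harm. The bound is a p-th power so that the
  root in \<open>weighted_operator\<close> returns \<open>K * d\<close>.\<close>

lemma small_conjugate:
  assumes "0 < d"
  shows "\<exists>n. gnorm \<Phi> (adj (id_blinfun - proj (G n)) o\<^sub>L (T o\<^sub>L (id_blinfun - proj (G n)))) \<le> ennreal (d powr p)"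
proof -
  have "0 < d powr p" using assms by simp
  then obtain n where n: "gnorm \<Phi> (T o\<^sub>L (id_blinfun - proj (G n))) \<le> ennreal (d powr p)"
    using gnorm_diff_proj_small[OF sn T(2) G] by blast
  show ?thesis
    using gnorm_conjugate_le[OF sn bop_diff[OF bop_id proj_bop] norm_id_minus_proj_le[OF G(1)], where T = T] n
      order_trans by blast
qed

text \<open>The integral over \<open>E\<close> is the weak integral with the indicator as weight.
  Its truncations have finite rank and its tails are small, which puts it into the closure; the
  identity for \<open>h\<close> holds on truncations, and the tails on both sides are small.\<close>

lemma pettis_integrable_C: "pettis_integrable M (sn_ideal0 \<Psi>) (sn_norm \<Psi>) C"
  unfolding pettis_integrable_def
proof (intro conjI ballI)
  fix h :: "('h \<Rightarrow>\<^sub>L 'h) \<Rightarrow> complex" assume h: "h \<in> dual_space (sn_ideal0 \<Psi>) (sn_norm \<Psi>)"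
  then obtain c0 where c0: "\<forall>u\<in>sn_ideal0 \<Psi>. cmod (h u) \<le> c0 * sn_norm \<Psi> u"
    by (auto simp: dual_space_def)
  \<comment> \<open>The constant in \<open>dual_space\<close> may be negative; the maximum with 0
    makes it usable.\<close>
  have hc: "\<forall>u\<in>sn_ideal0 \<Psi>. cmod (h u) \<le> max 0 c0 * sn_norm \<Psi> u"
  proof
    fix u :: "'h \<Rightarrow>\<^sub>L 'h" assume "u \<in> sn_ideal0 \<Psi>"
    then have "cmod (h u) \<le> c0 * sn_norm \<Psi> u" using c0 by blast
    also have "\<dots> \<le> max 0 c0 * sn_norm \<Psi> u"
      by (intro mult_right_mono) (auto simp: sn_norm_def)
    finally show "cmod (h u) \<le> max 0 c0 * sn_norm \<Psi> u" .
  qed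
  show "mu_measurable M (\<lambda>t. h (C t))" "integrable M (\<lambda>t. h (C t))"
    using h_measurable[OF h _ hc] h_integrable[OF h _ hc] by auto
next
  fix E assume E: "E \<in> sets M"
  define \<theta> where "\<theta> t = (indicator E t :: complex)" for t
  have th: "\<theta> \<in> borel_measurable M" "\<And>t. cmod (\<theta> t) \<le> 1"
    using E by (auto simp: \<theta>_def[abs_def] indicator_def)
  obtain Z where Z: "Z \<in> bop" "\<And>x y. cinner (Z x) y = (LINT t|M. \<theta> t * cinner (C t x) y)"
    "\<And>D \<tau>. D \<in> bop \<Longrightarrow> norm D \<le> 1 \<Longrightarrow> 0 \<le> \<tau> \<Longrightarrow> gnorm \<Phi> (adj D o\<^sub>L (T o\<^sub>L D)) \<le> ennreal \<tau> \<Longrightarrow>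
      gnorm \<Psi> (Z o\<^sub>L D) \<le> ennreal (K * \<tau> powr (1 / p))"
    using weighted_operator[OF th] by blast
  define P where "P n = proj (G n)" for n
  define Q where "Q n = id_blinfun - P n" for n
  have Q: "Q n \<in> bop" "norm (Q n) \<le> 1" for n
    unfolding Q_def P_def by (intro bop_diff bop_id proj_bop, rule norm_id_minus_proj_le[OF G(1)])
  have P: "P n \<in> bop" "norm (P n) \<le> 1" "finite_rank (P n)" for n
    unfolding P_def using proj_bop norm_proj_blinfun_le[OF G(1)] finite_rank_proj[OF G(1)] by auto
  have split: "W = (W o\<^sub>L P n) + (W o\<^sub>L Q n)" for W :: "'h \<Rightarrow>\<^sub>L 'h" and n
    by (auto intro!: blinfun_eqI simp: Q_def blinfun.add_left blinfun.diff_left blinfun.diff_right)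
  \<comment> \<open>One \<open>n\<close> serves two purposes: the second bound is the tail of
    \<open>Z\<close>, the first controls the tail of the integrand through
    \<open>h_nn_integral_le\<close>.\<close>
  have small: "\<exists>n. gnorm \<Phi> (adj (Q n) o\<^sub>L (T o\<^sub>L Q n)) \<le> ennreal (d powr p) \<and>
      gnorm \<Psi> (Z o\<^sub>L Q n) \<le> ennreal (K * d)" if d: "0 < d" for d
  proof -
    obtain n where n: "gnorm \<Phi> (adj (Q n) o\<^sub>L (T o\<^sub>L Q n)) \<le> ennreal (d powr p)"
      using small_conjugate[OF d] by (auto simp: Q_def P_def)
    have "gnorm \<Psi> (Z o\<^sub>L Q n) \<le> ennreal (K * (d powr p) powr (1 / p))"
      by (rule Z(3)[OF Q _ n]) simp
    then show ?thesis
      using n d p by (auto simp: powr_powr)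
  qed
  have ZX: "Z \<in> sn_ideal0 \<Psi>"
    unfolding sn_ideal0_iff[OF sn_Psi]
  proof (intro conjI allI impI Z(1))
    fix e :: real assume e: "e > 0"
    define d where "d = e / (K + 1)"
    have d: "d > 0" using e K by (simp add: d_def)
    obtain n where n: "gnorm \<Psi> (Z o\<^sub>L Q n) \<le> ennreal (K * d)"
      using small[OF d] by blast
    have "K * d < (K + 1) * d"
      using d by (intro mult_strict_right_mono) auto
    also have "\<dots> = e" using K by (simp add: d_def)
    finally have "ennreal (K * d) < ennreal e"
      using e by (intro ennreal_lessI)
    moreover have "Z - (Z o\<^sub>L P n) = Z o\<^sub>L Q n"
      using split[of Z n] by (metis add_diff_cancel_left')
    ultimately show "\<exists>F. finite_rank F \<and> gnorm \<Psi> (Z - F) < ennreal e"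
      using n finite_rank_compose_left[OF P(3) Z(1)] by (metis le_less_trans)
  qed
  have "h Z = (LINT t:E|M. h (C t))" if h: "h \<in> dual_space (sn_ideal0 \<Psi>) (sn_norm \<Psi>)"
    for h :: "('h \<Rightarrow>\<^sub>L 'h) \<Rightarrow> complex"
  proof -
    obtain c0 where c0: "\<forall>u\<in>sn_ideal0 \<Psi>. cmod (h u) \<le> c0 * sn_norm \<Psi> u"
      using h by (auto simp: dual_space_def)
    define c where "c = max 0 c0"
    have c: "0 \<le> c" by (simp add: c_def)
    have hc: "\<forall>u\<in>sn_ideal0 \<Psi>. cmod (h u) \<le> c * sn_norm \<Psi> u"
    proof
      fix u :: "'h \<Rightarrow>\<^sub>L 'h" assume "u \<in> sn_ideal0 \<Psi>"
      then have "cmod (h u) \<le> c0 * sn_norm \<Psi> u" using c0 by blast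
      also have "\<dots> \<le> c * sn_norm \<Psi> u"
        by (intro mult_right_mono) (auto simp: sn_norm_def c_def)
      finally show "cmod (h u) \<le> c * sn_norm \<Psi> u" .
    qed
    note hadd = h_add[OF h c hc]
    have hsplit: "h W = h (W o\<^sub>L P n) + h (W o\<^sub>L Q n)" if "W \<in> sn_ideal0 \<Psi>" for W n
      using hadd[OF sn_ideal0_compose_right[OF sn_Psi that P(1,2)] sn_ideal0_compose_right[OF sn_Psi that Q]]
        split[of W n] by metis
    have eqP: "(LINT t|M. \<theta> t * h (C t o\<^sub>L P n)) = h (Z o\<^sub>L P n)" for n
      using h_weighted_integral[OF h c hc bop_id th Z(1,2), of n]
      by (simp add: P_def blinfun_compose_id_right)
    have intP: "integrable M (\<lambda>t. h (C t o\<^sub>L P n))" for n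
      using h_compose_proj_measurable(2)[OF h c hc bop_id, of n]
      by (simp add: P_def blinfun_compose_id_right)
    have intC: "integrable M (\<lambda>t. h (C t))"
      by (rule h_integrable[OF h c hc])
    have ith: "integrable M (\<lambda>t. \<theta> t * f t)" if "integrable M f" for f
      by (rule Bochner_Integration.integrable_bound[OF that])
        (use th borel_measurable_integrable[OF that] in \<open>auto simp: norm_mult intro!: AE_I2 mult_left_le_one_le\<close>)
    have set_eq: "(LINT t:E|M. h (C t)) = (LINT t|M. \<theta> t * h (C t))"
      unfolding set_lebesgue_integral_def
      by (rule Bochner_Integration.integral_cong) (auto simp: \<theta>_def indicator_def)
    \<comment> \<open>The truncated parts agree by \<open>eqP\<close> and cancel; each of the two
      tails contributes at most \<open>c * (K * d)\<close>.\<close>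
    have close: "cmod (h Z - (LINT t|M. \<theta> t * h (C t))) \<le> 2 * c * K * d" if d: "0 < d" for d
    proof -
      obtain n where n: "gnorm \<Phi> (adj (Q n) o\<^sub>L (T o\<^sub>L Q n)) \<le> ennreal (d powr p)"
        "gnorm \<Psi> (Z o\<^sub>L Q n) \<le> ennreal (K * d)"
        using small[OF d] by blast
      have "cmod (h (Z o\<^sub>L Q n)) \<le> c * (K * d)"
        by (rule h_bound[OF h c hc sn_ideal0_compose_right[OF sn_Psi ZX Q] n(2)]) (use K d in simp)
      moreover have "cmod (LINT t|M. \<theta> t * h (C t o\<^sub>L Q n)) \<le> c * (K * d)"
      proof -
        have iQ: "integrable M (\<lambda>t. h (C t o\<^sub>L Q n))"
        proof (subst Bochner_Integration.integrable_cong[OF refl])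
          show "h (C t o\<^sub>L Q n) = h (C t) - h (C t o\<^sub>L P n)" if "t \<in> space M" for t
            using hsplit[OF C[OF that], of n] by simp
        qed (intro Bochner_Integration.integrable_diff intC intP)
        have "ennreal (cmod (LINT t|M. \<theta> t * h (C t o\<^sub>L Q n)))
            \<le> (\<integral>\<^sup>+t. ennreal (cmod (\<theta> t * h (C t o\<^sub>L Q n))) \<partial>M)"
          by (rule integral_norm_bound_ennreal[OF ith[OF iQ]])
        also have "\<dots> \<le> (\<integral>\<^sup>+t. ennreal (cmod (h (C t o\<^sub>L Q n))) \<partial>M)"
          using th(2) by (intro nn_integral_mono ennreal_leI) (auto simp: norm_mult intro!: mult_left_le_one_le)
        also have "\<dots> \<le> ennreal (c * (K * (d powr p) powr (1 / p)))"
          by (rule h_nn_integral_le[OF h c hc Q _ n(1)]) simp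
        also have "(d powr p) powr (1 / p) = d"
          using d p by (simp add: powr_powr)
        finally show ?thesis
          using c K d by (subst (asm) ennreal_le_iff) auto
      qed
      moreover have "h Z - (LINT t|M. \<theta> t * h (C t)) = h (Z o\<^sub>L Q n) - (LINT t|M. \<theta> t * h (C t o\<^sub>L Q n))"
      proof -
        have "(LINT t|M. \<theta> t * h (C t o\<^sub>L Q n)) = (LINT t|M. \<theta> t * h (C t) - \<theta> t * h (C t o\<^sub>L P n))"
        proof (rule Bochner_Integration.integral_cong[OF refl])
          fix t assume t: "t \<in> space M"
          show "\<theta> t * h (C t o\<^sub>L Q n) = \<theta> t * h (C t) - \<theta> t * h (C t o\<^sub>L P n)"
            by (subst hsplit[OF C[OF t], of n]) (simp add: algebra_simps)
        qed
        also have "\<dots> = (LINT t|M. \<theta> t * h (C t)) - (LINT t|M. \<theta> t * h (C t o\<^sub>L P n))"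
          by (rule Bochner_Integration.integral_diff[OF ith[OF intC] ith[OF intP]])
        finally show ?thesis
          using hsplit[OF ZX, of n] by (simp add: eqP)
      qed
      ultimately show ?thesis
        using norm_triangle_ineq4[of "h (Z o\<^sub>L Q n)" "LINT t|M. \<theta> t * h (C t o\<^sub>L Q n)"] by simp
    qed
    have "cmod (h Z - (LINT t|M. \<theta> t * h (C t))) \<le> 0"
    proof (rule field_le_epsilon)
      fix e :: real assume e: "e > 0"
      define d where "d = e / (2 * c * K + 1)"
      have pos: "0 < 2 * c * K + 1" using c K by (simp add: add_nonneg_pos)
      have d: "d > 0" using e pos by (simp add: d_def)
      have "2 * c * K * d \<le> (2 * c * K + 1) * d"
        using d by (intro mult_right_mono) auto
      also have "\<dots> = e" using pos by (simp add: d_def)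
      finally show "cmod (h Z - (LINT t|M. \<theta> t * h (C t))) \<le> 0 + e"
        using close[OF d] by simp
    qed
    then show ?thesis
      unfolding set_eq by simp
  qed
  then show "\<exists>v\<in>sn_ideal0 \<Psi>. \<forall>h\<in>dual_space (sn_ideal0 \<Psi>) (sn_norm \<Psi>). h v = (LINT t:E|M. h (C t))"
    using ZX by blast
qed (rule C)

text \<open>Scaling to norm one, with two points of care: the real supremum in
  \<open>dual_norm\<close> has to be bounded above, and on elements of norm 0 the functional
  vanishes by its continuity bound.\<close>

lemma dual_norm_bound:
  fixes h :: "('h \<Rightarrow>\<^sub>L 'h) \<Rightarrow> complex"
  assumes h: "h \<in> dual_space (sn_ideal0 \<Psi>) (sn_norm \<Psi>)" and u: "u \<in> sn_ideal0 \<Psi>"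
  shows "cmod (h u) \<le> dual_norm (sn_ideal0 \<Psi>) (sn_norm \<Psi>) h * sn_norm \<Psi> u"
proof -
  obtain c0 where c0: "\<And>u. u \<in> sn_ideal0 \<Psi> \<Longrightarrow> cmod (h u) \<le> c0 * sn_norm \<Psi> u"
    using h unfolding dual_space_def by blast
  have nn: "0 \<le> sn_norm \<Psi> u" for u :: "'h \<Rightarrow>\<^sub>L 'h" by (simp add: sn_norm_def)
  show ?thesis
  proof (cases "sn_norm \<Psi> u = 0")
    case True
    then show ?thesis using c0[OF u] by simp
  next
    case False
    define a where "a = 1 / sn_norm \<Psi> u"
    have a: "a > 0" using False nn[of u] by (simp add: a_def)
    define v where "v = of_real a *\<^sub>C u"
    have "sn_norm \<Psi> v = a * sn_norm \<Psi> u"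
      unfolding v_def sn_norm_scale[OF sn_Psi u] using a by simp
    then have v: "v \<in> sn_ideal0 \<Psi>" "sn_norm \<Psi> v = 1"
      using False by (simp_all add: v_def sn_ideal0_scale[OF sn_Psi u] a_def)
    have bdd: "bdd_above ((\<lambda>u. cmod (h u)) ` {u \<in> sn_ideal0 \<Psi>. sn_norm \<Psi> u \<le> 1})"
    proof (rule bdd_aboveI2)
      fix w :: "'h \<Rightarrow>\<^sub>L 'h" assume "w \<in> {u \<in> sn_ideal0 \<Psi>. sn_norm \<Psi> u \<le> 1}"
      then have "cmod (h w) \<le> c0 * sn_norm \<Psi> w" "sn_norm \<Psi> w \<le> 1" using c0 by auto
      then show "cmod (h w) \<le> max 0 c0"
        using mult_right_mono[of c0 "max 0 c0" "sn_norm \<Psi> w"] nn[of w]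
          mult_left_mono[of "sn_norm \<Psi> w" 1 "max 0 c0"] by simp
    qed
    have "cmod (h v) \<le> dual_norm (sn_ideal0 \<Psi>) (sn_norm \<Psi>) h"
      unfolding dual_norm_def by (rule cSUP_upper[OF _ bdd]) (use v in simp)
    moreover have "h v = of_real a * h u"
      using h u unfolding v_def dual_space_def by blast
    ultimately have "a * cmod (h u) \<le> dual_norm (sn_ideal0 \<Psi>) (sn_norm \<Psi>) h"
      using a by (simp add: norm_mult)
    then show ?thesis
      using nn[of u] False by (simp add: a_def field_simps)
  qed
qed

lemma pettis_norm_C_le:
  "pettis_norm M (sn_ideal0 \<Psi>) (sn_norm \<Psi>) C \<le> ennreal (K * enn2real (gnorm \<Phi> T) powr (1 / p))"
  unfolding pettis_norm_def
proof (rule SUP_least)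
  fix h :: "('h \<Rightarrow>\<^sub>L 'h) \<Rightarrow> complex" assume "h \<in> {h \<in> dual_space (sn_ideal0 \<Psi>) (sn_norm \<Psi>). dual_norm (sn_ideal0 \<Psi>) (sn_norm \<Psi>) h = 1}"
  then have h: "h \<in> dual_space (sn_ideal0 \<Psi>) (sn_norm \<Psi>)" "dual_norm (sn_ideal0 \<Psi>) (sn_norm \<Psi>) h = 1"
    by auto
  then have "\<forall>u\<in>sn_ideal0 \<Psi>. cmod (h u) \<le> 1 * sn_norm \<Psi> u"
    using dual_norm_bound[OF h(1)] by simp
  from h_nn_integral_full[OF h(1) zero_le_one this]
  show "(\<integral>\<^sup>+t. ennreal (cmod (h (C t))) \<partial>M) \<le> ennreal (K * enn2real (gnorm \<Phi> T) powr (1 / p))"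
    by simp
qed

end

text \<open>The functionals \<open>Y \<mapsto> \<Sum> c\<^sub>k \<langle>Y v\<^sub>k, u\<^sub>k\<rangle>\<close>, built from a Schmidt decomposition of \<open>T\<close> and a
  norming functional of the truncated singular value sequence, have norm one.\<close>

lemma gnorm_weak_integral_le_pettis_norm:
  fixes S :: "'t \<Rightarrow> 'h::complex_hilbert \<Rightarrow>\<^sub>L 'h"
  assumes sn: "sn_function \<Phi>" and T: "T \<in> sn_ideal0 \<Phi>"
    and int: "\<And>x y. integrable M (\<lambda>t. cinner (S t x) y)"
    and TI: "\<And>x y. cinner (T x) y = (LINT t|M. cinner (S t x) y)"
  shows "gnorm \<Phi> T \<le> pettis_norm M (sn_ideal0 \<Phi>) (sn_norm \<Phi>) S"
proof -
  have comp: "compact_op T" by (rule sn_ideal0_compact[OF sn T])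
  define s where "s = sing_val T"
  obtain u v where s: "antimono s" "\<And>n. 0 \<le> s n" "bessel u" "bessel v" "\<And>n. cinner (T (v n)) (u n) = of_real (s n)"
    "\<And>m n. m \<noteq> n \<Longrightarrow> cinner (v m) (v n) = 0"
    "\<And>n. of_real (s n) * (cinner (v n) (v n) * cinner (u n) (u n)) = of_real (s n)"
    unfolding s_def by (rule schmidt_decomposition[OF comp]) blast
  have "ennreal (\<Phi> (\<lambda>k. if k < n then complex_of_real (s k) else 0)) \<le> pettis_norm M (sn_ideal0 \<Phi>) (sn_norm \<Phi>) S" for n
  \<comment> \<open>If the truncated sequence has norm 0 the claim is trivial; otherwise that norm
    is used as a divisor below.\<close>
  proof (cases "\<Phi> (\<lambda>k. if k < n then complex_of_real (s k) else 0) = 0")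
    case False
    define x where "x k = (if k < n then complex_of_real (s k) else 0)" for k
    have xf: "x \<in> fin_supp" unfolding x_def by (rule fin_supp_restrict)
    define N where "N = \<Phi> x"
    have N: "N > 0"
      using False sn_nonneg[OF sn xf] by (simp add: N_def x_def[abs_def])
    obtain c where c: "\<And>i. 0 \<le> c i" "\<And>i. i \<ge> n \<Longrightarrow> c i = 0" "(\<Sum>i<n. c i * cmod (x i)) = \<Phi> (\<lambda>i. if i < n then x i else 0)"
      "\<And>z. z \<in> fin_supp \<Longrightarrow> (\<Sum>i<n. c i * cmod (z i)) \<le> \<Phi> z"
      by (rule sn_norming_functional[OF sn, of n x]) blast
    have cs: "(\<Sum>k<n. c k * s k) = N"
    proof -
      have "(\<Sum>k<n. c k * s k) = (\<Sum>k<n. c k * cmod (x k))"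
        by (rule sum.cong) (use s(2) in \<open>auto simp: x_def\<close>)
      also have "\<dots> = \<Phi> (\<lambda>i. if i < n then x i else 0)" by (rule c(3))
      also have "(\<lambda>i. if i < n then x i else 0) = x" by (auto simp: x_def)
      finally show ?thesis by (simp add: N_def)
    qed
    define h where "h Y = (\<Sum>k<n. of_real (c k) * cinner (blinfun_apply Y (v k)) (u k))" for Y :: "'h \<Rightarrow>\<^sub>L 'h"
    have hle: "cmod (h Y) \<le> 1 * sn_norm \<Phi> Y" if Y: "Y \<in> sn_ideal0 \<Phi>" for Y
    proof -
      define z where "z k = (if k < n then cinner (Y (v k)) (u k) else 0)" for k
      have "cmod (h Y) \<le> (\<Sum>k<n. cmod (of_real (c k) * cinner (Y (v k)) (u k)))"
        unfolding h_def by (rule norm_sum)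
      also have "\<dots> = (\<Sum>k<n. c k * cmod (z k))"
        using c(1) by (intro sum.cong) (auto simp: norm_mult z_def)
      also have "\<dots> \<le> \<Phi> z"
        by (rule c(4)) (simp add: z_def[abs_def] fin_supp_restrict)
      finally have "ennreal (cmod (h Y)) \<le> ennreal (\<Phi> z)"
        by (rule ennreal_leI)
      also have "\<dots> \<le> gnorm \<Phi> Y"
        unfolding z_def by (rule gnorm_upper[OF s(4,3)])
      also have "\<dots> = ennreal (sn_norm \<Phi> Y)"
        by (rule sn_norm_ideal0[OF sn Y, symmetric])
      finally show ?thesis
        by (subst (asm) ennreal_le_iff) (simp_all add: sn_norm_def)
    qed
    have dual: "h \<in> dual_space (sn_ideal0 \<Phi>) (sn_norm \<Phi>)"
      unfolding dual_space_def
    proof (intro CollectI conjI ballI allI)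
      show "h (a + b) = h a + h b" for a b
        by (simp add: h_def blinfun.add_left cinner_add_left distrib_left sum.distrib)
      show "h (r *\<^sub>C a) = r * h a" for r a
        by (simp add: h_def scaleC_blinfun_apply cinner_scaleC_left sum_distrib_left mult_ac)
      show "\<exists>C. \<forall>u\<in>sn_ideal0 \<Phi>. cmod (h u) \<le> C * sn_norm \<Phi> u"
        using hle by blast
    qed
    \<comment> \<open>The Pettis norm ranges over functionals of dual norm exactly 1. This
      normalised partial Schmidt sum has norm at most 1 and \<open>h W = 1\<close>, so the dual norm
      of \<open>h\<close> does not fall below 1.\<close>
    define W where "W = of_real (1 / N) *\<^sub>C (\<Sum>k<n. s k *\<^sub>R rank1 (u k) (v k))"
    have "finite_rank (\<Sum>k<n. s k *\<^sub>R rank1 (u k) (v k))"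
    proof -
      have "(\<Sum>k<n. s k *\<^sub>R rank1 (u k) (v k)) = (\<Sum>k<n. rank1 (s k *\<^sub>R u k) (v k))"
        by (rule sum.cong[OF refl], rule blinfun_eqI)
          (simp add: rank1.rep_eq blinfun.scaleR_left scaleC_scaleR)
      then show ?thesis
        using finite_rank_sum_rank1[of "{..<n}" "\<lambda>k. s k *\<^sub>R u k" v] by simp
    qed
    then have WX: "W \<in> sn_ideal0 \<Phi>"
      unfolding W_def by (intro finite_rank_sn_ideal0[OF sn] finite_rank_scaleC)
    have "ennreal (sn_norm \<Phi> W) \<le> ennreal (1 / N) * ennreal N"
    proof -
      have "cmod (complex_of_real (1 / N)) = 1 / N"
        unfolding norm_of_real using N by simp
      then show ?thesis
        unfolding sn_norm_ideal0[OF sn WX] unfolding W_def gnorm_scale[OF sn]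
        using gnorm_schmidt_sum_le[OF sn s(1,2,3,4), of n]
        by (simp add: N_def x_def[abs_def] mult_left_mono)
    qed
    also have "\<dots> = ennreal 1"
      using N by (simp flip: ennreal_mult)
    finally have W1: "sn_norm \<Phi> W \<le> 1"
      by (subst (asm) ennreal_le_iff) auto
    have "dual_norm (sn_ideal0 \<Phi>) (sn_norm \<Phi>) h = 1"
    proof (rule antisym)
      have le1: "cmod (h Y) \<le> 1" if "Y \<in> {u \<in> sn_ideal0 \<Phi>. sn_norm \<Phi> u \<le> 1}" for Y
        using hle[of Y] that by auto
      show "dual_norm (sn_ideal0 \<Phi>) (sn_norm \<Phi>) h \<le> 1"
        unfolding dual_norm_def using WX W1 le1 by (intro cSUP_least) auto
      have up: "cmod (h W) \<le> dual_norm (sn_ideal0 \<Phi>) (sn_norm \<Phi>) h"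
        unfolding dual_norm_def
        by (rule cSUP_upper) (use WX W1 le1 in \<open>auto intro!: bdd_aboveI2[where M = 1]\<close>)
      show "1 \<le> dual_norm (sn_ideal0 \<Phi>) (sn_norm \<Phi>) h"
      proof -
        have "cinner (W (v k)) (u k) = of_real (1 / N) * of_real (s k)" if "k < n" for k
        proof -
          have "cinner ((\<Sum>j<n. s j *\<^sub>R rank1 (u j) (v j)) (v k)) (u k)
              = (\<Sum>j<n. of_real (s j) * (cinner (v k) (v j) * cinner (u j) (u k)))"
            by (simp add: blinfun.sum_left blinfun.scaleR_left rank1.rep_eq cinner_sum_left cinner_simps)
          also have "\<dots> = (\<Sum>j<n. if j = k then of_real (s k) else 0)"
            by (rule sum.cong) (use s(6)[of k] s(7)[of k] in auto)
          also have "\<dots> = of_real (s k)"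
            using that by simp
          finally show ?thesis
            by (simp only: W_def scaleC_blinfun_apply cinner_scaleC_left)
        qed
        then have "h W = (\<Sum>k<n. of_real (1 / N) * of_real (c k * s k))"
          unfolding h_def by (intro sum.cong) auto
        also have "\<dots> = of_real (1 / N) * of_real (\<Sum>k<n. c k * s k)"
          by (simp only: of_real_sum sum_distrib_left)
        also have "\<dots> = 1"
          unfolding cs using N by simp
        finally show ?thesis
          using up by simp
      qed
    qed
    then have "(\<integral>\<^sup>+t. ennreal (cmod (h (S t))) \<partial>M) \<le> pettis_norm M (sn_ideal0 \<Phi>) (sn_norm \<Phi>) S"
      unfolding pettis_norm_def using dual by (intro SUP_upper) auto
    moreover have "ennreal N \<le> (\<integral>\<^sup>+t. ennreal (cmod (h (S t))) \<partial>M)"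
    proof -
      have ih: "integrable M (\<lambda>t. h (S t))"
        unfolding h_def by (intro Bochner_Integration.integrable_sum integrable_mult_right int)
      have "h T = (LINT t|M. h (S t))"
        unfolding h_def
        by (subst Bochner_Integration.integral_sum) (auto simp: TI int intro!: integrable_mult_right)
      moreover have "h T = of_real N"
        using cs by (simp add: h_def s(5) flip: of_real_mult of_real_sum)
      ultimately have "N = cmod (LINT t|M. h (S t))"
        using N by (metis abs_of_pos norm_of_real)
      then show ?thesis
        using integral_norm_bound_ennreal[OF ih] by simp
    qed
    ultimately show ?thesis
      by (simp add: N_def x_def[abs_def])
  qed simp
  then show ?thesis
    unfolding sn_ext_sing_val[OF sn comp, symmetric] sn_ext_eq_SUP[OF sn] s_def by (rule SUP_least)
qed

text \<open>\<open>Lqs\<close> asks for finiteness at each vector; that the supremum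
  \<open>Lqs_norm\<close> is finite is a uniform boundedness statement. The estimate on the unit
  sphere is then extended to the unit ball.\<close>

lemma Lqs_norm_bound:
  fixes A :: "'t \<Rightarrow> 'h::complex_hilbert \<Rightarrow>\<^sub>L 'h"
  assumes A: "A \<in> Lqs M q" and q: "1 \<le> q"
    and nb: "\<And>f. (\<lambda>t. norm (A t f)) \<in> borel_measurable M"
  obtains K where "0 \<le> K" "Lqs_norm M q A = ennreal K"
    "\<And>f. norm f \<le> 1 \<Longrightarrow> (\<integral>\<^sup>+t. ennreal (norm (A t f) powr q) \<partial>M) \<le> ennreal (K powr q)"
proof -
  define I where "I f = (\<integral>\<^sup>+t. ennreal (norm (A t f) powr q) \<partial>M)" for f
  have fin: "I f < \<infinity>" for f
    using A by (simp add: Lqs_def I_def)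
  \<comment> \<open>The constant \<open>2 powr q\<close> comes from replacing the sum of two norms
    by twice the larger one.\<close>
  have diff: "norm (A t (x - y)) powr q \<le> 2 powr q * (norm (A t x) powr q + norm (A t y) powr q)" for t x y
  proof -
    define m where "m = max (norm (A t x)) (norm (A t y))"
    have "norm (A t (x - y)) \<le> 2 * m"
      using norm_triangle_ineq4[of "A t x" "A t y"] by (simp add: m_def blinfun.diff_right)
    then have "norm (A t (x - y)) powr q \<le> (2 * m) powr q"
      using q by (intro powr_mono2) auto
    also have "\<dots> = 2 powr q * m powr q"
      by (simp add: powr_mult)
    also have "m powr q \<le> norm (A t x) powr q + norm (A t y) powr q"
      by (simp add: m_def max_def)
    finally show ?thesis by (simp add: mult_left_mono)
  qed
  have "\<exists>K\<ge>0. \<forall>f. norm f \<le> 1 \<longrightarrow> I f \<le> ennreal K"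
    unfolding I_def
  proof (rule integral_uniformly_bounded[where c = "2 powr q" and q = q])
    show "(\<lambda>t. ennreal (norm (A t x) powr q)) \<in> borel_measurable M" for x
      using nb[of x] by measurable
    show "(\<lambda>n. ennreal (norm (A t (X n)) powr q)) \<longlonglongrightarrow> ennreal (norm (A t x) powr q)"
      if "X \<longlonglongrightarrow> x" for X x t
      using q by (intro tendsto_ennrealI tendsto_powr' tendsto_norm blinfun.tendsto tendsto_const that) auto
    show "(\<integral>\<^sup>+t. ennreal (norm (A t x) powr q) \<partial>M) < \<infinity>" for x
      using fin by (simp add: I_def)
    show "ennreal (norm (A t (x - y)) powr q)
        \<le> ennreal (2 powr q) * (ennreal (norm (A t x) powr q) + ennreal (norm (A t y) powr q))" for x y t
      using ennreal_leI[OF diff[of t x y]]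
      by (simp only: ennreal_plus ennreal_mult add_nonneg_nonneg powr_ge_zero)
    show "ennreal (norm (A t (r *\<^sub>R x)) powr q) = ennreal (r powr q) * ennreal (norm (A t x) powr q)"
      if "0 < r" for r x t
      using that by (simp add: blinfun.scaleR_right powr_mult ennreal_mult)
  qed simp
  then obtain K1 where K1: "0 \<le> K1" "\<And>f. norm f \<le> 1 \<Longrightarrow> I f \<le> ennreal K1"
    by blast
  have ep: "enn_powr (I f) (1 / q) = ennreal (enn2real (I f) powr (1 / q))" for f
    using fin[of f] by (simp add: enn_powr_def)
  have "Lqs_norm M q A \<le> ennreal (K1 powr (1 / q))"
    unfolding Lqs_norm_def I_def[symmetric]
  proof (rule SUP_least)
    fix f :: 'h assume "f \<in> {f. norm f = 1}"
    then have "enn2real (I f) \<le> K1"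
      using K1(2)[of f] K1(1) by (intro enn2real_leI) auto
    then show "enn_powr (I f) (1 / q) \<le> ennreal (K1 powr (1 / q))"
      unfolding ep using q by (intro ennreal_leI powr_mono2) auto
  qed
  then obtain K where K: "0 \<le> K" "Lqs_norm M q A = ennreal K"
    by (cases "Lqs_norm M q A") (auto simp: top_unique)
  have unit: "I f \<le> ennreal (K powr q)" if "norm f = 1" for f
  proof -
    have "enn_powr (I f) (1 / q) \<le> ennreal K"
      unfolding K(2)[symmetric] Lqs_norm_def I_def[symmetric]
      by (rule SUP_upper) (use that in simp)
    then have "enn2real (I f) powr (1 / q) \<le> K"
      unfolding ep using K(1) by simp
    then have "(enn2real (I f) powr (1 / q)) powr q \<le> K powr q"
      using q by (intro powr_mono2) auto
    then have "enn2real (I f) \<le> K powr q"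
      using q by (simp add: powr_powr)
    then have "ennreal (enn2real (I f)) \<le> ennreal (K powr q)"
      by (rule ennreal_leI)
    moreover have "ennreal (enn2real (I f)) = I f"
      using fin[of f] by simp
    ultimately show ?thesis
      by (simp only:)
  qed
  have "I f \<le> ennreal (K powr q)" if f: "norm f \<le> 1" for f
  proof (cases "f = 0")
    case True
    then show ?thesis by (simp add: I_def)
  next
    case False
    define g where "g = (1 / norm f) *\<^sub>R f"
    have g: "norm g = 1" "f = norm f *\<^sub>R g" using False by (simp_all add: g_def)
    have le: "norm (A t f) \<le> norm (A t g)" for t
      by (subst g(2)) (use f in \<open>simp add: blinfun.scaleR_right mult_left_le_one_le\<close>)
    have "I f \<le> I g"
      unfolding I_def using le q by (intro nn_integral_mono ennreal_leI powr_mono2) auto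
    then show ?thesis
      using unit[OF g(1)] by simp
  qed
  then show ?thesis
    using that[OF K] by (simp add: I_def)
qed

lemma enn_powr_ge: "ennreal (r :: real) \<le> x \<Longrightarrow> 0 \<le> r \<Longrightarrow> 0 < a \<Longrightarrow> ennreal (r powr a) \<le> enn_powr x a"
  by (cases x) (auto simp: enn_powr_def intro!: ennreal_leI powr_mono2)

theorem theorem5p3:
  fixes M :: "'t measure"
    and \<Phi> :: "(nat \<Rightarrow> complex) \<Rightarrow> real"
    and p q :: real
    and A B :: "'t \<Rightarrow> 'h::complex_hilbert \<Rightarrow>\<^sub>L 'h"
  assumes "separable_space (euclidean :: 'h topology)"
    and "infinite_dimensional TYPE('h)"
    and "complete_measure M"
    and "sn_function \<Phi>"
    and "1 < q" and "q \<le> 2" and "2 \<le> p" and "1 / p + 1 / q = 1"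
    and "A \<in> Lqs M q"
    and "B \<in> LpG M p"
    and "\<forall>t\<in>space M. B t \<in> sn_ideal0 (p_mod \<Phi> p)"
    and "wstar_integral M (space M) (\<lambda>t. abs_powr (B t) p) \<in> sn_ideal0 \<Phi>"
  shows "pettis_integrable M (sn_ideal0 (p_mod \<Phi> p)) (sn_norm (p_mod \<Phi> p))
           (\<lambda>t. adj (A t) o\<^sub>L B t) \<and>
         pettis_norm M (sn_ideal0 (p_mod \<Phi> p)) (sn_norm (p_mod \<Phi> p))
           (\<lambda>t. adj (A t) o\<^sub>L B t)
         \<le> Lqs_norm M q A *
           enn_powr (pettis_norm M (sn_ideal0 \<Phi>) (sn_norm \<Phi>) (\<lambda>t. abs_powr (B t) p)) (1 / p)"
proof -
  note cm = \<open>complete_measure M\<close> and sn = \<open>sn_function \<Phi>\<close>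
  have p1: "1 \<le> p" "1 < p" and q1: "1 \<le> q"
    using assms by auto
  have snp: "sn_function (p_mod \<Phi> p)"
    by (rule sn_function_p_mod[OF sn p1(1)])
  obtain G :: "nat \<Rightarrow> 'h set" where G: "\<And>n. orthonormal (G n)" "\<And>x. (\<lambda>n. proj (G n) x) \<longlonglongrightarrow> x"
    using separable_projections[OF assms(1)] by blast
  have Aw: "wstar_measurable M A" and Bw: "wstar_measurable M B"
    and Sint: "wstar_integrable M (\<lambda>t. abs_powr (B t) p)"
    using assms by (auto simp: Lqs_def LpG_def)
  have Ab: "A t \<in> bop" and Bb: "B t \<in> bop" if "t \<in> space M" for t
    using Aw Bw that by (auto simp: wstar_measurable_def)
  define T where "T = wstar_integral M (space M) (\<lambda>t. abs_powr (B t) p)"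
  have Spos: "pos_op (abs_powr (B t) p)" if "t \<in> space M" for t
    by (rule pos_op_abs_powr[OF Bb[OF that]]) (use p1 in simp)
  note T = wstar_integral_pos[OF Sint Spos, folded T_def]
  have T0: "T \<in> sn_ideal0 \<Phi>"
    using assms by (simp add: T_def)
  have norm_meas: "(\<lambda>t. norm (W t f)) \<in> borel_measurable M"
    if "wstar_measurable M W" for W :: "'t \<Rightarrow> 'h \<Rightarrow>\<^sub>L 'h" and f
  proof -
    have "(\<lambda>t. cinner (W t f) (W t f)) \<in> borel_measurable M"
      by (rule mu_measurable_borel[OF cm wstar_measurable_cinner_pair[OF cm that that G]])
    then show ?thesis
      unfolding norm_eq_sqrt_cinner by measurable
  qed
  obtain K where K: "0 \<le> K" "Lqs_norm M q A = ennreal K"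
    "\<And>f. norm f \<le> 1 \<Longrightarrow> (\<integral>\<^sup>+t. ennreal (norm (A t f) powr q) \<partial>M) \<le> ennreal (K powr q)"
    using Lqs_norm_bound[OF assms(9) q1 norm_meas[OF Aw]] by blast
  define C where "C t = adj (A t) o\<^sub>L B t" for t
  have CX: "C t \<in> sn_ideal0 (p_mod \<Phi> p)" if "t \<in> space M" for t
    unfolding C_def using assms that by (intro sn_ideal0_compose_left[OF snp] adj_bop Ab) auto
  have Cc: "cinner (C t x) y = cinner (B t x) (A t y)" if "t \<in> space M" for t x y
    by (simp add: C_def cinner_adj_left[OF Ab[OF that]])
  have meas: "mu_measurable M (\<lambda>t. cinner (C t x) y)" for x y
    by (subst mu_measurable_cong[OF cm Cc]) (auto intro: wstar_measurable_cinner_pair[OF cm Aw Bw G])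
  have bd: "(\<integral>\<^sup>+t. ennreal (cmod (cinner (C t x) y)) \<partial>M) \<le> ennreal (K * Re (cinner (T x) x) powr (1 / p))"
    if xy: "norm x \<le> 1" "norm y \<le> 1" for x y
  proof -
    have "(\<integral>\<^sup>+t. ennreal (cmod (cinner (C t x) y)) \<partial>M) \<le> (\<integral>\<^sup>+t. ennreal (norm (B t x) * norm (A t y)) \<partial>M)"
      by (intro nn_integral_mono ennreal_leI) (simp add: Cc cmod_cinner_le)
    also have "\<dots> \<le> ennreal (Re (cinner (T x) x) powr (1 / p) * (K powr q) powr (1 / q))"
    proof (rule nn_integral_Holder[OF p1(2) \<open>1 < q\<close> \<open>1 / p + 1 / q = 1\<close>])
      have "(\<integral>\<^sup>+t. ennreal (norm (B t x) powr p) \<partial>M) \<le> (\<integral>\<^sup>+t. ennreal (Re (cinner (abs_powr (B t) p x) x)) \<partial>M)"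
        using assms(7) xy(1) by (intro nn_integral_mono ennreal_leI norm_powr_le_abs_powr Bb)
      then show "(\<integral>\<^sup>+t. ennreal (norm (B t x) powr p) \<partial>M) \<le> ennreal (Re (cinner (T x) x))"
        by (simp add: T(3))
    qed (use norm_meas Aw Bw K(3)[OF xy(2)] pos_opD[OF T(1)] in auto)
    also have "Re (cinner (T x) x) powr (1 / p) * (K powr q) powr (1 / q) = K * Re (cinner (T x) x) powr (1 / p)"
      using q1 K(1) by (simp add: powr_powr)
    finally show ?thesis .
  qed
  \<comment> \<open>The premises of the two results of the abstract setting, in their order;
    \<open>refl\<close> fixes the norming function there to be
    \<open>p_mod \<Phi> p\<close>.\<close>
  note main = cm sn p1(1) K(1) refl G CX meas T(1) T0 bd
  have "pettis_integrable M (sn_ideal0 (p_mod \<Phi> p)) (sn_norm (p_mod \<Phi> p)) C"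
    by (rule pettis_integrable_C[OF main])
  moreover have "pettis_norm M (sn_ideal0 (p_mod \<Phi> p)) (sn_norm (p_mod \<Phi> p)) C
      \<le> Lqs_norm M q A * enn_powr (pettis_norm M (sn_ideal0 \<Phi>) (sn_norm \<Phi>) (\<lambda>t. abs_powr (B t) p)) (1 / p)"
  proof -
    define \<tau> where "\<tau> = enn2real (gnorm \<Phi> T)"
    have "pettis_norm M (sn_ideal0 (p_mod \<Phi> p)) (sn_norm (p_mod \<Phi> p)) C \<le> ennreal (K * \<tau> powr (1 / p))"
      unfolding \<tau>_def by (rule pettis_norm_C_le[OF main])
    also have "\<dots> = Lqs_norm M q A * ennreal (\<tau> powr (1 / p))"
      using K by (simp add: ennreal_mult)
    also have "\<dots> \<le> Lqs_norm M q A * enn_powr (pettis_norm M (sn_ideal0 \<Phi>) (sn_norm \<Phi>) (\<lambda>t. abs_powr (B t) p)) (1 / p)"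
    \<comment> \<open>The Pettis norm on the right is an extended number; its lower bound by the
      ideal norm of \<open>T\<close> is enough, as the extended power respects it.\<close>
    proof (intro mult_left_mono enn_powr_ge)
      have "ennreal \<tau> = gnorm \<Phi> T"
        using sn_ideal0_finite[OF sn T0] by (simp add: \<tau>_def)
      then show "ennreal \<tau> \<le> pettis_norm M (sn_ideal0 \<Phi>) (sn_norm \<Phi>) (\<lambda>t. abs_powr (B t) p)"
        using gnorm_weak_integral_le_pettis_norm[OF sn T0 wstar_integrable_cinner[OF Sint] T(2)] by simp
    qed (use p1 in \<open>auto simp: \<tau>_def\<close>)
    finally show ?thesis .
  qed
  ultimately show ?thesis
    unfolding C_def by blast
qed

end
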